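(* Let $\{(X_{n,k}^{(1)},X_{n,k}^{(2)}):1\le k\le n,\ n\ge1\}$ be a bivariate Gaussian triangular array with correlations $\rho_0(n)$ and $\rho_{ij}(k,n)$ as described in the context. Suppose that $$\sigma:=\sup_{n\ge2,\ 1\le k<n,\ i,j\in\{1,2\}}|\rho_{ij}(k,n)|<1,$$ let $\alpha\in\left(0,\frac{1-\sigma}{1+\sigma}\right)$ and $I_n:=[n^{\alpha}]$, and assume that $$\lim_{n\to\infty}\ \max_{I_n\le k<n,\ i,j\in\{1,2\}}|\rho_{ij}(k,n)|\ln n=0 .$$ Suppose further that $$\lim_{n\to\infty}(1-\rho_0(n))\ln n=\lambda^2\quad\text{for some }\lambda\in[0,\infty].$$ Then $$\lim_{n\to\infty}\ \sup_{x,y\in\mathbb{R}}\left|\mathbb{P}\left(M_n^{(1)}\le u_n(x),\,M_n^{(2)}\le u_n(y)\right)-H_\lambda(x,y)\right|=0 .$$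
   Context: Array: for each $n\ge1$ the random variables $X_{n,k}^{(i)}$, $1\le k\le n$, $i\in\{1,2\}$, are jointly Gaussian with mean zero and unit variance, and $$\mathrm{corr}(X_{n,k}^{(1)},X_{n,k}^{(2)})=\rho_0(n),\qquad \mathrm{corr}(X_{n,k}^{(i)},X_{n,l}^{(j)})=\rho_{ij}(|k-l|,n)\quad(1\le k\ne l\le n,\ i,j\in\{1,2\}),$$ so these correlations depend on $k,l$ only through $|k-l|$. Maxima: $M_n^{(i)}:=\max_{1\le k\le n}X_{n,k}^{(i)}$, $i\in\{1,2\}$. Normalisation (for $n\ge2$): $u_n(s)=a_ns+b_n$, $s\in\mathbb{R}$, with $a_n=\frac{1}{\sqrt{2\ln n}}$ and $b_n=\sqrt{2\ln n}-\frac{1}{2\sqrt{2\ln n}}\ln(4\pi\ln n)$. Hüsler–Reiss distribution: for $\lambda\in(0,\infty)$, $$H_\lambda(x,y)=\exp\left(-\Phi\left(\lambda+\tfrac{x-y}{2\lambda}\right)e^{-y}-\Phi\left(\lambda+\tfrac{y-x}{2\lambda}\right)e^{-x}\right),\quad x,y\in\mathbb{R},$$ where $\Phi$ is the standard Gaussian distribution function; with $\Lambda(x)=\exp(-e^{-x})$, $H_0(x,y)=\min(\Lambda(x),\Lambda(y))$ and $H_\infty(x,y)=\Lambda(x)\Lambda(y)$. Here $[\cdot]$ denotes the integer part. *)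

theory Defs
  imports "HOL-Probability.Probability"
begin

text \<open>Gaussian laws include the degenerate (one-point) ones, so that jointly Gaussian
  families may have a singular covariance matrix.\<close>

definition gaussian_rv :: "'a measure \<Rightarrow> ('a \<Rightarrow> real) \<Rightarrow> bool" where
  "gaussian_rv M Y \<longleftrightarrow>
     Y \<in> borel_measurable M \<and>
     ((\<exists>m s. s > 0 \<and> distributed M lborel Y (\<lambda>t. ennreal (normal_density m s t))) \<or>
      (\<exists>m. AE \<omega> in M. Y \<omega> = m))"

definition jointly_gaussian :: "'a measure \<Rightarrow> 'i set \<Rightarrow> ('i \<Rightarrow> 'a \<Rightarrow> real) \<Rightarrow> bool" where
  "jointly_gaussian M I Y \<longleftrightarrow>
     finite I \<and> (\<forall>c :: 'i \<Rightarrow> real. gaussian_rv M (\<lambda>\<omega>. \<Sum>i\<in>I. c i * Y i \<omega>))"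

definition correlation :: "'a measure \<Rightarrow> ('a \<Rightarrow> real) \<Rightarrow> ('a \<Rightarrow> real) \<Rightarrow> real" where
  "correlation M Y Z =
     prob_space.expectation M
       (\<lambda>\<omega>. (Y \<omega> - prob_space.expectation M Y) * (Z \<omega> - prob_space.expectation M Z))
     / sqrt (prob_space.variance M Y * prob_space.variance M Z)"

definition row_max :: "(nat \<Rightarrow> nat \<Rightarrow> 'a \<Rightarrow> real) \<Rightarrow> nat \<Rightarrow> 'a \<Rightarrow> real" where
  "row_max Y n \<omega> = Max ((\<lambda>k. Y n k \<omega>) ` {1..n})"

text \<open>The normalisation below is meaningful for \<open>n \<ge> 2\<close> only.\<close>

definition norm_a :: "nat \<Rightarrow> real" where
  "norm_a n = 1 / sqrt (2 * ln (real n))"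

definition norm_b :: "nat \<Rightarrow> real" where
  "norm_b n = sqrt (2 * ln (real n))
     - 1 / (2 * sqrt (2 * ln (real n))) * ln (4 * pi * ln (real n))"

definition norm_u :: "nat \<Rightarrow> real \<Rightarrow> real" where
  "norm_u n s = norm_a n * s + norm_b n"

definition std_normal_cdf :: "real \<Rightarrow> real" where
  "std_normal_cdf = cdf std_normal_distribution"

definition gumbel_cdf :: "real \<Rightarrow> real" where
  "gumbel_cdf x = exp (- exp (- x))"

text \<open>Only parameters \<open>0 \<le> lam \<le> \<infinity>\<close> are meaningful.\<close>

definition huesler_reiss :: "ereal \<Rightarrow> real \<Rightarrow> real \<Rightarrow> real" where
  "huesler_reiss lam x y =
     (if lam = 0 then min (gumbel_cdf x) (gumbel_cdf y)
      else if lam = \<infinity> then gumbel_cdf x * gumbel_cdf y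
      else (let l = real_of_ereal lam in
        exp (- std_normal_cdf (l + (x - y) / (2 * l)) * exp (- y)
             - std_normal_cdf (l + (y - x) / (2 * l)) * exp (- x))))"

end

theory Submission
  imports Defs "HOL-Real_Asymp.Real_Asymp"
begin

text \<open>Only characteristic functions of Gaussian vectors are used, so singular covariance matrices
  need no special treatment.  For test functions \<open>\<Prod>k. g\<^sub>k(z\<^sub>k)\<close> whose factors are Fourier transforms of
  integrable \<open>h\<^sub>k\<close>, the expectation is \<open>\<integral> (\<Prod>k. h\<^sub>k(t\<^sub>k)) exp (- t\<^sup>T S t / 2) dt\<close>, and
  differentiating along the segment between two covariance matrices yields the normal comparison inequality,
  first for indicators smoothed by a small Gaussian and then for orthants.  It lets one replace the row by independent
  copies of one pair: lags below \<open>n powr \<alpha>\<close> contribute \<open>n powr (1 + \<alpha> - 2 / (1 + \<sigma>))\<close> up to powers of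
  \<open>ln n\<close>, the others \<open>ln n * max |\<rho>|\<close>.  For independent pairs the exponent \<open>n (1 - p\<^sub>n)\<close> is a tail integral;
  substituting \<open>t = u\<^sub>n(s)\<close> turns the Gaussian density into one dominated by \<open>exp (- s)\<close>, and
  dominated convergence gives the Huesler-Reiss exponent for all \<open>\<lambda>\<close> at once.  Uniformity follows
  by monotonicity on a finite grid.\<close>

section \<open>Gaussian families and their characteristic functions\<close>

text \<open>The obstacle is that \<open>\<rho>0 n\<close> tends to 1 for finite \<open>lam\<close>,
  where the factor \<open>1 / sqrt (1 - R\<^sup>2)\<close> of the comparison inequality explodes.
  The independent pairs therefore keep the correlation inside each pair: both covariance matrices
  agree there, those summands vanish, and bounds below 1 are demanded only at entries that differ.
  Across pairs one of the two entries is 0 and the other has modulus at most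
  \<open>\<sigma> < 1\<close>. The range of \<open>\<alpha>\<close> comes from counting: about
  \<open>n * n powr \<alpha>\<close> pairs of indices have short lag, each weighing
  \<open>exp (- u\<^sup>2 / (1 + \<sigma>))\<close>, and \<open>u\<^sup>2\<close> is close to
  \<open>2 * ln n\<close>; the product decays exactly for
  \<open>\<alpha> < (1 - \<sigma>) / (1 + \<sigma>)\<close>. For long lags there are of order
  \<open>n\<^sup>2\<close> pairs, which only \<open>exp (- u\<^sup>2)\<close> without loss in the
  exponent can absorb; the assumed decay of the correlations keeps
  \<open>exp (\<mu> * u\<^sup>2)\<close> bounded. Uniformity requires the limit law to be monotone
  and Lipschitz with respect to the Gumbel margins; both properties are inherited from the
  probabilities that converge to it.\<close>

lemma fourier_gaussian_kernel:
  fixes v x :: real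
  assumes "v > 0"
  shows "(CLBINT t. complex_of_real (exp (- v * t\<^sup>2 / 2) / (2 * pi)) * iexp (t * x))
     = complex_of_real (normal_density 0 (sqrt v) x)"
proof -
  \<comment> \<open>The substitution by \<open>c * t\<close> with \<open>v * c\<^sup>2 = 1\<close>
    reduces the claim to the characteristic function of the standard normal law.\<close>
  define c where "c = 1 / sqrt v"
  have c: "c > 0" using assms by (simp add: c_def)
  have cc: "v * c\<^sup>2 = 1" using assms by (simp add: c_def power_divide)
  have "(CLBINT t. complex_of_real (exp (- v * t\<^sup>2 / 2) / (2 * pi)) * iexp (t * x))
     = c *\<^sub>R (CLBINT t. complex_of_real (exp (- v * (c * t)\<^sup>2 / 2) / (2 * pi)) * iexp (c * t * x))"
    using lborel_integral_real_affine[of c "\<lambda>t. complex_of_real (exp (- v * t\<^sup>2 / 2) / (2 * pi)) * iexp (t * x)" 0] c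
    by simp
  also have "(CLBINT t. complex_of_real (exp (- v * (c * t)\<^sup>2 / 2) / (2 * pi)) * iexp (c * t * x))
     = (CLBINT t. complex_of_real (1 / sqrt (2 * pi)) * (std_normal_density t *\<^sub>R iexp ((c * x) * t)))"
  proof (intro Bochner_Integration.integral_cong refl)
    fix t :: real
    have "- v * (c * t)\<^sup>2 / 2 = - t\<^sup>2 / 2" using cc by (simp add: power_mult_distrib algebra_simps)
    moreover have "1 / (2 * pi) = 1 / sqrt (2 * pi) * (1 / sqrt (2 * pi))" by simp
    ultimately have "exp (- v * (c * t)\<^sup>2 / 2) / (2 * pi) = 1 / sqrt (2 * pi) * std_normal_density t"
      unfolding std_normal_density_def by (simp add: field_simps)
    then show "complex_of_real (exp (- v * (c * t)\<^sup>2 / 2) / (2 * pi)) * iexp (c * t * x) =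
      complex_of_real (1 / sqrt (2 * pi)) * (std_normal_density t *\<^sub>R iexp ((c * x) * t))"
      by (simp add: scaleR_conv_of_real mult_ac flip: of_real_mult)
  qed
  also have "\<dots> = complex_of_real (1 / sqrt (2 * pi)) * (CLBINT t. std_normal_density t *\<^sub>R iexp ((c * x) * t))"
    by (rule integral_mult_right_zero)
  also have "(CLBINT t. std_normal_density t *\<^sub>R iexp ((c * x) * t)) = char std_normal_distribution (c * x)"
    unfolding char_def by (subst integral_density) auto
  also have "complex_of_real (1 / sqrt (2 * pi)) * char std_normal_distribution (c * x)
     = complex_of_real (1 / sqrt (2 * pi) * exp (- (c * x)\<^sup>2 / 2))"
    by (simp add: char_std_normal_distribution)
  also have "c *\<^sub>R \<dots> = complex_of_real (c / sqrt (2 * pi) * exp (- (c * x)\<^sup>2 / 2))"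
    by (simp add: scaleR_conv_of_real)
  also have "c / sqrt (2 * pi) * exp (- (c * x)\<^sup>2 / 2) = normal_density 0 (sqrt v) x"
    using assms by (simp add: normal_density_def c_def power_mult_distrib power_divide real_sqrt_mult field_simps)
  finally show ?thesis .
qed

lemma integrable_gaussian_kernel_abs_moment:
  fixes v :: real
  assumes "v > 0"
  shows "integrable lborel (\<lambda>t. exp (- v * t\<^sup>2 / 2) * \<bar>t\<bar> ^ j)"
proof -
  have "integrable lborel (\<lambda>t. normal_density 0 (1 / sqrt v) t * \<bar>t - 0\<bar> ^ j * sqrt (2 * pi / v))"
    using assms by (intro integrable_mult_left integrable_normal_moment_abs) auto
  moreover have "normal_density 0 (1 / sqrt v) t * \<bar>t - 0\<bar> ^ j * sqrt (2 * pi / v) = exp (- v * t\<^sup>2 / 2) * \<bar>t\<bar> ^ j" for t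
    using assms by (simp add: normal_density_def power_divide real_sqrt_mult real_sqrt_divide field_simps)
  ultimately show ?thesis by (simp only:)
qed

definition quad_form :: "'i set \<Rightarrow> ('i \<Rightarrow> 'i \<Rightarrow> real) \<Rightarrow> ('i \<Rightarrow> real) \<Rightarrow> real" where
  "quad_form K S t = (\<Sum>k\<in>K. \<Sum>l\<in>K. S k l * (t k * t l))"

text \<open>\<open>S\<close> is fixed only through \<open>quad_form K S\<close>, that is, up to its
  antisymmetric part on \<open>K\<close>; statements that read an off-diagonal entry as a
  correlation ask for symmetry separately.\<close>

definition gaussian_cf :: "'a measure \<Rightarrow> 'i set \<Rightarrow> ('i \<Rightarrow> 'a \<Rightarrow> real) \<Rightarrow> ('i \<Rightarrow> 'i \<Rightarrow> real) \<Rightarrow> bool" where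
  "gaussian_cf N K Z S \<longleftrightarrow> prob_space N \<and> finite K \<and> (\<forall>k\<in>K. Z k \<in> borel_measurable N) \<and>
     (\<forall>t. (CLINT \<omega>|N. iexp (\<Sum>k\<in>K. t k * Z k \<omega>)) = complex_of_real (exp (- quad_form K S t / 2)))"

lemma gaussian_cfD:
  assumes "gaussian_cf N K Z S"
  shows "prob_space N" "finite K" "k \<in> K \<Longrightarrow> Z k \<in> borel_measurable N"
    "(CLINT \<omega>|N. iexp (\<Sum>k\<in>K. t k * Z k \<omega>)) = complex_of_real (exp (- quad_form K S t / 2))"
  using assms by (auto simp: gaussian_cf_def)

text \<open>A characteristic function has modulus at most 1, so
  \<open>exp (- Q / 2) \<le> 1\<close>. This stands in for the positive semidefiniteness of a
  covariance matrix.\<close>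

lemma quad_form_nonneg:
  assumes "gaussian_cf N K Z S"
  shows "quad_form K S t \<ge> 0"
proof -
  interpret prob_space N using gaussian_cfD(1)[OF assms] .
  have "norm (CLINT \<omega>|N. iexp (\<Sum>k\<in>K. t k * Z k \<omega>)) \<le> (\<integral>\<omega>. norm (iexp (\<Sum>k\<in>K. t k * Z k \<omega>)) \<partial>N)"
    by (rule integral_norm_bound)
  also have "\<dots> = 1" by (simp add: prob_space)
  finally show ?thesis unfolding gaussian_cfD(4)[OF assms] by simp
qed

lemma quad_form_linear:
  "quad_form K (\<lambda>k l. a * S k l + b * T k l) t = a * quad_form K S t + b * quad_form K T t"
  by (simp add: quad_form_def sum.distrib sum_distrib_left algebra_simps)

lemma quad_form_scale: "quad_form K S (\<lambda>k. c * t k) = c\<^sup>2 * quad_form K S t"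
  by (simp add: quad_form_def sum_distrib_left power2_eq_square algebra_simps)

lemma measurable_quad_form [measurable]:
  "finite K \<Longrightarrow> quad_form K S \<in> borel_measurable (PiM K (\<lambda>_. lborel))"
  unfolding quad_form_def by (intro borel_measurable_sum) measurable

lemma integral_pair_mult:
  fixes f :: "'a \<Rightarrow> complex" and g :: "'b \<Rightarrow> complex"
  assumes "prob_space N" "prob_space N'" "integrable N f" "integrable N' g"
  shows "(\<integral>z. f (fst z) * g (snd z) \<partial>(N \<Otimes>\<^sub>M N')) = (\<integral>x. f x \<partial>N) * (\<integral>y. g y \<partial>N')"
proof -
  interpret N: prob_space N by fact
  interpret N': prob_space N' by fact
  interpret P: pair_prob_space N N' ..
  have m[measurable]: "f \<in> borel_measurable N" "g \<in> borel_measurable N'" using assms by auto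
  have "integrable (N \<Otimes>\<^sub>M N') (\<lambda>z. f (fst z) * g (snd z))"
    by (rule P.Fubini_integrable) (use assms in \<open>auto simp: norm_mult\<close>)
  from P.integral_fst'[OF this] show ?thesis by simp
qed

text \<open>Square roots of the weights, because covariances are quadratic: every point of the
  segment between \<open>S\<close> and \<open>T\<close> is the covariance of a Gaussian family,
  realised on the product space with independent summands.\<close>

lemma gaussian_cf_mixture:
  assumes X: "gaussian_cf N K X S" and Y: "gaussian_cf N' K Y T" and s: "0 \<le> s" "s \<le> 1"
  shows "gaussian_cf (N \<Otimes>\<^sub>M N') K (\<lambda>k z. sqrt s * X k (fst z) + sqrt (1 - s) * Y k (snd z))
     (\<lambda>k l. s * S k l + (1 - s) * T k l)"
  unfolding gaussian_cf_def
proof (intro conjI allI ballI)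
  interpret N: prob_space N using gaussian_cfD(1)[OF X] .
  interpret N': prob_space N' using gaussian_cfD(1)[OF Y] .
  interpret P: pair_prob_space N N' ..
  show "prob_space (N \<Otimes>\<^sub>M N')" by (rule P.prob_space_axioms)
  show "finite K" using gaussian_cfD(2)[OF X] .
  note [measurable] = gaussian_cfD(3)[OF X] gaussian_cfD(3)[OF Y]
  show "(\<lambda>z. sqrt s * X k (fst z) + sqrt (1 - s) * Y k (snd z)) \<in> borel_measurable (N \<Otimes>\<^sub>M N')"
    if [measurable]: "k \<in> K" for k by measurable
  fix t
  have "(CLINT z|N \<Otimes>\<^sub>M N'. iexp (\<Sum>k\<in>K. t k * (sqrt s * X k (fst z) + sqrt (1 - s) * Y k (snd z))))
     = (CLINT z|N \<Otimes>\<^sub>M N'. iexp (\<Sum>k\<in>K. (sqrt s * t k) * X k (fst z)) * iexp (\<Sum>k\<in>K. (sqrt (1 - s) * t k) * Y k (snd z)))"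
    by (intro Bochner_Integration.integral_cong refl)
       (simp add: sum.distrib algebra_simps flip: exp_add)
  also have "\<dots> = (CLINT z|N. iexp (\<Sum>k\<in>K. (sqrt s * t k) * X k z)) * (CLINT z|N'. iexp (\<Sum>k\<in>K. (sqrt (1 - s) * t k) * Y k z))"
    by (intro integral_pair_mult N.integrable_const_bound[where B=1] N'.integrable_const_bound[where B=1] N.prob_space_axioms N'.prob_space_axioms) auto
  also have "\<dots> = complex_of_real (exp (- quad_form K S (\<lambda>k. sqrt s * t k) / 2)) * complex_of_real (exp (- quad_form K T (\<lambda>k. sqrt (1 - s) * t k) / 2))"
    by (simp only: gaussian_cfD(4)[OF X] gaussian_cfD(4)[OF Y])
  also have "\<dots> = complex_of_real (exp (- quad_form K (\<lambda>k l. s * S k l + (1 - s) * T k l) t / 2))"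
    using s by (simp add: quad_form_scale quad_form_linear flip: of_real_mult exp_add)
  finally show "(CLINT z|N \<Otimes>\<^sub>M N'. iexp (\<Sum>k\<in>K. t k * (sqrt s * X k (fst z) + sqrt (1 - s) * Y k (snd z))))
     = complex_of_real (exp (- quad_form K (\<lambda>k l. s * S k l + (1 - s) * T k l) t / 2))" .
qed

text \<open>Each \<open>g k\<close> is replaced by its Fourier integral, the product becomes one
  integral over \<open>PiM K\<close>, and Fubini moves the expectation onto \<open>iexp\<close>,
  where it is the characteristic function. Integrability comes from \<open>h\<close>, since
  \<open>iexp\<close> has modulus 1.\<close>

lemma expectation_fourier_product:
  fixes h :: "'i \<Rightarrow> real \<Rightarrow> complex"
  assumes Z: "gaussian_cf N K Z S"
    and h: "\<And>k. k \<in> K \<Longrightarrow> integrable lborel (h k)"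
    and g: "\<And>k x. k \<in> K \<Longrightarrow> g k x = (CLBINT t. h k t * iexp (t * x))"
  shows "(CLINT \<omega>|N. \<Prod>k\<in>K. g k (Z k \<omega>))
     = (CLINT t|PiM K (\<lambda>_. lborel). (\<Prod>k\<in>K. h k (t k)) * complex_of_real (exp (- quad_form K S t / 2)))"
proof -
  interpret N: prob_space N using gaussian_cfD(1)[OF Z] .
  have K: "finite K" using gaussian_cfD(2)[OF Z] .
  interpret L: product_sigma_finite "\<lambda>_::'i. lborel :: real measure"
    by standard
  interpret P: sigma_finite_measure "PiM K (\<lambda>_::'i. lborel :: real measure)"
    using L.sigma_finite[OF K] .
  interpret Q: pair_sigma_finite N "PiM K (\<lambda>_::'i. lborel :: real measure)" ..
  note [measurable] = gaussian_cfD(3)[OF Z]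
  have hm[measurable]: "k \<in> K \<Longrightarrow> h k \<in> borel_measurable borel" for k using borel_measurable_integrable[OF h[of k]] by simp
  define H where "H = (\<lambda>t. \<Prod>k\<in>K. h k (t k))"
  have Hm[measurable]: "H \<in> borel_measurable (PiM K (\<lambda>_. lborel))"
    unfolding H_def by measurable
  have Hi: "integrable (PiM K (\<lambda>_. lborel)) H"
    unfolding H_def by (rule L.product_integrable_prod[OF K h])
  have "(CLINT \<omega>|N. \<Prod>k\<in>K. g k (Z k \<omega>)) = (CLINT \<omega>|N. CLINT t|PiM K (\<lambda>_. lborel). H t * iexp (\<Sum>k\<in>K. t k * Z k \<omega>))"
  proof (intro Bochner_Integration.integral_cong refl)
    fix \<omega>
    have i: "integrable lborel (\<lambda>t. h k t * iexp (t * Z k \<omega>))" if "k \<in> K" for k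
      by (rule Bochner_Integration.integrable_bound[OF h[OF that]]) (use that in \<open>auto simp: norm_mult\<close>)
    have "(\<Prod>k\<in>K. g k (Z k \<omega>)) = (\<Prod>k\<in>K. (CLBINT t. h k t * iexp (t * Z k \<omega>)))"
      using g by simp
    also have "\<dots> = (CLINT t|PiM K (\<lambda>_. lborel). \<Prod>k\<in>K. h k (t k) * iexp (t k * Z k \<omega>))"
      using L.product_integral_prod[OF K i] by simp
    also have "(\<lambda>t. \<Prod>k\<in>K. h k (t k) * iexp (t k * Z k \<omega>)) = (\<lambda>t. H t * iexp (\<Sum>k\<in>K. t k * Z k \<omega>))"
      using K by (auto simp: H_def prod.distrib exp_sum sum_distrib_left fun_eq_iff)
    finally show "(\<Prod>k\<in>K. g k (Z k \<omega>)) = (CLINT t|PiM K (\<lambda>_. lborel). H t * iexp (\<Sum>k\<in>K. t k * Z k \<omega>))" .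
  qed
  also have "\<dots> = (CLINT t|PiM K (\<lambda>_. lborel). CLINT \<omega>|N. H t * iexp (\<Sum>k\<in>K. t k * Z k \<omega>))"
  proof (rule Q.Fubini_integral[symmetric], rule Q.Fubini_integrable)
    show "(\<lambda>(\<omega>, t). H t * iexp (\<Sum>k\<in>K. t k * Z k \<omega>)) \<in> borel_measurable (N \<Otimes>\<^sub>M PiM K (\<lambda>_. lborel))"
      by measurable
    show "integrable N (\<lambda>\<omega>. \<integral>t. norm (case (\<omega>, t) of (\<omega>, t) \<Rightarrow> H t * iexp (\<Sum>k\<in>K. t k * Z k \<omega>)) \<partial>PiM K (\<lambda>_. lborel))"
      by (simp add: norm_mult)
    show "AE \<omega> in N. integrable (PiM K (\<lambda>_. lborel)) (\<lambda>t. case (\<omega>, t) of (\<omega>, t) \<Rightarrow> H t * iexp (\<Sum>k\<in>K. t k * Z k \<omega>))"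
      by (intro AE_I2 Bochner_Integration.integrable_bound[OF Hi])
         (auto simp: norm_mult)
  qed
  also have "\<dots> = (CLINT t|PiM K (\<lambda>_. lborel). H t * complex_of_real (exp (- quad_form K S t / 2)))"
    by (simp only: integral_mult_right_zero gaussian_cfD(4)[OF Z])
  finally show ?thesis by (simp add: H_def)
qed

section \<open>Normal comparison\<close>

text \<open>The fundamental theorem of calculus along the segment, as a Bochner integral so that
  Fubini can exchange it with the integral over \<open>t\<close>.\<close>

lemma exp_difference_integral:
  fixes p q :: real
  shows "complex_of_real (exp (- (p + q) / 2) - exp (- p / 2))
     = (CLBINT s. indicator {0..1} s *\<^sub>R complex_of_real (- q / 2 * exp (- (p + s * q) / 2)))"
proof -
  have "(\<integral>s. indicator {0..1} s *\<^sub>R (- q / 2 * exp (- (p + s * q) / 2)) \<partial>lborel)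
     = exp (- (p + 1 * q) / 2) - exp (- (p + 0 * q) / 2)"
  proof (rule integral_FTC_atLeastAtMost)
    show "((\<lambda>s. exp (- (p + s * q) / 2)) has_vector_derivative - q / 2 * exp (- (p + s * q) / 2)) (at s within {0..1})" for s
      unfolding has_real_derivative_iff_has_vector_derivative[symmetric]
      by (auto intro!: derivative_eq_intros)
  qed (auto intro!: continuous_intros)
  then have "complex_of_real (exp (- (p + q) / 2) - exp (- p / 2))
     = complex_of_real (\<integral>s. indicator {0..1} s *\<^sub>R (- q / 2 * exp (- (p + s * q) / 2)) \<partial>lborel)"
    by simp
  also have "\<dots> = (CLBINT s. complex_of_real (indicator {0..1} s *\<^sub>R (- q / 2 * exp (- (p + s * q) / 2))))"
    by (rule integral_complex_of_real[symmetric])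
  finally show ?thesis by (simp add: scaleR_conv_of_real)
qed

lemma norm_fourier_le:
  fixes h :: "real \<Rightarrow> complex"
  assumes "integrable lborel h"
  shows "norm (CLBINT t. h t * iexp (t * x)) \<le> (\<integral>t. norm (h t) \<partial>lborel)"
  using integral_norm_bound[of lborel "\<lambda>t. h t * iexp (t * x)"] by (simp add: norm_mult)

text \<open>Along the segment \<open>s S + (1 - s) T\<close> the derivative of \<open>exp (- Q / 2)\<close> brings down
  \<open>t\<^sub>k t\<^sub>l\<close>, which turns \<open>h\<^sub>k\<close>, \<open>h\<^sub>l\<close> into \<open>h'\<^sub>k\<close>, \<open>h'\<^sub>l\<close>, hence \<open>g\<^sub>k\<close>, \<open>g\<^sub>l\<close> into their derivatives.\<close>

theorem gaussian_comparison_smooth: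
  fixes h h' :: "'i \<Rightarrow> real \<Rightarrow> complex" and g g' :: "'i \<Rightarrow> real \<Rightarrow> complex"
  assumes X: "gaussian_cf N K X S" and Y: "gaussian_cf N' K Y T"
    and diag: "\<And>k. k \<in> K \<Longrightarrow> S k k = T k k"
    and h: "\<And>k. k \<in> K \<Longrightarrow> integrable lborel (h k)"
    and g: "\<And>k x. k \<in> K \<Longrightarrow> g k x = (CLBINT t. h k t * iexp (t * x))"
    and h'_def: "\<And>k t. h' k t = \<i> * complex_of_real t * h k t"
    and h': "\<And>k. k \<in> K \<Longrightarrow> integrable lborel (h' k)"
    and g': "\<And>k x. k \<in> K \<Longrightarrow> g' k x = (CLBINT t. h' k t * iexp (t * x))"
    and g_le: "\<And>k x. k \<in> K \<Longrightarrow> norm (g k x) \<le> 1"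
    and B: "\<And>s k l. 0 \<le> s \<Longrightarrow> s \<le> 1 \<Longrightarrow> k \<in> K \<Longrightarrow> l \<in> K \<Longrightarrow> k \<noteq> l \<Longrightarrow> S k l \<noteq> T k l \<Longrightarrow>
       (\<integral>z. norm (g' k (sqrt s * X k (fst z) + sqrt (1 - s) * Y k (snd z)))
          * norm (g' l (sqrt s * X l (fst z) + sqrt (1 - s) * Y l (snd z))) \<partial>(N \<Otimes>\<^sub>M N')) \<le> B k l"
  shows "norm ((CLINT \<omega>|N. \<Prod>k\<in>K. g k (X k \<omega>)) - (CLINT \<omega>|N'. \<Prod>k\<in>K. g k (Y k \<omega>)))
     \<le> (\<Sum>k\<in>K. \<Sum>l\<in>K - {k}. \<bar>S k l - T k l\<bar> * B k l) / 2"
proof -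
  have K: "finite K" using gaussian_cfD(2)[OF X] .
  interpret L: product_sigma_finite "\<lambda>_::'i. lborel :: real measure"
    by standard
  let ?P = "PiM K (\<lambda>_::'i. lborel :: real measure)"
  interpret P: sigma_finite_measure ?P
    using L.sigma_finite[OF K] .
  interpret PL: pair_sigma_finite ?P "lborel :: real measure" ..
  have hm[measurable]: "k \<in> K \<Longrightarrow> h k \<in> borel_measurable borel" for k using borel_measurable_integrable[OF h[of k]] by simp
  have h'm[measurable]: "k \<in> K \<Longrightarrow> h' k \<in> borel_measurable borel" for k using borel_measurable_integrable[OF h'[of k]] by simp
  define H where "H = (\<lambda>t. \<Prod>k\<in>K. h k (t k))"
  have Hm[measurable]: "H \<in> borel_measurable ?P"
    unfolding H_def by measurable
  have Hi: "integrable ?P H"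
    unfolding H_def by (rule L.product_integrable_prod[OF K h])
  define q where "q = quad_form K (\<lambda>k l. S k l - T k l)"
  define Q where "Q = (\<lambda>s. quad_form K (\<lambda>k l. s * S k l + (1 - s) * T k l))"
  have [measurable]: "q \<in> borel_measurable ?P" "Q s \<in> borel_measurable ?P" 
    "quad_form K S \<in> borel_measurable ?P" "quad_form K T \<in> borel_measurable ?P" for s
    using K by (auto simp: q_def Q_def)
  have q_eq: "q t = quad_form K S t - quad_form K T t" for t
    using quad_form_linear[of K 1 S "-1" T t] by (simp add: q_def)
  have Q_eq: "Q s t = quad_form K T t + s * q t" for s t
    unfolding q_eq Q_def quad_form_linear by (simp add: algebra_simps)
  have Q_nonneg: "Q s t \<ge> 0" if "0 \<le> s" "s \<le> 1" for s t
    using that quad_form_nonneg[OF X, of t] quad_form_nonneg[OF Y, of t] by (simp add: Q_def quad_form_linear)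
  have g'_le: "norm (g' m x) \<le> (\<integral>t. norm (h' m t) \<partial>lborel)" if "m \<in> K" for m x
    unfolding g'[OF that] by (rule norm_fourier_le[OF h'[OF that]])
  \<comment> \<open>The families with the factors \<open>k\<close> and \<open>l\<close>
    differentiated, on the Fourier side (\<open>hh\<close>) and in space
    (\<open>gg\<close>).\<close>
  define hh where "hh = (\<lambda>k l m. if m = k \<or> m = l then h' m else h m)"
  define gg where "gg = (\<lambda>k l m. if m = k \<or> m = l then g' m else g m)"
  have hhi: "integrable lborel (hh k l m)" if "m \<in> K" for k l m
    using that h h' by (auto simp: hh_def)
  \<comment> \<open>The minus sign is \<open>\<i> * \<i>\<close>; it cancels against the one in the
    derivative \<open>- q / 2\<close>.\<close>
  have prod_hh: "(\<Prod>m\<in>K. hh k l m (t m)) = - complex_of_real (t k * t l) * H t" if "k \<in> K" "l \<in> K" "k \<noteq> l" for k l t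
  proof -
    have "(\<Prod>m\<in>K. hh k l m (t m)) = hh k l k (t k) * (hh k l l (t l) * (\<Prod>m\<in>K - {k} - {l}. hh k l m (t m)))"
      using that K by (subst prod.remove[of K k]) (auto simp: prod.remove[of "K - {k}" l])
    also have "(\<Prod>m\<in>K - {k} - {l}. hh k l m (t m)) = (\<Prod>m\<in>K - {k} - {l}. h m (t m))"
      by (intro prod.cong) (auto simp: hh_def)
    also have "hh k l k (t k) * (hh k l l (t l) * (\<Prod>m\<in>K - {k} - {l}. h m (t m)))
        = - complex_of_real (t k * t l) * (h k (t k) * (h l (t l) * (\<Prod>m\<in>K - {k} - {l}. h m (t m))))"
      by (simp add: hh_def h'_def mult_ac)
    also have "h k (t k) * (h l (t l) * (\<Prod>m\<in>K - {k} - {l}. h m (t m))) = H t"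
      using that K unfolding H_def by (subst prod.remove[of K k]) (auto simp: prod.remove[of "K - {k}" l])
    finally show ?thesis .
  qed
  \<comment> \<open>Equal diagonals remove the terms with \<open>l = k\<close>, so no factor is ever
    differentiated twice.\<close>
  have Hq: "H t * complex_of_real (q t) = - (\<Sum>k\<in>K. \<Sum>l\<in>K - {k}. complex_of_real (S k l - T k l) * (\<Prod>m\<in>K. hh k l m (t m)))" for t
  proof -
    have "q t = (\<Sum>k\<in>K. \<Sum>l\<in>K - {k}. (S k l - T k l) * (t k * t l))"
      unfolding q_def quad_form_def
    proof (rule sum.cong[OF refl])
      fix k assume k: "k \<in> K"
      show "(\<Sum>l\<in>K. (S k l - T k l) * (t k * t l)) = (\<Sum>l\<in>K - {k}. (S k l - T k l) * (t k * t l))"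
        using diag[OF k] K k by (subst sum.remove[of K k]) auto
    qed
    then have "H t * complex_of_real (q t) = (\<Sum>k\<in>K. \<Sum>l\<in>K - {k}. H t * (complex_of_real ((S k l - T k l) * (t k * t l))))"
      by (simp add: sum_distrib_left)
    also have "\<dots> = (\<Sum>k\<in>K. \<Sum>l\<in>K - {k}. - (complex_of_real (S k l - T k l) * (\<Prod>m\<in>K. hh k l m (t m))))"
      by (intro sum.cong refl, subst prod_hh) (auto simp: mult_ac)
    finally show ?thesis by (simp add: sum_negf)
  qed
  have prod_hhi: "integrable ?P (\<lambda>t. \<Prod>m\<in>K. hh k l m (t m))" for k l
    by (rule L.product_integrable_prod[OF K hhi])
  have Hqi: "integrable ?P (\<lambda>t. H t * complex_of_real (q t))"
    unfolding Hq by (intro integrable_minus Bochner_Integration.integrable_sum integrable_mult_right prod_hhi)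
  define R where "R = (\<Sum>k\<in>K. \<Sum>l\<in>K - {k}. \<bar>S k l - T k l\<bar> * B k l) / 2"
  define F where "F = (\<lambda>(t, s). indicator {0..1::real} s *\<^sub>R (H t * complex_of_real (- q t / 2 * exp (- Q s t / 2))))"
  have Fm[measurable]: "F \<in> borel_measurable (?P \<Otimes>\<^sub>M lborel)"
    unfolding F_def Q_eq by measurable
  have Gi: "integrable (?P \<Otimes>\<^sub>M lborel) (\<lambda>(t, s). indicator {0..1::real} s *\<^sub>R (H t * complex_of_real (q t)))"
  proof (rule PL.Fubini_integrable)
    show "integrable ?P (\<lambda>t. \<integral>s. norm (case (t, s) of (t, s) \<Rightarrow> indicator {0..1::real} s *\<^sub>R (H t * complex_of_real (q t))) \<partial>lborel)"
      using integrable_norm[OF Hqi] by simp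
    show "AE t in ?P. integrable lborel (\<lambda>s. case (t, s) of (t, s) \<Rightarrow> indicator {0..1::real} s *\<^sub>R (H t * complex_of_real (q t)))"
      by (auto intro!: integrable_scaleR_left)
  qed measurable
  \<comment> \<open>\<open>Q s t\<close> is nonnegative on the segment, so the exponential is at
    most 1 and the function in \<open>Gi\<close> dominates.\<close>
  have Fi: "integrable (?P \<Otimes>\<^sub>M lborel) F"
  proof (rule Bochner_Integration.integrable_bound[OF Gi])
    have *: "norm (complex_of_real (- q t / 2 * exp (- Q s t / 2))) \<le> norm (complex_of_real (q t))" if "0 \<le> s" "s \<le> 1" for s t
    proof -
      have "\<bar>q t\<bar> / 2 * exp (- Q s t / 2) \<le> \<bar>q t\<bar> * 1"
        by (intro mult_mono) (use Q_nonneg[OF that, of t] in auto)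
      then show ?thesis unfolding norm_of_real by (simp add: abs_mult)
    qed
    have "norm (F (t, s)) \<le> norm (indicator {0..1::real} s *\<^sub>R (H t * complex_of_real (q t)))" for t s
    proof (cases "s \<in> {0..1}")
      case True
      then show ?thesis
        using mult_left_mono[OF *[of s t], of "norm (H t)"]
        by (simp only: F_def prod.case indicator_simps scaleR_one norm_mult norm_ge_zero atLeastAtMost_iff)
    qed (simp add: F_def)
    then show "AE z in ?P \<Otimes>\<^sub>M lborel. norm (F z) \<le> norm (case z of (t, s) \<Rightarrow> indicator {0..1::real} s *\<^sub>R (H t * complex_of_real (q t)))"
      by (intro AE_I2) (simp only: split_paired_all prod.case)
  qed measurable
  \<comment> \<open>At a fixed \<open>s\<close> the derivative is a weighted sum of expectations
    under the mixture. In each, two factors are differentiated and controlled by \<open>B\<close>;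
    the others have modulus at most 1.\<close>
  have inner: "norm (\<integral>t. H t * complex_of_real (- q t / 2 * exp (- Q s t / 2)) \<partial>?P) \<le> R" if s: "0 \<le> s" "s \<le> 1" for s
  proof -
    let ?Z = "\<lambda>k z. sqrt s * X k (fst z) + sqrt (1 - s) * Y k (snd z)"
    let ?N = "N \<Otimes>\<^sub>M N'"
    note Z = gaussian_cf_mixture[OF X Y s]
    interpret Z: prob_space ?N using gaussian_cfD(1)[OF Z] .
    note [measurable] = gaussian_cfD(3)[OF Z]
    define E where "E = (\<lambda>k l. (CLINT t|?P. (\<Prod>m\<in>K. hh k l m (t m)) * complex_of_real (exp (- Q s t / 2))))"
    have Ei: "integrable ?P (\<lambda>t. (\<Prod>m\<in>K. hh k l m (t m)) * complex_of_real (exp (- Q s t / 2)))" for k l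
    proof (rule Bochner_Integration.integrable_bound[OF prod_hhi[of k l]])
      show "(\<lambda>t. (\<Prod>m\<in>K. hh k l m (t m)) * complex_of_real (exp (- Q s t / 2))) \<in> borel_measurable ?P"
        using borel_measurable_integrable[OF prod_hhi] by measurable
    qed (use Q_nonneg[OF s] in \<open>auto simp: norm_mult intro!: mult_left_le\<close>)
    have EB: "norm (E k l) \<le> B k l" if kl: "k \<in> K" "l \<in> K" "k \<noteq> l" "S k l \<noteq> T k l" for k l
    proof -
      have g'm: "g' m \<in> borel_measurable borel" if [measurable]: "m \<in> K" for m
        unfolding g'[OF that, abs_def] by measurable
      have "E k l = (CLINT z|?N. \<Prod>m\<in>K. gg k l m (?Z m z))"
        unfolding E_def Q_def
        by (rule expectation_fourier_product[OF Z hhi, symmetric]) (auto simp: gg_def hh_def g g')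
      then have "norm (E k l) \<le> (\<integral>z. norm (\<Prod>m\<in>K. gg k l m (?Z m z)) \<partial>?N)"
        using integral_norm_bound[of ?N "\<lambda>z. \<Prod>m\<in>K. gg k l m (?Z m z)"] by simp
      also have "\<dots> \<le> (\<integral>z. norm (g' k (?Z k z)) * norm (g' l (?Z l z)) \<partial>?N)"
      proof (rule integral_mono')
        show "norm (\<Prod>m\<in>K. gg k l m (?Z m z)) \<le> norm (g' k (?Z k z)) * norm (g' l (?Z l z))" for z
        proof -
          have "norm (\<Prod>m\<in>K. gg k l m (?Z m z)) = norm (gg k l k (?Z k z)) * (norm (gg k l l (?Z l z)) * (\<Prod>m\<in>K - {k} - {l}. norm (gg k l m (?Z m z))))"
            unfolding prod_norm[symmetric] using kl K by (subst prod.remove[of K k]) (auto simp: prod.remove[of "K - {k}" l])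
          also have "\<dots> \<le> norm (gg k l k (?Z k z)) * (norm (gg k l l (?Z l z)) * 1)"
            by (intro mult_left_mono prod_le_1) (auto simp: gg_def g_le)
          finally show ?thesis by (simp add: gg_def)
        qed
        show "integrable ?N (\<lambda>z. norm (g' k (?Z k z)) * norm (g' l (?Z l z)))"
        proof (rule Z.integrable_const_bound[where B="(\<integral>t. norm (h' k t) \<partial>lborel) * (\<integral>t. norm (h' l t) \<partial>lborel)"])
          show "(\<lambda>z. norm (g' k (?Z k z)) * norm (g' l (?Z l z))) \<in> borel_measurable ?N"
            using g'm[OF kl(1)] g'm[OF kl(2)] gaussian_cfD(3)[OF Z kl(1)] gaussian_cfD(3)[OF Z kl(2)] by measurable
          show "AE z in ?N. norm (norm (g' k (?Z k z)) * norm (g' l (?Z l z))) \<le> (\<integral>t. norm (h' k t) \<partial>lborel) * (\<integral>t. norm (h' l t) \<partial>lborel)"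
            unfolding real_norm_def abs_mult abs_norm_cancel using kl
            by (intro AE_I2 mult_mono g'_le) auto
        qed
      qed simp
      also have "\<dots> \<le> B k l" by (rule B[OF s kl])
      finally show ?thesis .
    qed
    have "(\<integral>t. H t * complex_of_real (- q t / 2 * exp (- Q s t / 2)) \<partial>?P)
       = (\<integral>t. (1/2) * (\<Sum>k\<in>K. \<Sum>l\<in>K - {k}. complex_of_real (S k l - T k l) * ((\<Prod>m\<in>K. hh k l m (t m)) * complex_of_real (exp (- Q s t / 2)))) \<partial>?P)"
    proof (intro Bochner_Integration.integral_cong refl)
      fix t
      have "H t * complex_of_real (- q t / 2 * exp (- Q s t / 2)) = - (1 / 2) * (H t * complex_of_real (q t)) * complex_of_real (exp (- Q s t / 2))"
        by simp
      also have "\<dots> = (1/2) * (\<Sum>k\<in>K. \<Sum>l\<in>K - {k}. complex_of_real (S k l - T k l) * ((\<Prod>m\<in>K. hh k l m (t m)) * complex_of_real (exp (- Q s t / 2))))"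
        unfolding Hq by (simp add: sum_distrib_right mult.assoc)
      finally show "H t * complex_of_real (- q t / 2 * exp (- Q s t / 2)) = \<dots>" .
    qed
    also have "\<dots> = (1/2) * (\<Sum>k\<in>K. \<Sum>l\<in>K - {k}. complex_of_real (S k l - T k l) * E k l)"
      unfolding integral_mult_right_zero E_def
      by (subst Bochner_Integration.integral_sum, intro Bochner_Integration.integrable_sum integrable_mult_right Ei)
         (subst Bochner_Integration.integral_sum, intro integrable_mult_right Ei, simp only: integral_mult_right_zero)
    also have "norm \<dots> = (1/2) * norm (\<Sum>k\<in>K. \<Sum>l\<in>K - {k}. complex_of_real (S k l - T k l) * E k l)"
      by (simp add: norm_mult)
    also have "\<dots> \<le> (1/2) * (\<Sum>k\<in>K. \<Sum>l\<in>K - {k}. \<bar>S k l - T k l\<bar> * B k l)"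
    proof (intro mult_left_mono sum_norm_le)
      \<comment> \<open>Where \<open>S\<close> and \<open>T\<close> agree the summand is 0, so
        \<open>B\<close> is never consulted there.\<close>
      fix k l assume "k \<in> K" "l \<in> K - {k}"
      then show "norm (complex_of_real (S k l - T k l) * E k l) \<le> \<bar>S k l - T k l\<bar> * B k l"
        using EB[of k l] unfolding norm_mult norm_of_real by (cases "S k l = T k l") (auto intro!: mult_left_mono)
    qed auto
    finally show ?thesis by (simp add: R_def)
  qed
  have "(CLINT \<omega>|N. \<Prod>k\<in>K. g k (X k \<omega>)) - (CLINT \<omega>|N'. \<Prod>k\<in>K. g k (Y k \<omega>))
     = (CLINT t|?P. H t * complex_of_real (exp (- quad_form K S t / 2))) - (CLINT t|?P. H t * complex_of_real (exp (- quad_form K T t / 2)))"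
    by (simp only: expectation_fourier_product[OF X h g] expectation_fourier_product[OF Y h g] H_def)
  also have "\<dots> = (CLINT t|?P. H t * complex_of_real (exp (- quad_form K S t / 2)) - H t * complex_of_real (exp (- quad_form K T t / 2)))"
  proof (rule Bochner_Integration.integral_diff[symmetric]; rule Bochner_Integration.integrable_bound[OF Hi])
  qed (use quad_form_nonneg[OF X] quad_form_nonneg[OF Y] in \<open>auto simp: norm_mult intro!: mult_left_le\<close>)
  also have "\<dots> = (CLINT t|?P. CLBINT s. F (t, s))"
  proof (intro Bochner_Integration.integral_cong refl)
    fix t
    have "H t * complex_of_real (exp (- quad_form K S t / 2)) - H t * complex_of_real (exp (- quad_form K T t / 2))
       = H t * complex_of_real (exp (- (quad_form K T t + q t) / 2) - exp (- quad_form K T t / 2))"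
      unfolding q_eq by (simp add: algebra_simps)
    also have "\<dots> = (CLBINT s. F (t, s))"
      unfolding exp_difference_integral F_def Q_eq
      by (subst integral_mult_right_zero[symmetric]) (simp add: mult_scaleR_right del: integral_mult_right_zero of_real_mult of_real_exp)
    finally show "H t * complex_of_real (exp (- quad_form K S t / 2)) - H t * complex_of_real (exp (- quad_form K T t / 2)) = (CLBINT s. F (t, s))" .
  qed
  also have "\<dots> = (CLBINT s. (CLINT t|?P. F (t, s)))"
    using PL.Fubini_integral[of "\<lambda>t s. F (t, s)"] Fi by simp
  also have "norm \<dots> \<le> (\<integral>s. norm (CLINT t|?P. F (t, s)) \<partial>lborel)"
    by (rule integral_norm_bound)
  also have "\<dots> \<le> (\<integral>s. indicator {0..1::real} s *\<^sub>R R \<partial>lborel)"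
  proof (rule integral_mono')
    have "R \<ge> 0" using order_trans[OF norm_ge_zero inner[of 0]] by simp
    then show "0 \<le> (indicator {0..1} s *\<^sub>R R :: real)" for s :: real by simp
    show "norm (CLINT t|?P. F (t, s)) \<le> indicator {0..1::real} s *\<^sub>R R" for s
      using inner[of s] unfolding F_def by (auto simp: indicator_def)
  qed (auto intro!: integrable_scaleR_left)
  also have "\<dots> = R" by simp
  finally show ?thesis by (simp add: R_def)
qed

section \<open>Marginals, and the Gaussian kernel estimate for two coordinates\<close>

lemma quad_form_support:
  assumes "finite K" "A \<subseteq> K" "\<And>k. k \<in> K - A \<Longrightarrow> t k = 0"
  shows "quad_form K S t = quad_form A S t"
proof -
  have "quad_form K S t = (\<Sum>k\<in>A. \<Sum>l\<in>K. S k l * (t k * t l))"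
    unfolding quad_form_def using assms by (intro sum.mono_neutral_right) auto
  also have "\<dots> = quad_form A S t"
    unfolding quad_form_def using assms by (intro sum.cong refl sum.mono_neutral_right) auto
  finally show ?thesis .
qed

text \<open>A vector \<open>t\<close> supported at \<open>k\<close> turns the joint characteristic
  function into that of \<open>Z k\<close>; Levy's uniqueness theorem does the rest.\<close>

lemma gaussian_cf_std_normal:
  assumes Z: "gaussian_cf N K Z S" and k: "k \<in> K" "S k k = 1"
  shows "distr N borel (Z k) = std_normal_distribution"
proof -
  interpret N: prob_space N using gaussian_cfD(1)[OF Z] .
  have K: "finite K" using gaussian_cfD(2)[OF Z] .
  have [measurable]: "Z k \<in> borel_measurable N" using gaussian_cfD(3)[OF Z k(1)] .
  have "char (distr N borel (Z k)) t = char std_normal_distribution t" for t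
  proof -
    let ?t = "\<lambda>l. if l = k then t else 0"
    have "(\<Sum>l\<in>K. ?t l * Z l \<omega>) = t * Z k \<omega>" for \<omega>
      using K k by (subst sum.remove[of K k]) (auto intro!: sum.neutral)
    moreover have "quad_form K S ?t = t\<^sup>2"
      using K k by (subst quad_form_support[of K "{k}"]) (auto simp: quad_form_def power2_eq_square)
    ultimately show ?thesis
      using gaussian_cfD(4)[OF Z, of ?t] by (simp add: char_def integral_distr char_std_normal_distribution)
  qed
  then show ?thesis
    by (intro Levy_uniqueness N.real_distribution_distr real_dist_normal_dist) auto
qed

lemma std_normal_distribution_singleton: "measure std_normal_distribution {c} = 0"
proof -
  have "emeasure std_normal_distribution {c} = (\<integral>\<^sup>+x. ennreal (std_normal_density x) * indicator {c} x \<partial>lborel)"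
    by (subst emeasure_density) auto
  also have "\<dots> = 0"
    using AE_lborel_singleton[of c]
    by (subst nn_integral_0_iff_AE) (auto simp: indicator_def elim!: eventually_mono)
  finally show ?thesis by (simp add: measure_def)
qed

text \<open>Smoothed indicators do not converge to the indicator at the level itself; this makes
  hitting the level negligible.\<close>

lemma gaussian_cf_AE_neq:
  assumes Z: "gaussian_cf N K Z S" and k: "k \<in> K" "S k k = 1"
  shows "AE \<omega> in N. Z k \<omega> \<noteq> c"
proof -
  interpret N: prob_space N using gaussian_cfD(1)[OF Z] .
  have [measurable]: "Z k \<in> borel_measurable N" using gaussian_cfD(3)[OF Z k(1)] .
  have "measure N {\<omega> \<in> space N. Z k \<omega> = c} = measure (distr N borel (Z k)) {c}"
    by (subst measure_distr) (auto intro!: arg_cong[where f="measure N"])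
  also have "\<dots> = 0" by (simp add: gaussian_cf_std_normal[OF assms] std_normal_distribution_singleton)
  finally show ?thesis by (subst (asm) N.prob_eq_0) auto
qed

text \<open>The rotation by 45 degrees decorrelates two components of equal variance, so that their
  Fourier integral factorises.\<close>

definition rotation_pair :: "('i \<Rightarrow> 'a \<Rightarrow> real) \<Rightarrow> 'i \<Rightarrow> 'i \<Rightarrow> bool \<Rightarrow> 'a \<Rightarrow> real" where
  "rotation_pair Z k l b \<omega> = (if b then Z k \<omega> + Z l \<omega> else Z k \<omega> - Z l \<omega>) / sqrt 2"

lemma gaussian_cf_rotation:
  assumes Z: "gaussian_cf N K Z S" and kl: "k \<in> K" "l \<in> K" "k \<noteq> l"
    and S: "S k k = 1" "S l l = 1" "S k l = r" "S l k = r"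
  shows "gaussian_cf N {False, True} (rotation_pair Z k l)
     (\<lambda>b c. if b = c then (if b then 1 + r else 1 - r) else 0)" (is "gaussian_cf _ _ _ ?T")
  unfolding gaussian_cf_def
proof (intro conjI allI ballI)
  have K: "finite K" using gaussian_cfD(2)[OF Z] .
  have [measurable]: "Z k \<in> borel_measurable N" "Z l \<in> borel_measurable N"
    using gaussian_cfD(3)[OF Z] kl by auto
  show "rotation_pair Z k l b \<in> borel_measurable N" for b
    unfolding rotation_pair_def[abs_def] by measurable
  fix t :: "bool \<Rightarrow> real"
  let ?t = "\<lambda>m. if m = k then (t True + t False) / sqrt 2 else if m = l then (t True - t False) / sqrt 2 else 0"
  have "(\<Sum>m\<in>K. ?t m * Z m \<omega>) = (\<Sum>m\<in>{k, l}. ?t m * Z m \<omega>)" for \<omega>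
    using K kl by (intro sum.mono_neutral_right) auto
  then have 1: "(\<Sum>m\<in>K. ?t m * Z m \<omega>) = (\<Sum>b\<in>{False, True}. t b * rotation_pair Z k l b \<omega>)" for \<omega>
    using kl by (simp add: rotation_pair_def field_simps)
  have "quad_form K S ?t = quad_form {k, l} S ?t"
    using K kl by (intro quad_form_support) auto
  also have "\<dots> = quad_form {False, True} ?T t"
    using kl S by (simp add: quad_form_def field_simps)
  finally have 2: "quad_form K S ?t = quad_form {False, True} ?T t" .
  show "(CLINT \<omega>|N. iexp (\<Sum>b\<in>{False, True}. t b * rotation_pair Z k l b \<omega>)) = complex_of_real (exp (- quad_form {False, True} ?T t / 2))"
    using gaussian_cfD(4)[OF Z, of ?t] unfolding 1 2 .
qed (use gaussian_cfD(1)[OF Z] in auto)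

lemma fourier_shifted_gaussian_kernel:
  fixes v p x :: real
  assumes "v > 0"
  shows "(CLBINT t. complex_of_real (exp (- v * t\<^sup>2 / 2) / (2 * pi)) * iexp (- t * p) * iexp (t * x))
     = complex_of_real (normal_density 0 (sqrt v) (x - p))"
proof -
  have "(CLBINT t. complex_of_real (exp (- v * t\<^sup>2 / 2) / (2 * pi)) * iexp (- t * p) * iexp (t * x))
     = (CLBINT t. complex_of_real (exp (- v * t\<^sup>2 / 2) / (2 * pi)) * iexp (t * (x - p)))"
    by (intro Bochner_Integration.integral_cong refl) (simp add: mult.assoc algebra_simps flip: exp_add)
  then show ?thesis by (simp only: fourier_gaussian_kernel[OF assms])
qed

lemma integrable_shifted_gaussian_kernel:
  fixes v p :: real
  assumes "v > 0"
  shows "integrable lborel (\<lambda>t. complex_of_real (exp (- v * t\<^sup>2 / 2) / (2 * pi)) * iexp (- t * p))"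
proof (rule Bochner_Integration.integrable_bound[OF integrable_gaussian_kernel_abs_moment[OF assms, of 0]])
  have "norm (complex_of_real c * iexp y) = \<bar>c\<bar>" for c y
    by (simp add: norm_mult)
  moreover have "exp x / (2 * pi) \<le> exp x / 1" for x
    using pi_ge_two by (intro divide_left_mono) auto
  ultimately show "AE t in lborel. norm (complex_of_real (exp (- v * t\<^sup>2 / 2) / (2 * pi)) * iexp (- t * p)) \<le> norm (exp (- v * t\<^sup>2 / 2) * \<bar>t\<bar> ^ 0)"
    by (intro AE_I2) (simp only: power_0 mult_1_right real_norm_def abs_divide abs_exp_cancel, simp)
qed simp

text \<open>This is the joint density at \<open>(a, b)\<close> of the two coordinates after adding
  independent noise of variance \<open>d\<^sup>2\<close>. The product of the kernels depends only on
  the squared distance, hence survives the rotation; in rotated coordinates the covariance is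
  diagonal with entries \<open>1 + r\<close> and \<open>1 - r\<close>, and the Fourier integral
  splits into two.\<close>

lemma expectation_two_gaussian_kernels:
  assumes Z: "gaussian_cf N K Z S" and kl: "k \<in> K" "l \<in> K" "k \<noteq> l"
    and S: "S k k = 1" "S l l = 1" "S k l = r" "S l k = r" and r: "\<bar>r\<bar> < 1" and d: "d > 0"
  shows "(\<integral>\<omega>. normal_density 0 d (Z k \<omega> - a) * normal_density 0 d (Z l \<omega> - b) \<partial>N)
     = normal_density 0 (sqrt (d\<^sup>2 + (1 + r))) ((a + b) / sqrt 2) * normal_density 0 (sqrt (d\<^sup>2 + (1 - r))) ((a - b) / sqrt 2)"
proof -
  let ?v = "\<lambda>c. if c then 1 + r else 1 - r"
  let ?p = "\<lambda>c. (if c then a + b else a - b) / sqrt 2"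
  let ?W = "rotation_pair Z k l"
  define h where "h = (\<lambda>c t. complex_of_real (exp (- d\<^sup>2 * t\<^sup>2 / 2) / (2 * pi)) * iexp (- t * ?p c))"
  note W = gaussian_cf_rotation[OF Z kl S]
  have d2: "d\<^sup>2 > 0" using d by simp
  interpret L: product_sigma_finite "\<lambda>_::bool. lborel :: real measure"
    by standard
  have hi: "integrable lborel (h c)" for c
    unfolding h_def by (rule integrable_shifted_gaussian_kernel[OF d2])
  have hg: "complex_of_real (normal_density 0 d (x - ?p c)) = (CLBINT t. h c t * iexp (t * x))" for c x
    unfolding h_def fourier_shifted_gaussian_kernel[OF d2] using d by simp
  have "complex_of_real (\<integral>\<omega>. normal_density 0 d (Z k \<omega> - a) * normal_density 0 d (Z l \<omega> - b) \<partial>N)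
     = (CLINT \<omega>|N. \<Prod>c\<in>{False, True}. complex_of_real (normal_density 0 d (?W c \<omega> - ?p c)))"
  proof (subst integral_complex_of_real[symmetric], intro Bochner_Integration.integral_cong refl)
    fix \<omega>
    have nd: "normal_density 0 d x * normal_density 0 d y = exp (- ((x\<^sup>2 + y\<^sup>2) / (2 * d\<^sup>2))) / (2 * pi * d\<^sup>2)" for x y
    proof -
      have "(1 / sqrt c * e) * (1 / sqrt c * e') = e * e' / c" if "c > 0" for c e e' :: real
        using that by (simp add: field_simps)
      moreover have "2 * pi * d\<^sup>2 > 0" using d by simp
      ultimately show ?thesis
        unfolding normal_density_def by (simp only: mult_exp_exp) (simp add: add_divide_distrib)
    qed
    have "(Z k \<omega> - a)\<^sup>2 + (Z l \<omega> - b)\<^sup>2 = (?W False \<omega> - ?p False)\<^sup>2 + (?W True \<omega> - ?p True)\<^sup>2"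
      unfolding rotation_pair_def by (simp add: power_divide power2_eq_square flip: diff_divide_distrib) (simp add: field_simps)
    then have "normal_density 0 d (Z k \<omega> - a) * normal_density 0 d (Z l \<omega> - b)
       = normal_density 0 d (?W False \<omega> - ?p False) * normal_density 0 d (?W True \<omega> - ?p True)"
      by (simp only: nd)
    then show "complex_of_real (normal_density 0 d (Z k \<omega> - a) * normal_density 0 d (Z l \<omega> - b))
       = (\<Prod>c\<in>{False, True}. complex_of_real (normal_density 0 d (?W c \<omega> - ?p c)))" by simp
  qed
  also have "\<dots> = (CLINT t|PiM {False, True} (\<lambda>_. lborel). (\<Prod>c\<in>{False, True}. h c (t c)) *
       complex_of_real (exp (- quad_form {False, True} (\<lambda>b c. if b = c then ?v b else 0) t / 2)))"
    by (rule expectation_fourier_product[OF W hi hg])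
  also have "\<dots> = (CLINT t|PiM {False, True} (\<lambda>_. lborel). \<Prod>c\<in>{False, True}. h c (t c) * complex_of_real (exp (- ?v c * (t c)\<^sup>2 / 2)))"
  proof (intro Bochner_Integration.integral_cong refl)
    fix t :: "bool \<Rightarrow> real"
    have "quad_form {False, True} (\<lambda>b c. if b = c then ?v b else 0) t = (1 - r) * (t False)\<^sup>2 + (1 + r) * (t True)\<^sup>2"
      by (simp add: quad_form_def power2_eq_square)
    then have "exp (- quad_form {False, True} (\<lambda>b c. if b = c then ?v b else 0) t / 2)
       = (\<Prod>c\<in>{False, True}. exp (- ?v c * (t c)\<^sup>2 / 2))"
      by (simp add: mult_exp_exp add_divide_distrib diff_divide_distrib algebra_simps)
    then show "(\<Prod>c\<in>{False, True}. h c (t c)) * complex_of_real (exp (- quad_form {False, True} (\<lambda>b c. if b = c then ?v b else 0) t / 2))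
       = (\<Prod>c\<in>{False, True}. h c (t c) * complex_of_real (exp (- ?v c * (t c)\<^sup>2 / 2)))"
      unfolding prod.distrib by (simp only: of_real_prod)
  qed
  also have "\<dots> = (\<Prod>c\<in>{False, True}. CLBINT t. h c t * complex_of_real (exp (- ?v c * t\<^sup>2 / 2)))"
  proof (rule L.product_integral_prod)
    show "integrable lborel (\<lambda>t. h c t * complex_of_real (exp (- ?v c * t\<^sup>2 / 2)))" for c
      by (rule Bochner_Integration.integrable_bound[OF hi[of c]])
         (use r hi[of c, THEN borel_measurable_integrable] in \<open>auto simp: norm_mult intro!: AE_I2 mult_left_le\<close>)
  qed simp
  also have "\<dots> = (\<Prod>c\<in>{False, True}. complex_of_real (normal_density 0 (sqrt (d\<^sup>2 + ?v c)) (?p c)))"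
  proof (intro prod.cong refl)
    fix c
    \<comment> \<open>The factor \<open>iexp (t * 0)\<close> is inserted so that the kernel formula
      applies at argument 0, with the variance raised from \<open>d\<^sup>2\<close> to
      \<open>d\<^sup>2 + ?v c\<close>.\<close>
    have "(CLBINT t. h c t * complex_of_real (exp (- ?v c * t\<^sup>2 / 2)))
       = (CLBINT t. complex_of_real (exp (- (d\<^sup>2 + ?v c) * t\<^sup>2 / 2) / (2 * pi)) * iexp (- t * ?p c) * iexp (t * 0))"
    proof (intro Bochner_Integration.integral_cong refl)
      fix t
      have e: "exp (- (d\<^sup>2 + ?v c) * t\<^sup>2 / 2) = exp (- d\<^sup>2 * t\<^sup>2 / 2) * exp (- ?v c * t\<^sup>2 / 2)"
        unfolding mult_exp_exp by (rule arg_cong[where f=exp]) (simp add: field_simps)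
      show "h c t * complex_of_real (exp (- ?v c * t\<^sup>2 / 2))
         = complex_of_real (exp (- (d\<^sup>2 + ?v c) * t\<^sup>2 / 2) / (2 * pi)) * iexp (- t * ?p c) * iexp (t * 0)"
        unfolding e h_def by simp
    qed
    also have "\<dots> = complex_of_real (normal_density 0 (sqrt (d\<^sup>2 + ?v c)) (0 - ?p c))"
    proof (rule fourier_shifted_gaussian_kernel)
      show "0 < d\<^sup>2 + ?v c" using r d2 by (cases c; simp only: if_True if_False)
    qed
    also have "normal_density 0 (sqrt (d\<^sup>2 + ?v c)) (0 - ?p c) = normal_density 0 (sqrt (d\<^sup>2 + ?v c)) (?p c)"
      by (simp add: normal_density_def)
    finally show "(CLBINT t. h c t * complex_of_real (exp (- ?v c * t\<^sup>2 / 2))) = complex_of_real (normal_density 0 (sqrt (d\<^sup>2 + ?v c)) (?p c))" .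
  qed
  also have "\<dots> = complex_of_real (normal_density 0 (sqrt (d\<^sup>2 + (1 + r))) ((a + b) / sqrt 2) * normal_density 0 (sqrt (d\<^sup>2 + (1 - r))) ((a - b) / sqrt 2))"
    by (simp add: mult.commute)
  finally show ?thesis unfolding of_real_eq_iff .
qed

text \<open>Both variances \<open>A\<close> and \<open>B\<close> are at most \<open>C\<close>, and
  the rotation preserves \<open>a\<^sup>2 + b\<^sup>2 \<ge> 2 * w\<^sup>2\<close>, which gives the
  exponent; \<open>A * B \<ge> 1 - r\<^sup>2 \<ge> 1 - R\<^sup>2\<close> gives the denominator,
  uniformly in \<open>d\<close>.\<close>

lemma expectation_two_gaussian_kernels_le:
  assumes Z: "gaussian_cf N K Z S" and kl: "k \<in> K" "l \<in> K" "k \<noteq> l"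
    and S: "S k k = 1" "S l l = 1" "S k l = r" "S l k = r"
    and R: "\<bar>r\<bar> \<le> R" "R < 1" and d: "d > 0" and w: "0 \<le> w" "w \<le> \<bar>a\<bar>" "w \<le> \<bar>b\<bar>"
  shows "(\<integral>\<omega>. normal_density 0 d (Z k \<omega> - a) * normal_density 0 d (Z l \<omega> - b) \<partial>N)
     \<le> exp (- w\<^sup>2 / (1 + R + d\<^sup>2)) / (2 * pi * sqrt (1 - R\<^sup>2))"
proof -
  define A B where "A = d\<^sup>2 + (1 + r)" and "B = d\<^sup>2 + (1 - r)"
  define p q where "p = (a + b) / sqrt 2" and "q = (a - b) / sqrt 2"
  define C where "C = 1 + R + d\<^sup>2"
  have r: "\<bar>r\<bar> < 1" using R by linarith
  have d2: "d\<^sup>2 > 0" using d by simp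
  have AB: "0 < A" "A \<le> C" "0 < B" "B \<le> C" "0 < C" using r R d2 unfolding A_def B_def C_def by linarith+
  have "1 - R\<^sup>2 \<le> 1 - r\<^sup>2" using R abs_le_square_iff[of r R] by auto
  also have "\<dots> = (1 + r) * (1 - r)" by (simp add: power2_eq_square algebra_simps)
  also have "\<dots> \<le> A * B" using r d2 unfolding A_def B_def by (intro mult_mono) auto
  finally have AB': "1 - R\<^sup>2 \<le> A * B" .
  have R2: "1 - R\<^sup>2 > 0" using R abs_square_less_1[of R] by auto
  have "2 * w\<^sup>2 \<le> a\<^sup>2 + b\<^sup>2"
    using w abs_le_square_iff[of w a] abs_le_square_iff[of w b] by auto
  also have "\<dots> = p\<^sup>2 + q\<^sup>2" unfolding p_def q_def by (simp add: power_divide power2_eq_square field_simps)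
  finally have "w\<^sup>2 / C \<le> (p\<^sup>2 + q\<^sup>2) / (2 * C)" using AB by (simp add: field_simps)
  also have "\<dots> = p\<^sup>2 / (2 * C) + q\<^sup>2 / (2 * C)" by (simp add: add_divide_distrib)
  also have "\<dots> \<le> p\<^sup>2 / (2 * A) + q\<^sup>2 / (2 * B)"
    using AB by (intro add_mono divide_left_mono) auto
  finally have e: "exp (- (p\<^sup>2 / (2 * A) + q\<^sup>2 / (2 * B))) \<le> exp (- w\<^sup>2 / C)" by simp
  have "normal_density 0 (sqrt A) p * normal_density 0 (sqrt B) q
     = exp (- (p\<^sup>2 / (2 * A) + q\<^sup>2 / (2 * B))) / (2 * pi * sqrt (A * B))"
    using AB unfolding normal_density_def by (simp add: real_sqrt_mult mult_exp_exp field_simps)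
  also have "\<dots> \<le> exp (- w\<^sup>2 / C) / (2 * pi * sqrt (1 - R\<^sup>2))"
    using e AB' R2 by (intro frac_le mult_left_mono) auto
  finally show ?thesis
    unfolding expectation_two_gaussian_kernels[OF Z kl S r d] A_def B_def C_def p_def q_def .
qed

section \<open>Smoothed indicators and the comparison of orthant probabilities\<close>

definition smoothed_indicator :: "real \<Rightarrow> real \<Rightarrow> real \<Rightarrow> real \<Rightarrow> real" where
  "smoothed_indicator d a b x = (\<integral>y. indicator {a..b} y * normal_density 0 d (x - y) \<partial>lborel)"

lemma normal_density_reflect: "normal_density 0 d (x - y) = normal_density x d y"
  by (simp add: normal_density_def power2_commute)

lemma norm_mult_iexp: "norm (c * iexp y) = norm c"
  by (simp add: norm_mult)

lemma smoothed_indicator_bounds: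
  assumes "d > 0"
  shows "0 \<le> smoothed_indicator d a b x" "smoothed_indicator d a b x \<le> 1"
proof -
  show "0 \<le> smoothed_indicator d a b x"
    unfolding smoothed_indicator_def by (intro Bochner_Integration.integral_nonneg) auto
  have "smoothed_indicator d a b x \<le> (\<integral>y. normal_density x d y \<partial>lborel)"
    unfolding smoothed_indicator_def normal_density_reflect using assms
    by (intro integral_mono') (auto simp: indicator_def)
  then show "smoothed_indicator d a b x \<le> 1" using assms by simp
qed

text \<open>Read as the probability that \<open>x\<close> plus \<open>d\<close> times a standard
  normal variable lies in \<open>{a..b}\<close>, the limit \<open>d\<close> to 0 becomes a pointwise
  limit of integrands.\<close>

lemma smoothed_indicator_eq:
  assumes "d > 0"
  shows "smoothed_indicator d a b x = (\<integral>w. std_normal_density w * indicator {a..b} (x + d * w) \<partial>lborel)"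
proof -
  have "smoothed_indicator d a b x = d *\<^sub>R (\<integral>w. indicator {a..b} (x + d * w) * normal_density 0 d (x - (x + d * w)) \<partial>lborel)"
    unfolding smoothed_indicator_def using assms
    by (subst lborel_integral_real_affine[of d _ x]) auto
  also have "\<dots> = (\<integral>w. d * (indicator {a..b} (x + d * w) * normal_density 0 d (x - (x + d * w))) \<partial>lborel)"
    by simp
  also have "\<dots> = (\<integral>w. std_normal_density w * indicator {a..b} (x + d * w) \<partial>lborel)"
    using assms by (intro Bochner_Integration.integral_cong refl)
      (simp add: normal_density_def real_sqrt_mult power_mult_distrib)
  finally show ?thesis .
qed

text \<open>At \<open>x = u\<close> the limit would be 1/2, hence the exclusion. One index drives
  both the smoothing width to 0 and the lower cut-off to minus infinity.\<close>

lemma smoothed_indicator_tendsto: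
  assumes "x \<noteq> u"
  shows "(\<lambda>m. smoothed_indicator (1 / real (Suc m)) (- real (Suc m)) u x) \<longlonglongrightarrow> indicator {..u} x"
proof -
  have "(\<lambda>m. \<integral>w. std_normal_density w * indicator {- real (Suc m)..u} (x + 1 / real (Suc m) * w) \<partial>lborel)
     \<longlonglongrightarrow> (\<integral>w. std_normal_density w * indicator {..u} x \<partial>lborel)"
  proof (rule integral_dominated_convergence[where w=std_normal_density])
    show "AE w in lborel. (\<lambda>m. std_normal_density w * indicator {- real (Suc m)..u} (x + 1 / real (Suc m) * w))
        \<longlonglongrightarrow> std_normal_density w * indicator {..u} x"
    proof (intro AE_I2 tendsto_mult tendsto_const)
      fix w :: real
      have l: "(\<lambda>m. x + 1 / real (Suc m) * w) \<longlonglongrightarrow> x"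
        by (rule tendsto_eq_intros LIMSEQ_Suc[OF lim_1_over_n] refl)+ simp
      have lo: "eventually (\<lambda>m. - real (Suc m) < x + 1 / real (Suc m) * w) sequentially"
        using l by real_asymp
      have "eventually (\<lambda>m. indicator {- real (Suc m)..u} (x + 1 / real (Suc m) * w) = (indicator {..u} x :: real)) sequentially"
      proof (cases "x < u")
        case True
        from order_tendstoD(2)[OF l this] lo show ?thesis
          by eventually_elim (use True in \<open>auto simp: indicator_def\<close>)
      next
        case False
        then have "u < x" using assms by simp
        from order_tendstoD(1)[OF l this] show ?thesis
          by eventually_elim (use False assms in \<open>auto simp: indicator_def\<close>)
      qed
      then show "(\<lambda>m. indicator {- real (Suc m)..u} (x + 1 / real (Suc m) * w)) \<longlonglongrightarrow> (indicator {..u} x :: real)"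
        by (rule tendsto_eventually)
    qed
  qed (auto simp: indicator_def)
  then show ?thesis by (simp add: smoothed_indicator_eq)
qed

text \<open>The Gaussian factor supplies the integrability for Fubini and hence for the inversion
  formula. In the third part, multiplication by \<open>\<i> * t\<close> makes the inner integrand an
  exact derivative, so only the endpoints remain: the smoothed indicator has as derivative a
  Gaussian bump at \<open>a\<close> minus one at \<open>b\<close>.\<close>

lemma fourier_smoothed_indicator:
  fixes d a b :: real
  assumes d: "d > 0" and ab: "a \<le> b"
  defines "h \<equiv> \<lambda>t. complex_of_real (exp (- d\<^sup>2 * t\<^sup>2 / 2) / (2 * pi)) * (CLBINT y. indicator {a..b} y *\<^sub>R iexp (- t * y))"
  shows "integrable lborel h"
    and "(CLBINT t. h t * iexp (t * x)) = complex_of_real (smoothed_indicator d a b x)"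
    and "\<i> * complex_of_real t * h t = complex_of_real (exp (- d\<^sup>2 * t\<^sup>2 / 2) / (2 * pi)) * iexp (- t * a)
           - complex_of_real (exp (- d\<^sup>2 * t\<^sup>2 / 2) / (2 * pi)) * iexp (- t * b)"
proof -
  have d2: "d\<^sup>2 > 0" using d by simp
  let ?e = "\<lambda>t. complex_of_real (exp (- d\<^sup>2 * t\<^sup>2 / 2) / (2 * pi))"
  have ei: "integrable lborel ?e"
    using integrable_shifted_gaussian_kernel[OF d2, of 0] by simp
  have i1: "integrable lborel (\<lambda>y. indicator {a..b} y *\<^sub>R (1::real))"
    using integrable_real_indicator[of "{a..b}" lborel] by (simp add: emeasure_lborel_Icc_eq)
  have G: "integrable (lborel \<Otimes>\<^sub>M lborel) (\<lambda>(t, y). ?e t * (indicator {a..b} y *\<^sub>R iexp (- t * y)))"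
  proof (rule lborel_pair.Fubini_integrable)
    have [simp]: "norm (indicator {a..b} y *\<^sub>R iexp (- t * y)) = indicator {a..b} y" for t y :: real
      by (simp add: indicator_def)
    show "integrable lborel (\<lambda>t. \<integral>y. norm (case (t, y) of (t, y) \<Rightarrow> ?e t * (indicator {a..b} y *\<^sub>R iexp (- t * y))) \<partial>lborel)"
      unfolding prod.case norm_mult \<open>\<And>t y. norm (indicator {a..b} y *\<^sub>R iexp (- t * y)) = indicator {a..b} y\<close>
      using integrable_norm[OF ei] by (simp only: integral_mult_right_zero) (rule integrable_mult_left)
    show "AE t in lborel. integrable lborel (\<lambda>y. case (t, y) of (t, y) \<Rightarrow> ?e t * (indicator {a..b} y *\<^sub>R iexp (- t * y)))"
    proof (rule AE_I2)
      fix t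
      have "integrable lborel (\<lambda>y. indicator {a..b} y *\<^sub>R iexp (- t * y))"
        by (rule Bochner_Integration.integrable_bound[OF i1]) (auto simp: indicator_def)
      then show "integrable lborel (\<lambda>y. case (t, y) of (t, y) \<Rightarrow> ?e t * (indicator {a..b} y *\<^sub>R iexp (- t * y)))"
        unfolding prod.case by (rule integrable_mult_right)
    qed
  qed measurable
  from lborel_pair.integrable_fst'[OF G] show hi: "integrable lborel h"
    unfolding h_def prod.case integral_mult_right_zero .
  have F: "(\<integral>y. indicator {a..b} y *\<^sub>R iexp (- t * y) \<partial>lborel) * (\<i> * complex_of_real t) = iexp (- t * a) - iexp (- t * b)" for t
  proof -
    have "(\<integral>y. indicator {a..b} y *\<^sub>R (\<i> * complex_of_real t * iexp (- t * y)) \<partial>lborel) = - iexp (- t * b) - - iexp (- t * a)"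
    proof (rule integral_FTC_atLeastAtMost[OF ab])
      show "((\<lambda>y. - iexp (- t * y)) has_vector_derivative \<i> * complex_of_real t * iexp (- t * y)) (at y within {a..b})" for y
      proof -
        have "((\<lambda>z. - exp (\<i> * (- complex_of_real t * z))) has_field_derivative \<i> * complex_of_real t * iexp (- t * y)) (at (complex_of_real y))"
          by (auto intro!: derivative_eq_intros)
        from has_vector_derivative_real_field[OF this] show ?thesis by simp
      qed
    qed (auto intro!: continuous_intros)
    moreover have "(\<lambda>y. indicator {a..b} y *\<^sub>R (\<i> * complex_of_real t * iexp (- t * y))) = (\<lambda>y. (indicator {a..b} y *\<^sub>R iexp (- t * y)) * (\<i> * complex_of_real t))"
      by (auto simp: fun_eq_iff indicator_def)
    ultimately show ?thesis by (simp only: integral_mult_left_zero) simp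
  qed
  have "\<i> * complex_of_real t * h t = ?e t * ((\<integral>y. indicator {a..b} y *\<^sub>R iexp (- t * y) \<partial>lborel) * (\<i> * complex_of_real t))"
    unfolding h_def by (simp only: mult_ac)
  also have "\<dots> = ?e t * iexp (- t * a) - ?e t * iexp (- t * b)"
    unfolding F by (simp only: right_diff_distrib)
  finally show "\<i> * complex_of_real t * h t = ?e t * iexp (- t * a) - ?e t * iexp (- t * b)" .
  have G': "integrable (lborel \<Otimes>\<^sub>M lborel) (\<lambda>(t, y). ?e t * (indicator {a..b} y *\<^sub>R iexp (- t * y)) * iexp (t * x))"
  proof (rule Bochner_Integration.integrable_bound[OF G])
    show "AE z in lborel \<Otimes>\<^sub>M lborel. norm (case z of (t, y) \<Rightarrow> ?e t * (indicator {a..b} y *\<^sub>R iexp (- t * y)) * iexp (t * x))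
       \<le> norm (case z of (t, y) \<Rightarrow> ?e t * (indicator {a..b} y *\<^sub>R iexp (- t * y)))"
      by (intro AE_I2) (simp only: split_beta norm_mult_iexp order_refl)
  qed measurable
  have "(CLBINT t. h t * iexp (t * x)) = (CLBINT t. (CLBINT y. ?e t * (indicator {a..b} y *\<^sub>R iexp (- t * y)) * iexp (t * x)))"
    unfolding h_def by (simp only: integral_mult_right_zero integral_mult_left_zero)
  also have "\<dots> = (CLBINT y. (CLBINT t. ?e t * (indicator {a..b} y *\<^sub>R iexp (- t * y)) * iexp (t * x)))"
    by (rule lborel_pair.Fubini_integral[symmetric, OF G'])
  also have "\<dots> = (CLBINT y. complex_of_real (indicator {a..b} y * normal_density 0 d (x - y)))"
  proof (intro Bochner_Integration.integral_cong refl)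
    fix y
    have "(CLBINT t. ?e t * (indicator {a..b} y *\<^sub>R iexp (- t * y)) * iexp (t * x))
       = (CLBINT t. complex_of_real (indicator {a..b} y) * (?e t * iexp (- t * y) * iexp (t * x)))"
      by (intro Bochner_Integration.integral_cong refl) (simp add: scaleR_conv_of_real mult_ac)
    also have "\<dots> = complex_of_real (indicator {a..b} y) * complex_of_real (normal_density 0 (sqrt (d\<^sup>2)) (x - y))"
      unfolding integral_mult_right_zero fourier_shifted_gaussian_kernel[OF d2] ..
    finally show "(CLBINT t. ?e t * (indicator {a..b} y *\<^sub>R iexp (- t * y)) * iexp (t * x)) = complex_of_real (indicator {a..b} y * normal_density 0 d (x - y))"
      using d by simp
  qed
  also have "\<dots> = complex_of_real (smoothed_indicator d a b x)"
    unfolding smoothed_indicator_def by (rule integral_complex_of_real)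
  finally show "(CLBINT t. h t * iexp (t * x)) = complex_of_real (smoothed_indicator d a b x)" .
qed

text \<open>The cut-off at \<open>- L\<close> is there only because the indicator of a half-line is not the Fourier transform
  of an integrable function; the bound does not depend on \<open>L\<close>.\<close>

lemma smoothed_orthant_comparison:
  assumes X: "gaussian_cf N K X S" and Y: "gaussian_cf N' K Y T"
    and diag: "\<And>k. k \<in> K \<Longrightarrow> S k k = 1" "\<And>k. k \<in> K \<Longrightarrow> T k k = 1"
    and sym: "\<And>k l. k \<in> K \<Longrightarrow> l \<in> K \<Longrightarrow> S k l = S l k" "\<And>k l. k \<in> K \<Longrightarrow> l \<in> K \<Longrightarrow> T k l = T l k"
    and R: "\<And>k l. k \<in> K \<Longrightarrow> l \<in> K \<Longrightarrow> k \<noteq> l \<Longrightarrow> S k l \<noteq> T k l \<Longrightarrow> \<bar>S k l\<bar> \<le> R k l \<and> \<bar>T k l\<bar> \<le> R k l \<and> R k l < 1"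
    and w: "0 \<le> w" "\<And>k. k \<in> K \<Longrightarrow> w \<le> \<bar>u k\<bar>"
    and d: "d > 0" and L: "w \<le> L" "\<And>k. k \<in> K \<Longrightarrow> - L \<le> u k"
  shows "\<bar>(\<integral>\<omega>. (\<Prod>k\<in>K. smoothed_indicator d (- L) (u k) (X k \<omega>)) \<partial>N)
      - (\<integral>\<omega>. (\<Prod>k\<in>K. smoothed_indicator d (- L) (u k) (Y k \<omega>)) \<partial>N')\<bar>
     \<le> (\<Sum>k\<in>K. \<Sum>l\<in>K - {k}. \<bar>S k l - T k l\<bar> * (exp (- w\<^sup>2 / (1 + R k l + d\<^sup>2)) / (pi * sqrt (1 - (R k l)\<^sup>2))))"
proof -
  have d2: "d\<^sup>2 > 0" using d by simp
  let ?e = "\<lambda>t. complex_of_real (exp (- d\<^sup>2 * t\<^sup>2 / 2) / (2 * pi))"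
  define h where "h = (\<lambda>k t. ?e t * (CLBINT y. indicator {- L..u k} y *\<^sub>R iexp (- t * y)))"
  define h' where "h' = (\<lambda>k t. \<i> * complex_of_real t * h k t)"
  define g where "g = (\<lambda>k x. complex_of_real (smoothed_indicator d (- L) (u k) x))"
  define g' where "g' = (\<lambda>k x. complex_of_real (normal_density 0 d (x - - L) - normal_density 0 d (x - u k)))"
  define B where "B = (\<lambda>k l. exp (- w\<^sup>2 / (1 + R k l + d\<^sup>2)) / (2 * pi * sqrt (1 - (R k l)\<^sup>2)))"
  have h'_eq: "h' k t = ?e t * iexp (- t * (- L)) - ?e t * iexp (- t * u k)" if "k \<in> K" for k t
    unfolding h'_def h_def by (rule fourier_smoothed_indicator(3)[OF d L(2)[OF that]])
  note ki = integrable_shifted_gaussian_kernel[OF d2]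
  have "norm ((CLINT \<omega>|N. \<Prod>k\<in>K. g k (X k \<omega>)) - (CLINT \<omega>|N'. \<Prod>k\<in>K. g k (Y k \<omega>)))
     \<le> (\<Sum>k\<in>K. \<Sum>l\<in>K - {k}. \<bar>S k l - T k l\<bar> * (4 * B k l)) / 2"
  proof (rule gaussian_comparison_smooth[OF X Y, where h=h and h'=h' and g'=g'])
    show "S k k = T k k" if "k \<in> K" for k using diag that by simp
    show "integrable lborel (h k)" if "k \<in> K" for k
      unfolding h_def by (rule fourier_smoothed_indicator(1)[OF d L(2)[OF that]])
    show "g k x = (CLBINT t. h k t * iexp (t * x))" if "k \<in> K" for k x
      unfolding h_def g_def by (rule fourier_smoothed_indicator(2)[OF d L(2)[OF that], symmetric])
    show "integrable lborel (h' k)" if "k \<in> K" for k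
      unfolding h'_eq[OF that, abs_def] by (intro Bochner_Integration.integrable_diff ki)
    show "g' k x = (CLBINT t. h' k t * iexp (t * x))" if "k \<in> K" for k x
    proof -
      have i: "integrable lborel (\<lambda>t. ?e t * iexp (- t * p) * iexp (t * x))" for p
      proof (rule Bochner_Integration.integrable_bound[OF ki[of p]])
        show "AE t in lborel. norm (?e t * iexp (- t * p) * iexp (t * x)) \<le> norm (?e t * iexp (- t * p))"
          by (intro AE_I2) (simp only: norm_mult_iexp order_refl)
      qed measurable
      show ?thesis
        unfolding h'_eq[OF that] left_diff_distrib Bochner_Integration.integral_diff[OF i i]
          fourier_shifted_gaussian_kernel[OF d2] g'_def using d by simp
    qed
    show "norm (g k x) \<le> 1" for k x
      using smoothed_indicator_bounds[OF d, of "- L" "u k" x] by (simp add: g_def)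
    fix s :: real and k l assume s: "0 \<le> s" "s \<le> 1" and kl: "k \<in> K" "l \<in> K" "k \<noteq> l" and ne: "S k l \<noteq> T k l"
    let ?Z = "\<lambda>k z. sqrt s * X k (fst z) + sqrt (1 - s) * Y k (snd z)"
    let ?N = "N \<Otimes>\<^sub>M N'"
    note Z = gaussian_cf_mixture[OF X Y s]
    interpret Z: prob_space ?N using gaussian_cfD(1)[OF Z] .
    note [measurable] = gaussian_cfD(3)[OF Z kl(1)] gaussian_cfD(3)[OF Z kl(2)]
    let ?r = "s * S k l + (1 - s) * T k l"
    note R' = R[OF kl ne]
    have "\<bar>?r\<bar> \<le> s * \<bar>S k l\<bar> + (1 - s) * \<bar>T k l\<bar>"
      using abs_triangle_ineq[of "s * S k l" "(1 - s) * T k l"] s by (simp add: abs_mult)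
    also have "\<dots> \<le> s * R k l + (1 - s) * R k l" using R' s by (intro add_mono mult_left_mono) auto
    finally have r: "\<bar>?r\<bar> \<le> R k l" by (simp add: algebra_simps)
    \<comment> \<open>The levels \<open>u k\<close> and the cut-off \<open>- L\<close> all have
      modulus at least \<open>w\<close>, so one bound serves every position of the two
      bumps.\<close>
    have e: "(\<integral>z. normal_density 0 d (?Z k z - a) * normal_density 0 d (?Z l z - b) \<partial>?N) \<le> B k l"
      if "w \<le> \<bar>a\<bar>" "w \<le> \<bar>b\<bar>" for a b
      unfolding B_def
      by (rule expectation_two_gaussian_kernels_le[OF Z kl _ _ refl _ r])
         (use diag kl sym[OF kl(1,2)] R' d w that in \<open>auto simp: algebra_simps\<close>)
    have nb: "normal_density 0 d x \<le> 1 / sqrt (2 * pi * d\<^sup>2)" for x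
      by (auto simp: normal_density_def intro!: divide_right_mono)
    have i: "integrable ?N (\<lambda>z. normal_density 0 d (?Z k z - a) * normal_density 0 d (?Z l z - b))" for a b
      by (rule Z.integrable_const_bound[where B="1 / sqrt (2 * pi * d\<^sup>2) * (1 / sqrt (2 * pi * d\<^sup>2))"])
         (auto intro!: AE_I2 mult_mono nb simp: abs_mult simp del: times_divide_eq_left times_divide_eq_right)
    \<comment> \<open>Each derivative is a difference of two bumps; the product of the moduli is at
      most a sum of four kernel products, whence the 4 in front of \<open>B\<close>.\<close>
    have "(\<integral>z. norm (g' k (?Z k z)) * norm (g' l (?Z l z)) \<partial>?N)
       \<le> (\<integral>z. (normal_density 0 d (?Z k z - - L) * normal_density 0 d (?Z l z - - L)
          + normal_density 0 d (?Z k z - - L) * normal_density 0 d (?Z l z - u l))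
          + (normal_density 0 d (?Z k z - u k) * normal_density 0 d (?Z l z - - L)
          + normal_density 0 d (?Z k z - u k) * normal_density 0 d (?Z l z - u l)) \<partial>?N)"
    proof (rule integral_mono')
      fix z
      have n: "norm (g' k x) \<le> normal_density 0 d (x - - L) + normal_density 0 d (x - u k)" for k x
        unfolding g'_def norm_of_real using normal_density_nonneg[of 0 d "x - - L"] normal_density_nonneg[of 0 d "x - u k"] by linarith
      have "norm (g' k (?Z k z)) * norm (g' l (?Z l z))
         \<le> (normal_density 0 d (?Z k z - - L) + normal_density 0 d (?Z k z - u k)) * (normal_density 0 d (?Z l z - - L) + normal_density 0 d (?Z l z - u l))"
        by (intro mult_mono n) auto
      then show "norm (g' k (?Z k z)) * norm (g' l (?Z l z)) \<le> (normal_density 0 d (?Z k z - - L) * normal_density 0 d (?Z l z - - L)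
          + normal_density 0 d (?Z k z - - L) * normal_density 0 d (?Z l z - u l))
          + (normal_density 0 d (?Z k z - u k) * normal_density 0 d (?Z l z - - L)
          + normal_density 0 d (?Z k z - u k) * normal_density 0 d (?Z l z - u l))"
        by (simp only: distrib_left distrib_right add_ac)
    qed (intro Bochner_Integration.integrable_add i | simp)+
    also have "\<dots> \<le> (B k l + B k l) + (B k l + B k l)"
      unfolding Bochner_Integration.integral_add[OF Bochner_Integration.integrable_add[OF i i] Bochner_Integration.integrable_add[OF i i]]
        Bochner_Integration.integral_add[OF i i]
      using w L kl by (intro add_mono e) auto
    finally show "(\<integral>z. norm (g' k (?Z k z)) * norm (g' l (?Z l z)) \<partial>?N) \<le> 4 * B k l" by simp
  qed (simp add: h'_def)
  also have "(CLINT \<omega>|N. \<Prod>k\<in>K. g k (X k \<omega>)) - (CLINT \<omega>|N'. \<Prod>k\<in>K. g k (Y k \<omega>))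
     = complex_of_real ((\<integral>\<omega>. (\<Prod>k\<in>K. smoothed_indicator d (- L) (u k) (X k \<omega>)) \<partial>N)
      - (\<integral>\<omega>. (\<Prod>k\<in>K. smoothed_indicator d (- L) (u k) (Y k \<omega>)) \<partial>N'))"
    unfolding g_def of_real_prod[symmetric] integral_complex_of_real by simp
  also have "norm (complex_of_real x) = \<bar>x\<bar>" for x by simp
  \<comment> \<open>\<open>4 / 2\<close> times the \<open>1 / (2 * pi)\<close> inside
    \<open>B\<close> gives the constant \<open>1 / pi\<close>.\<close>
  also have "(\<Sum>k\<in>K. \<Sum>l\<in>K - {k}. \<bar>S k l - T k l\<bar> * (4 * B k l)) / 2
     = (\<Sum>k\<in>K. \<Sum>l\<in>K - {k}. \<bar>S k l - T k l\<bar> * (exp (- w\<^sup>2 / (1 + R k l + d\<^sup>2)) / (pi * sqrt (1 - (R k l)\<^sup>2))))"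
    unfolding sum_divide_distrib by (intro sum.cong refl) (simp add: B_def field_simps)
  finally show ?thesis .
qed

text \<open>Berman's inequality up to a constant factor, each pair being counted in both orders; it
  follows from the smoothed version as the width tends to 0. Bounds below 1 are asked only at
  entries that differ, so a correlation common to both families may be arbitrarily close to
  1.\<close>

theorem normal_comparison:
  assumes X: "gaussian_cf N K X S" and Y: "gaussian_cf N' K Y T"
    and diag: "\<And>k. k \<in> K \<Longrightarrow> S k k = 1" "\<And>k. k \<in> K \<Longrightarrow> T k k = 1"
    and sym: "\<And>k l. k \<in> K \<Longrightarrow> l \<in> K \<Longrightarrow> S k l = S l k" "\<And>k l. k \<in> K \<Longrightarrow> l \<in> K \<Longrightarrow> T k l = T l k"
    and R: "\<And>k l. k \<in> K \<Longrightarrow> l \<in> K \<Longrightarrow> k \<noteq> l \<Longrightarrow> S k l \<noteq> T k l \<Longrightarrow> \<bar>S k l\<bar> \<le> R k l \<and> \<bar>T k l\<bar> \<le> R k l \<and> R k l < 1"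
    and w: "0 \<le> w" "\<And>k. k \<in> K \<Longrightarrow> w \<le> \<bar>u k\<bar>"
  shows "\<bar>measure N {\<omega> \<in> space N. \<forall>k\<in>K. X k \<omega> \<le> u k} - measure N' {\<omega> \<in> space N'. \<forall>k\<in>K. Y k \<omega> \<le> u k}\<bar>
     \<le> (\<Sum>k\<in>K. \<Sum>l\<in>K - {k}. \<bar>S k l - T k l\<bar> * (exp (- w\<^sup>2 / (1 + R k l)) / (pi * sqrt (1 - (R k l)\<^sup>2))))"
proof -
  have K: "finite K" using gaussian_cfD(2)[OF X] .
  have lim: "(\<lambda>m. \<integral>\<omega>. (\<Prod>k\<in>K. smoothed_indicator (1 / real (Suc m)) (- real (Suc m)) (u k) (Z k \<omega>)) \<partial>P)
     \<longlonglongrightarrow> measure P {\<omega> \<in> space P. \<forall>k\<in>K. Z k \<omega> \<le> u k}"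
    if Z: "gaussian_cf P K Z V" and V: "\<And>k. k \<in> K \<Longrightarrow> V k k = 1" for P Z V
  proof -
    interpret P: prob_space P using gaussian_cfD(1)[OF Z] .
    note [measurable] = gaussian_cfD(3)[OF Z]
    have [measurable]: "smoothed_indicator d a b \<in> borel_measurable borel" for d a b
      unfolding smoothed_indicator_def[abs_def] by measurable
    have "(\<lambda>m. \<integral>\<omega>. (\<Prod>k\<in>K. smoothed_indicator (1 / real (Suc m)) (- real (Suc m)) (u k) (Z k \<omega>)) \<partial>P)
       \<longlonglongrightarrow> (\<integral>\<omega>. (\<Prod>k\<in>K. indicator {..u k} (Z k \<omega>)) \<partial>P)"
    proof (rule integral_dominated_convergence[where w="\<lambda>_. 1"])
      have "AE \<omega> in P. \<forall>k\<in>K. Z k \<omega> \<noteq> u k"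
        using K gaussian_cf_AE_neq[OF Z] V by (auto intro!: AE_finite_allI)
      then show "AE \<omega> in P. (\<lambda>m. (\<Prod>k\<in>K. smoothed_indicator (1 / real (Suc m)) (- real (Suc m)) (u k) (Z k \<omega>)))
         \<longlonglongrightarrow> (\<Prod>k\<in>K. indicator {..u k} (Z k \<omega>))"
        by eventually_elim (intro tendsto_prod smoothed_indicator_tendsto, blast)
      show "AE \<omega> in P. norm (\<Prod>k\<in>K. smoothed_indicator (1 / real (Suc m)) (- real (Suc m)) (u k) (Z k \<omega>)) \<le> 1" for m
        unfolding prod_norm[symmetric] using smoothed_indicator_bounds[of "1 / real (Suc m)"]
        by (intro AE_I2 prod_le_1) auto
    qed auto
    also have "(\<integral>\<omega>. (\<Prod>k\<in>K. indicator {..u k} (Z k \<omega>)) \<partial>P :: real) = (\<integral>\<omega>. indicator {\<omega> \<in> space P. \<forall>k\<in>K. Z k \<omega> \<le> u k} \<omega> \<partial>P)"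
    proof (rule Bochner_Integration.integral_cong[OF refl])
      fix \<omega> assume "\<omega> \<in> space P"
      then show "(\<Prod>k\<in>K. indicator {..u k} (Z k \<omega>)) = (indicator {\<omega> \<in> space P. \<forall>k\<in>K. Z k \<omega> \<le> u k} \<omega> :: real)"
        using K by (auto simp: indicator_def)
    qed
    also have "\<dots> = measure P {\<omega> \<in> space P. \<forall>k\<in>K. Z k \<omega> \<le> u k}"
      using K by simp
    finally show ?thesis .
  qed
  \<comment> \<open>Large enough for \<open>- L\<close> to lie below every level and for
    \<open>w \<le> L\<close>.\<close>
  define L where "L = w + (\<Sum>k\<in>K. \<bar>u k\<bar>)"
  have uL: "- L \<le> u k" if "k \<in> K" for k
    using member_le_sum[OF that, of "\<lambda>k. \<bar>u k\<bar>"] K w by (auto simp: L_def)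
  have wL: "w \<le> L" by (auto simp: L_def intro!: sum_nonneg)
  show ?thesis
  proof (rule LIMSEQ_le)
    show "(\<lambda>m. \<bar>(\<integral>\<omega>. (\<Prod>k\<in>K. smoothed_indicator (1 / real (Suc m)) (- real (Suc m)) (u k) (X k \<omega>)) \<partial>N)
       - (\<integral>\<omega>. (\<Prod>k\<in>K. smoothed_indicator (1 / real (Suc m)) (- real (Suc m)) (u k) (Y k \<omega>)) \<partial>N')\<bar>)
       \<longlonglongrightarrow> \<bar>measure N {\<omega> \<in> space N. \<forall>k\<in>K. X k \<omega> \<le> u k} - measure N' {\<omega> \<in> space N'. \<forall>k\<in>K. Y k \<omega> \<le> u k}\<bar>"
      by (intro tendsto_intros lim[OF X diag(1)] lim[OF Y diag(2)])
    have "(\<lambda>m. \<bar>S k l - T k l\<bar> * (exp (- w\<^sup>2 / (1 + R k l + (1 / real (Suc m))\<^sup>2)) / (pi * sqrt (1 - (R k l)\<^sup>2))))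
      \<longlonglongrightarrow> \<bar>S k l - T k l\<bar> * (exp (- w\<^sup>2 / (1 + R k l)) / (pi * sqrt (1 - (R k l)\<^sup>2)))" if "k \<in> K" "l \<in> K" "k \<noteq> l" for k l
    proof (cases "S k l = T k l")
      \<comment> \<open>Only differing entries constrain \<open>R\<close>; at equal ones the
        prefactor is 0 and the convergence trivial.\<close>
      case False
      from R[OF that False] have "0 \<le> R k l" by linarith
      moreover have "(R k l)\<^sup>2 < 1" using R[OF that False] unfolding abs_square_less_1 by linarith
      moreover have "(\<lambda>m. 1 + R k l + (1 / real (Suc m))\<^sup>2) \<longlonglongrightarrow> 1 + R k l + 0\<^sup>2"
        by (intro tendsto_intros LIMSEQ_Suc[OF lim_1_over_n])
      ultimately show ?thesis
        by (intro tendsto_mult tendsto_const tendsto_divide tendsto_exp) auto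
    qed simp
    then show "(\<lambda>m. \<Sum>k\<in>K. \<Sum>l\<in>K - {k}. \<bar>S k l - T k l\<bar> * (exp (- w\<^sup>2 / (1 + R k l + (1 / real (Suc m))\<^sup>2)) / (pi * sqrt (1 - (R k l)\<^sup>2))))
      \<longlonglongrightarrow> (\<Sum>k\<in>K. \<Sum>l\<in>K - {k}. \<bar>S k l - T k l\<bar> * (exp (- w\<^sup>2 / (1 + R k l)) / (pi * sqrt (1 - (R k l)\<^sup>2))))"
      by (intro tendsto_sum) auto
    obtain m0 :: nat where m0: "L \<le> real m0" using real_arch_simple by blast
    show "\<exists>m0. \<forall>m\<ge>m0. \<bar>(\<integral>\<omega>. (\<Prod>k\<in>K. smoothed_indicator (1 / real (Suc m)) (- real (Suc m)) (u k) (X k \<omega>)) \<partial>N)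
       - (\<integral>\<omega>. (\<Prod>k\<in>K. smoothed_indicator (1 / real (Suc m)) (- real (Suc m)) (u k) (Y k \<omega>)) \<partial>N')\<bar>
       \<le> (\<Sum>k\<in>K. \<Sum>l\<in>K - {k}. \<bar>S k l - T k l\<bar> * (exp (- w\<^sup>2 / (1 + R k l + (1 / real (Suc m))\<^sup>2)) / (pi * sqrt (1 - (R k l)\<^sup>2))))"
    proof (intro exI[of _ m0] allI impI)
      fix m assume "m0 \<le> m"
      then have m: "L \<le> real (Suc m)" using m0 by linarith
      show "\<bar>(\<integral>\<omega>. (\<Prod>k\<in>K. smoothed_indicator (1 / real (Suc m)) (- real (Suc m)) (u k) (X k \<omega>)) \<partial>N)
       - (\<integral>\<omega>. (\<Prod>k\<in>K. smoothed_indicator (1 / real (Suc m)) (- real (Suc m)) (u k) (Y k \<omega>)) \<partial>N')\<bar>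
       \<le> (\<Sum>k\<in>K. \<Sum>l\<in>K - {k}. \<bar>S k l - T k l\<bar> * (exp (- w\<^sup>2 / (1 + R k l + (1 / real (Suc m))\<^sup>2)) / (pi * sqrt (1 - (R k l)\<^sup>2))))"
      proof (rule smoothed_orthant_comparison[OF X Y diag sym R w])
        show "w \<le> real (Suc m)" using m wL by linarith
        show "- real (Suc m) \<le> u k" if "k \<in> K" for k using m uL[OF that] by linarith
      qed auto
    qed
  qed
qed

section \<open>Jointly Gaussian families and independent copies\<close>

lemma (in prob_space) gaussian_rv_square_integrable:
  assumes "gaussian_rv M Y"
  shows "integrable M (\<lambda>\<omega>. (Y \<omega>)\<^sup>2)"
proof -
  have [measurable]: "Y \<in> borel_measurable M" using assms by (simp add: gaussian_rv_def)
  consider m s where "s > 0" "distributed M lborel Y (\<lambda>t. ennreal (normal_density m s t))" | m where "AE \<omega> in M. Y \<omega> = m"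
    using assms by (auto simp: gaussian_rv_def)
  then show ?thesis
  proof cases
    case (1 m s)
    have "integrable lborel (\<lambda>t. normal_density m s t * (t - m) ^ 2 + 2 * m * (normal_density m s t * t) - m\<^sup>2 * normal_density m s t)"
      using 1 by (intro Bochner_Integration.integrable_add Bochner_Integration.integrable_diff integrable_mult_right
          integrable_normal_moment integrable_normal_moment_nz_1 integrable_normal_density) auto
    also have "(\<lambda>t. normal_density m s t * (t - m) ^ 2 + 2 * m * (normal_density m s t * t) - m\<^sup>2 * normal_density m s t) = (\<lambda>t. normal_density m s t * t\<^sup>2)"
      by (auto simp: power2_eq_square algebra_simps)
    finally show ?thesis
      using distributed_integrable[OF 1(2), of "\<lambda>t. t\<^sup>2"] by simp
  next
    case (2 m)
    then have "integrable M (\<lambda>\<omega>. (Y \<omega>)\<^sup>2) \<longleftrightarrow> integrable M (\<lambda>\<omega>. m\<^sup>2)"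
      by (intro integrable_cong_AE) auto
    then show ?thesis by simp
  qed
qed

lemma (in prob_space) gaussian_rv_cf:
  assumes Y: "gaussian_rv M Y" and mean: "expectation Y = 0"
  shows "(CLINT \<omega>|M. iexp (Y \<omega>)) = complex_of_real (exp (- expectation (\<lambda>\<omega>. (Y \<omega>)\<^sup>2) / 2))"
proof -
  have [measurable]: "Y \<in> borel_measurable M" using Y by (simp add: gaussian_rv_def)
  consider m s where "s > 0" "distributed M lborel Y (\<lambda>t. ennreal (normal_density m s t))" | m where "AE \<omega> in M. Y \<omega> = m"
    using Y by (auto simp: gaussian_rv_def)
  then show ?thesis
  proof cases
    case (1 m s)
    have m: "m = 0" using normal_distributed_expectation[OF 1] mean by simp
    have v: "expectation (\<lambda>\<omega>. (Y \<omega>)\<^sup>2) = s\<^sup>2"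
      using normal_distributed_variance[OF 1] mean by simp
    have "distributed M lborel (\<lambda>\<omega>. Y \<omega> / s) std_normal_density"
      using 1 normal_standard_normal_convert[of s Y m] m by simp
    then have "distr M lborel (\<lambda>\<omega>. Y \<omega> / s) = std_normal_distribution"
      by (simp add: distributed_def)
    then have "char std_normal_distribution s = char (distr M lborel (\<lambda>\<omega>. Y \<omega> / s)) s" by simp
    also have "\<dots> = (CLINT \<omega>|M. iexp (s * (Y \<omega> / s)))"
      unfolding char_def by (rule integral_distr) auto
    finally have "char std_normal_distribution s = (CLINT \<omega>|M. iexp (s * (Y \<omega> / s)))" .
    with 1 v show ?thesis by (simp add: char_std_normal_distribution)
  next
    case (2 m)
    then have "expectation Y = expectation (\<lambda>_. m)" by (intro integral_cong_AE) auto
    then have "m = 0" using mean by (simp add: prob_space)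
    with 2 have 0: "AE \<omega> in M. Y \<omega> = 0" by simp
    then have "(CLINT \<omega>|M. iexp (Y \<omega>)) = (CLINT \<omega>|M. 1)" by (intro integral_cong_AE) auto
    moreover have "expectation (\<lambda>\<omega>. (Y \<omega>)\<^sup>2) = expectation (\<lambda>\<omega>. 0)" using 0 by (intro integral_cong_AE) auto
    ultimately show ?thesis by (simp add: prob_space)
  qed
qed

text \<open>The Cramer-Wold device: the joint characteristic function at \<open>t\<close> is that of
  one linear combination at 1, and the second moment of this combination is the quadratic
  form.\<close>

lemma (in prob_space) jointly_gaussian_cf:
  assumes Z: "jointly_gaussian M K Z" and mean: "\<And>k. k \<in> K \<Longrightarrow> expectation (Z k) = 0"
  shows "gaussian_cf M K Z (\<lambda>k l. expectation (\<lambda>\<omega>. Z k \<omega> * Z l \<omega>))"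
  unfolding gaussian_cf_def
proof (intro conjI ballI allI)
  show K: "finite K" and "prob_space M" using Z prob_space_axioms by (auto simp: jointly_gaussian_def)
  have G: "gaussian_rv M (\<lambda>\<omega>. \<Sum>k\<in>K. t k * Z k \<omega>)" for t
    using Z by (simp add: jointly_gaussian_def)
  have Gk: "gaussian_rv M (Z k)" if "k \<in> K" for k
  proof -
    have "(\<Sum>l\<in>K. (if l = k then 1 else 0) * Z l \<omega>) = Z k \<omega>" for \<omega>
      using K that by (subst sum.remove[of K k]) (auto intro!: sum.neutral)
    with G[of "\<lambda>l. if l = k then 1 else 0"] show ?thesis by simp
  qed
  then show m[measurable]: "Z k \<in> borel_measurable M" if "k \<in> K" for k
    using that by (auto simp: gaussian_rv_def)
  note sq = gaussian_rv_square_integrable[OF Gk]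
  have i1: "integrable M (Z k)" if "k \<in> K" for k
    using square_integrable_imp_integrable[OF m[OF that] sq[OF that]] .
  have i2: "integrable M (\<lambda>\<omega>. Z k \<omega> * Z l \<omega>)" if "k \<in> K" "l \<in> K" for k l
  proof (rule Bochner_Integration.integrable_bound)
    show "integrable M (\<lambda>\<omega>. (Z k \<omega>)\<^sup>2 + (Z l \<omega>)\<^sup>2)"
      by (intro Bochner_Integration.integrable_add sq that)
    have "\<bar>a * b\<bar> \<le> \<bar>a\<^sup>2 + b\<^sup>2\<bar>" for a b :: real
    proof -
      have "2 * \<bar>a * b\<bar> \<le> a\<^sup>2 + b\<^sup>2" using sum_squares_bound[of "\<bar>a\<bar>" "\<bar>b\<bar>"] by (simp add: abs_mult mult.assoc)
      then show ?thesis using abs_ge_zero[of "a * b"] by linarith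
    qed
    then show "AE \<omega> in M. norm (Z k \<omega> * Z l \<omega>) \<le> norm ((Z k \<omega>)\<^sup>2 + (Z l \<omega>)\<^sup>2)" by simp
  qed (use that in measurable)
  fix t
  have "expectation (\<lambda>\<omega>. \<Sum>k\<in>K. t k * Z k \<omega>) = (\<Sum>k\<in>K. expectation (\<lambda>\<omega>. t k * Z k \<omega>))"
    by (intro Bochner_Integration.integral_sum integrable_mult_right i1)
  also have "\<dots> = 0" by (simp add: mean)
  finally have E0: "expectation (\<lambda>\<omega>. \<Sum>k\<in>K. t k * Z k \<omega>) = 0" .
  have "(\<lambda>\<omega>. (\<Sum>k\<in>K. t k * Z k \<omega>)\<^sup>2) = (\<lambda>\<omega>. \<Sum>k\<in>K. \<Sum>l\<in>K. (t k * t l) * (Z k \<omega> * Z l \<omega>))"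
    unfolding power2_eq_square sum_product by (simp add: mult_ac)
  then have "expectation (\<lambda>\<omega>. (\<Sum>k\<in>K. t k * Z k \<omega>)\<^sup>2) = (\<Sum>k\<in>K. expectation (\<lambda>\<omega>. \<Sum>l\<in>K. (t k * t l) * (Z k \<omega> * Z l \<omega>)))"
    by (simp only:, intro Bochner_Integration.integral_sum Bochner_Integration.integrable_sum integrable_mult_right i2)
  also have "\<dots> = (\<Sum>k\<in>K. \<Sum>l\<in>K. expectation (\<lambda>\<omega>. (t k * t l) * (Z k \<omega> * Z l \<omega>)))"
    by (intro sum.cong refl Bochner_Integration.integral_sum integrable_mult_right i2)
  also have "\<dots> = quad_form K (\<lambda>k l. expectation (\<lambda>\<omega>. Z k \<omega> * Z l \<omega>)) t"
    by (simp add: quad_form_def mult_ac)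
  finally show "(CLINT \<omega>|M. iexp (\<Sum>k\<in>K. t k * Z k \<omega>)) = complex_of_real (exp (- quad_form K (\<lambda>k l. expectation (\<lambda>\<omega>. Z k \<omega> * Z l \<omega>)) t / 2))"
    using gaussian_rv_cf[OF G E0] by simp
qed

lemma gaussian_cf_mono:
  fixes K :: "'b set"
  assumes Z: "gaussian_cf N K Z S" and A: "A \<subseteq> K"
  shows "gaussian_cf N A Z S"
  unfolding gaussian_cf_def
proof (intro conjI ballI allI)
  have K: "finite K" using gaussian_cfD(2)[OF Z] .
  show "finite A" using K A by (rule finite_subset[rotated])
  fix t :: "'b \<Rightarrow> real"
  let ?t = "\<lambda>k. if k \<in> A then t k else 0"
  have "(\<Sum>k\<in>K. ?t k * Z k \<omega>) = (\<Sum>k\<in>A. t k * Z k \<omega>)" for \<omega>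
    using K A by (intro sum.mono_neutral_cong_right) auto
  moreover have "quad_form K S ?t = quad_form A S t"
    using K A by (subst quad_form_support[of K A]) (auto simp: quad_form_def)
  ultimately show "(CLINT \<omega>|N. iexp (\<Sum>k\<in>A. t k * Z k \<omega>)) = complex_of_real (exp (- quad_form A S t / 2))"
    using gaussian_cfD(4)[OF Z, of ?t] by simp
qed (use gaussian_cfD[OF Z] A in auto)

lemma gaussian_cf_reindex:
  fixes J :: "'c set"
  assumes Z: "gaussian_cf N K Z S" and f: "bij_betw f J K"
  shows "gaussian_cf N J (\<lambda>j. Z (f j)) (\<lambda>i j. S (f i) (f j))"
  unfolding gaussian_cf_def
proof (intro conjI ballI allI)
  show "finite J" using gaussian_cfD(2)[OF Z] bij_betw_finite[OF f] by simp
  show "Z (f j) \<in> borel_measurable N" if "j \<in> J" for j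
    using gaussian_cfD(3)[OF Z] bij_betwE[OF f] that by auto
  fix t :: "'c \<Rightarrow> real"
  let ?t = "\<lambda>k. t (inv_into J f k)"
  have inv: "inv_into J f (f j) = j" if "j \<in> J" for j
    using bij_betw_inv_into_left[OF f that] .
  have "(\<Sum>k\<in>K. ?t k * Z k \<omega>) = (\<Sum>j\<in>J. t j * Z (f j) \<omega>)" for \<omega>
    unfolding sum.reindex_bij_betw[OF f, symmetric] using inv by (intro sum.cong) auto
  moreover have "quad_form K S ?t = quad_form J (\<lambda>i j. S (f i) (f j)) t"
    unfolding quad_form_def sum.reindex_bij_betw[OF f, symmetric] using inv by (intro sum.cong refl) auto
  ultimately show "(CLINT \<omega>|N. iexp (\<Sum>j\<in>J. t j * Z (f j) \<omega>)) = complex_of_real (exp (- quad_form J (\<lambda>i j. S (f i) (f j)) t / 2))"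
    using gaussian_cfD(4)[OF Z, of ?t] by simp
qed (use gaussian_cfD[OF Z] in auto)

text \<open>Independence over \<open>A\<close> factorises the characteristic function, exactly as a
  block-diagonal covariance splits the exponential. Indices are pairs of component and copy, to
  match those of a row of the array.\<close>

lemma gaussian_cf_iid_copies:
  assumes Z: "gaussian_cf N J Z S" and A: "finite A"
  shows "gaussian_cf (PiM A (\<lambda>_. N)) (J \<times> A) (\<lambda>p \<omega>. Z (fst p) (\<omega> (snd p)))
     (\<lambda>p q. if snd p = snd q then S (fst p) (fst q) else 0)" (is "gaussian_cf _ _ _ ?T")
  unfolding gaussian_cf_def
proof (intro conjI ballI allI)
  interpret N: prob_space N using gaussian_cfD(1)[OF Z] .
  interpret P: product_prob_space "\<lambda>_. N" A ..
  have J: "finite J" using gaussian_cfD(2)[OF Z] .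
  show "prob_space (PiM A (\<lambda>_. N))" by (rule P.prob_space_axioms)
  show "finite (J \<times> A)" using J A by simp
  note [measurable] = gaussian_cfD(3)[OF Z]
  show "(\<lambda>\<omega>. Z (fst p) (\<omega> (snd p))) \<in> borel_measurable (PiM A (\<lambda>_. N))" if "p \<in> J \<times> A" for p
    using that gaussian_cfD(3)[OF Z, of "fst p"] by (auto intro!: measurable_compose[of "\<lambda>\<omega>. \<omega> (snd p)" _ N] measurable_component_singleton)
  fix t
  have "(CLINT \<omega>|PiM A (\<lambda>_. N). iexp (\<Sum>p\<in>J \<times> A. t p * Z (fst p) (\<omega> (snd p))))
     = (CLINT \<omega>|PiM A (\<lambda>_. N). \<Prod>k\<in>A. iexp (\<Sum>i\<in>J. t (i, k) * Z i (\<omega> k)))"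
  proof (intro Bochner_Integration.integral_cong refl)
    fix \<omega>
    have "(\<Sum>p\<in>J \<times> A. t p * Z (fst p) (\<omega> (snd p))) = (\<Sum>k\<in>A. \<Sum>i\<in>J. t (i, k) * Z i (\<omega> k))"
      by (subst sum.swap) (simp add: sum.cartesian_product split_beta)
    then show "iexp (\<Sum>p\<in>J \<times> A. t p * Z (fst p) (\<omega> (snd p))) = (\<Prod>k\<in>A. iexp (\<Sum>i\<in>J. t (i, k) * Z i (\<omega> k)))"
      using A by (simp only: exp_sum[symmetric] of_real_sum sum_distrib_left)
  qed
  also have "\<dots> = (\<Prod>k\<in>A. (CLINT \<omega>|N. iexp (\<Sum>i\<in>J. t (i, k) * Z i \<omega>)))"
    by (rule P.product_integral_prod[OF A]) (auto intro!: N.integrable_const_bound[where B=1])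
  also have "\<dots> = (\<Prod>k\<in>A. complex_of_real (exp (- quad_form J S (\<lambda>i. t (i, k)) / 2)))"
    by (simp only: gaussian_cfD(4)[OF Z])
  also have "\<dots> = complex_of_real (exp (\<Sum>k\<in>A. - quad_form J S (\<lambda>i. t (i, k)) / 2))"
    using A by (simp add: exp_sum)
  also have "(\<Sum>k\<in>A. - quad_form J S (\<lambda>i. t (i, k)) / 2) = - quad_form (J \<times> A) ?T t / 2"
  proof -
    have "quad_form (J \<times> A) ?T t = (\<Sum>i\<in>J. \<Sum>k\<in>A. \<Sum>j\<in>J. \<Sum>l\<in>A. (if k = l then S i j else 0) * (t (i, k) * t (j, l)))"
      unfolding quad_form_def sum.cartesian_product' fst_conv snd_conv ..
    also have "\<dots> = (\<Sum>i\<in>J. \<Sum>k\<in>A. \<Sum>j\<in>J. S i j * (t (i, k) * t (j, k)))"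
    proof (intro sum.cong refl)
      fix i k j assume "k \<in> A"
      then show "(\<Sum>l\<in>A. (if k = l then S i j else 0) * (t (i, k) * t (j, l))) = S i j * (t (i, k) * t (j, k))"
        using A by (subst sum.remove[of A k]) (auto intro!: sum.neutral split: if_splits)
    qed
    also have "\<dots> = (\<Sum>k\<in>A. quad_form J S (\<lambda>i. t (i, k)))"
      unfolding quad_form_def by (rule sum.swap)
    finally show ?thesis by (simp add: sum_negf sum_divide_distrib)
  qed
  finally show "(CLINT \<omega>|PiM A (\<lambda>_. N). iexp (\<Sum>p\<in>J \<times> A. t p * Z (fst p) (\<omega> (snd p)))) = complex_of_real (exp (- quad_form (J \<times> A) ?T t / 2))" .
qed

text \<open>The levels depend on the component only, so the event is a rectangle with the same side
  in every copy.\<close>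

lemma measure_iid_copies_orthant:
  assumes Z: "gaussian_cf N J Z S" and A: "finite A"
  shows "measure (PiM A (\<lambda>_. N)) {\<omega> \<in> space (PiM A (\<lambda>_. N)). \<forall>p\<in>J \<times> A. Z (fst p) (\<omega> (snd p)) \<le> u (fst p)}
     = measure N {\<omega> \<in> space N. \<forall>i\<in>J. Z i \<omega> \<le> u i} ^ card A"
proof -
  interpret N: prob_space N using gaussian_cfD(1)[OF Z] .
  interpret P: finite_product_prob_space "\<lambda>_. N" A by standard (rule A)
  have J: "finite J" using gaussian_cfD(2)[OF Z] .
  note [measurable] = gaussian_cfD(3)[OF Z]
  let ?E = "{\<omega> \<in> space N. \<forall>i\<in>J. Z i \<omega> \<le> u i}"
  have "{\<omega> \<in> space (PiM A (\<lambda>_. N)). \<forall>p\<in>J \<times> A. Z (fst p) (\<omega> (snd p)) \<le> u (fst p)} = (\<Pi>\<^sub>E k\<in>A. ?E)"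
    by (auto simp: space_PiM PiE_def Pi_def)
  moreover have "measure (PiM A (\<lambda>_. N)) (\<Pi>\<^sub>E k\<in>A. ?E) = (\<Prod>k\<in>A. measure N ?E)"
    using J by (intro P.prob_times) measurable
  ultimately show ?thesis by simp
qed

section \<open>The standard model of a correlated pair\<close>

abbreviation std_normal_plane :: "(real \<times> real) measure" where
  "std_normal_plane \<equiv> std_normal_distribution \<Otimes>\<^sub>M std_normal_distribution"

lemma prob_space_std_normal: "prob_space std_normal_distribution"
  using real_dist_normal_dist by (simp add: real_distribution_def)

text \<open>The coefficients form the Cholesky factor of the two-by-two correlation matrix; for
  \<open>r = 1\<close> and \<open>r = - 1\<close> the second noise term vanishes.\<close>

lemma gaussian_cf_std_normal_plane:
  assumes r: "\<bar>r\<bar> \<le> 1"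
  shows "gaussian_cf std_normal_plane {1, 2::nat} (\<lambda>i z. if i = 1 then fst z else r * fst z + sqrt (1 - r\<^sup>2) * snd z)
     (\<lambda>i j. if i = j then 1 else r)" (is "gaussian_cf _ _ ?Z ?S")
  unfolding gaussian_cf_def
proof (intro conjI ballI allI)
  interpret N: prob_space std_normal_distribution by (rule prob_space_std_normal)
  interpret P: pair_prob_space std_normal_distribution std_normal_distribution ..
  show "prob_space std_normal_plane" by (rule P.prob_space_axioms)
  show "(\<lambda>z. if i = 1 then fst z else r * fst z + sqrt (1 - r\<^sup>2) * snd z) \<in> borel_measurable std_normal_plane" for i :: nat
    by measurable
  fix t :: "nat \<Rightarrow> real"
  have "r\<^sup>2 \<le> 1" using r by (simp add: abs_square_le_1)
  then have s: "(sqrt (1 - r\<^sup>2))\<^sup>2 = 1 - r\<^sup>2" by simp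
  have "(CLINT z|std_normal_plane. iexp (\<Sum>i\<in>{1, 2}. t i * ?Z i z))
     = (CLINT z|std_normal_plane. iexp ((t 1 + r * t 2) * fst z) * iexp ((sqrt (1 - r\<^sup>2) * t 2) * snd z))"
    by (intro Bochner_Integration.integral_cong refl) (simp add: algebra_simps flip: exp_add)
  also have "\<dots> = char std_normal_distribution (t 1 + r * t 2) * char std_normal_distribution (sqrt (1 - r\<^sup>2) * t 2)"
    unfolding char_def
    by (rule integral_pair_mult) (auto intro!: prob_space_std_normal N.integrable_const_bound[where B=1])
  also have "\<dots> = complex_of_real (exp (- ((t 1 + r * t 2)\<^sup>2 + (sqrt (1 - r\<^sup>2) * t 2)\<^sup>2) / 2))"
    by (simp add: char_std_normal_distribution add_divide_distrib flip: of_real_mult exp_add)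
  also have "(t 1 + r * t 2)\<^sup>2 + (sqrt (1 - r\<^sup>2) * t 2)\<^sup>2 = quad_form {1, 2} ?S t"
    unfolding power_mult_distrib s by (simp add: quad_form_def power2_eq_square algebra_simps)
  finally show "(CLINT z|std_normal_plane. iexp (\<Sum>i\<in>{1, 2}. t i * ?Z i z)) = complex_of_real (exp (- quad_form {1, 2} ?S t / 2))" .
qed simp

text \<open>For equal covariances the comparison bound vanishes; this replaces the uniqueness theorem for
  multivariate characteristic functions.\<close>

lemma gaussian_pair_orthant:
  assumes Z: "gaussian_cf N {1, 2::nat} Z S" and S: "S 1 1 = 1" "S 2 2 = 1" "S 1 2 = r" "S 2 1 = r" and r: "\<bar>r\<bar> \<le> 1"
  shows "measure N {\<omega> \<in> space N. \<forall>i\<in>{1, 2}. Z i \<omega> \<le> u i}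
     = measure std_normal_plane {z \<in> space std_normal_plane. fst z \<le> u 1 \<and> r * fst z + sqrt (1 - r\<^sup>2) * snd z \<le> u 2}"
proof -
  let ?S = "\<lambda>i j::nat. if i = j then 1 else r"
  let ?Z = "\<lambda>(i::nat) z. if i = 1 then fst z else r * fst z + sqrt (1 - r\<^sup>2) * snd z"
  have "\<bar>measure N {\<omega> \<in> space N. \<forall>i\<in>{1, 2}. Z i \<omega> \<le> u i} - measure std_normal_plane {z \<in> space std_normal_plane. \<forall>i\<in>{1, 2}. ?Z i z \<le> u i}\<bar>
    \<le> (\<Sum>k\<in>{1, 2}. \<Sum>l\<in>{1, 2} - {k}. \<bar>S k l - ?S k l\<bar> * (exp (- 0\<^sup>2 / (1 + 0)) / (pi * sqrt (1 - 0\<^sup>2))))"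
    \<comment> \<open>The entries agree, so the condition on \<open>R\<close> is vacuous and
      \<open>w = 0\<close>, \<open>R = 0\<close> may be inserted.\<close>
    by (rule normal_comparison[OF Z gaussian_cf_std_normal_plane[OF r]]) (use S in auto)
  also have "\<dots> = 0" using S by (auto intro!: sum.neutral)
  finally show ?thesis by simp
qed

section \<open>Tails at the extreme-value scale\<close>

lemma norm_a_pos: "n \<ge> 2 \<Longrightarrow> norm_a n > 0"
proof -
  assume "n \<ge> 2"
  then have "ln (real n) > 0" by simp
  then show ?thesis unfolding norm_a_def by simp
qed

lemma norm_u_eq: "norm_u n s = sqrt (2 * ln (real n)) + (s - ln (4 * pi * ln (real n)) / 2) / sqrt (2 * ln (real n))"
proof -
  have "1 / r * s + (r - 1 / (2 * r) * l) = r + (s - l / 2) / r" for r l :: real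
    by (simp add: diff_divide_distrib)
  then show ?thesis unfolding norm_u_def norm_a_def norm_b_def .
qed

lemma norm_u_square:
  assumes "n \<ge> 2"
  defines "L \<equiv> ln (real n)"
  defines "c \<equiv> \<lambda>s. s - ln (4 * pi * L) / 2"
  shows "(norm_u n s)\<^sup>2 = 2 * L + 2 * c s + (c s)\<^sup>2 / (2 * L)"
proof -
  have L: "L > 0" using assms(1) by (simp add: L_def)
  have "(sqrt (2 * L) + c s / sqrt (2 * L))\<^sup>2 = (sqrt (2 * L))\<^sup>2 + 2 * c s * (sqrt (2 * L) / sqrt (2 * L)) + (c s)\<^sup>2 / (sqrt (2 * L))\<^sup>2"
    by (simp add: power2_eq_square field_simps)
  also have "\<dots> = 2 * L + 2 * c s + (c s)\<^sup>2 / (2 * L)" using L by simp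
  finally show ?thesis unfolding norm_u_eq L_def c_def .
qed

text \<open>\<open>real n\<close> times the density of \<open>(t - norm_b n) / norm_a n\<close> for
  standard normal \<open>t\<close>; \<open>norm_a n\<close> is the Jacobian.\<close>

definition tail_density :: "nat \<Rightarrow> real \<Rightarrow> real" where
  "tail_density n s = real n * norm_a n * std_normal_density (norm_u n s)"

text \<open>The logarithm in \<open>norm_b\<close> is tuned to this: its exponential
  \<open>sqrt (4 * pi * L)\<close> cancels the \<open>sqrt (2 * L)\<close> of \<open>norm_a\<close>
  and the \<open>sqrt (2 * pi)\<close> of the density, while \<open>exp (- L)\<close> cancels
  \<open>real n\<close>. What remains beside \<open>exp (- s)\<close> is at most 1 and tends to
  1.\<close>

lemma tail_density_eq:
  assumes n: "n \<ge> 2"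
  shows "tail_density n s = exp (- s) * exp (- (s - ln (4 * pi * ln (real n)) / 2)\<^sup>2 / (4 * ln (real n)))"
proof -
  define L where "L = ln (real n)"
  define c where "c = s - ln (4 * pi * L) / 2"
  have L: "L > 0" using n by (simp add: L_def)
  have "exp (- (norm_u n s)\<^sup>2 / 2) = exp (- L + (- s + (ln (4 * pi * L) / 2 + - c\<^sup>2 / (4 * L))))"
    unfolding norm_u_square[OF n] L_def[symmetric] c_def by (simp add: field_simps)
  also have "\<dots> = exp (- L) * (exp (- s) * (exp (ln (4 * pi * L) / 2) * exp (- c\<^sup>2 / (4 * L))))"
    by (simp only: exp_add)
  also have "exp (- L) = 1 / real n" using n by (simp add: L_def exp_minus inverse_eq_divide)
  also have "exp (ln (4 * pi * L) / 2) = sqrt (4 * pi * L)"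
    using L by (simp add: ln_sqrt[symmetric])
  finally have e: "exp (- (norm_u n s)\<^sup>2 / 2) = 1 / real n * (exp (- s) * (sqrt (4 * pi * L) * exp (- c\<^sup>2 / (4 * L))))" .
  have "sqrt (4 * pi * L) = sqrt (2 * L) * sqrt (2 * pi)"
    by (subst real_sqrt_mult[symmetric]) (simp add: mult_ac)
  then show ?thesis
    unfolding tail_density_def std_normal_density_def e norm_a_def L_def[symmetric] c_def[symmetric]
    using n L by simp
qed

lemma tail_density_nonneg: "0 \<le> tail_density n s"
proof (cases "n = 0")
  case False
  then show ?thesis by (simp add: tail_density_def norm_a_def)
qed (simp add: tail_density_def)

lemma tail_density_le:
  assumes "n \<ge> 2"
  shows "tail_density n s \<le> exp (- s)"
proof -
  have "- (s - ln (4 * pi * ln (real n)) / 2)\<^sup>2 / (4 * ln (real n)) \<le> 0"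
    using assms by (intro divide_nonpos_nonneg) auto
  then show ?thesis
    unfolding tail_density_eq[OF assms] by (intro mult_left_le) (simp_all only: exp_le_one_iff exp_ge_zero)
qed

lemma tail_density_tendsto: "(\<lambda>n. tail_density n s) \<longlonglongrightarrow> exp (- s)"
proof -
  have "(\<lambda>n. exp (- s) * exp (- (s - ln (4 * pi * ln (real n)) / 2)\<^sup>2 / (4 * ln (real n)))) \<longlonglongrightarrow> exp (- s)"
    by real_asymp
  moreover have "eventually (\<lambda>n. exp (- s) * exp (- (s - ln (4 * pi * ln (real n)) / 2)\<^sup>2 / (4 * ln (real n))) = tail_density n s) sequentially"
    using eventually_ge_at_top[of 2] by eventually_elim (simp add: tail_density_eq)
  ultimately show ?thesis by (rule Lim_transform_eventually)
qed

lemma measurable_norm_u [measurable]: "norm_u n \<in> borel_measurable borel"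
  unfolding norm_u_def[abs_def] by measurable

lemma measurable_tail_density [measurable]: "tail_density n \<in> borel_measurable borel"
  unfolding tail_density_def[abs_def] by measurable

lemma norm_u_less_iff: "n \<ge> 2 \<Longrightarrow> norm_u n x < norm_u n s \<longleftrightarrow> x < s"
  using norm_a_pos[of n] unfolding norm_u_def by (simp only: add_less_cancel_right mult_less_cancel_left_pos)

lemma tail_integral_rescale:
  fixes q :: "real \<Rightarrow> real"
  assumes n: "n \<ge> 2"
  shows "real n * (\<integral>t. std_normal_density t * (indicator {norm_u n x<..} t * q t) \<partial>lborel)
     = (\<integral>s. indicator {x<..} s * (tail_density n s * q (norm_u n s)) \<partial>lborel)"
proof -
  have "(\<integral>t. std_normal_density t * (indicator {norm_u n x<..} t * q t) \<partial>lborel)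
      = norm_a n * (\<integral>s. std_normal_density (norm_u n s) * (indicator {norm_u n x<..} (norm_u n s) * q (norm_u n s)) \<partial>lborel)"
    using norm_a_pos[OF n] by (subst lborel_integral_real_affine[of "norm_a n" _ "norm_b n"]) (auto simp: norm_u_def add_ac)
  also have "real n * \<dots> = (\<integral>s. real n * (norm_a n * (std_normal_density (norm_u n s) * (indicator {norm_u n x<..} (norm_u n s) * q (norm_u n s)))) \<partial>lborel)"
    by (simp only: integral_mult_right_zero)
  also have "\<dots> = (\<integral>s. indicator {x<..} s * (tail_density n s * q (norm_u n s)) \<partial>lborel)"
  proof (intro Bochner_Integration.integral_cong refl)
    fix s
    have "indicator {norm_u n x<..} (norm_u n s) = (indicator {x<..} s :: real)"
      unfolding indicator_def greaterThan_iff norm_u_less_iff[OF n] ..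
    then show "real n * (norm_a n * (std_normal_density (norm_u n s) * (indicator {norm_u n x<..} (norm_u n s) * q (norm_u n s))))
       = indicator {x<..} s * (tail_density n s * q (norm_u n s))"
      unfolding tail_density_def by (simp only: mult.assoc mult.left_commute)
  qed
  finally show ?thesis .
qed

lemma has_bochner_integral_exp_tail:
  "has_bochner_integral lborel (\<lambda>s. indicator {x<..} s * exp (- s)) (exp (- x) :: real)"
proof -
  have "(\<integral>\<^sup>+s. ennreal (exp (- s)) * indicator {x..} s \<partial>lborel) = ennreal (0 - (- exp (- x)))"
  proof (rule nn_integral_FTC_atLeast[where F="\<lambda>s. - exp (- s)"])
    show "((\<lambda>s::real. - exp (- s)) \<longlongrightarrow> 0) at_top" by real_asymp
  qed (auto intro!: derivative_eq_intros)
  moreover have "(\<integral>\<^sup>+s. ennreal (indicator {x<..} s * exp (- s)) \<partial>lborel) = (\<integral>\<^sup>+s. ennreal (exp (- s)) * indicator {x..} s \<partial>lborel)"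
    using AE_lborel_singleton[of x]
    by (intro nn_integral_cong_AE) (auto simp: indicator_def elim!: eventually_mono)
  ultimately show ?thesis
    by (intro has_bochner_integral_nn_integral) auto
qed

lemma tail_integral_tendsto:
  fixes q :: "nat \<Rightarrow> real \<Rightarrow> real"
  assumes [measurable]: "\<And>n. q n \<in> borel_measurable borel" "Q \<in> borel_measurable borel"
    and q: "\<And>n t. 0 \<le> q n t" "\<And>n t. q n t \<le> 1"
    and lim: "AE s in lborel. (\<lambda>n. q n (norm_u n s)) \<longlonglongrightarrow> Q s"
  shows "(\<lambda>n. real n * (\<integral>t. std_normal_density t * (indicator {norm_u n x<..} t * q n t) \<partial>lborel))
     \<longlonglongrightarrow> (\<integral>s. indicator {x<..} s * (exp (- s) * Q s) \<partial>lborel)"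
proof (rule LIMSEQ_offset[where k=2])
  \<comment> \<open>Dominated convergence wants the bound at every index, but the normalisation is
    meaningful only from 2 on; hence the shift.\<close>
  have "(\<lambda>n. \<integral>s. indicator {x<..} s * (tail_density (n + 2) s * q (n + 2) (norm_u (n + 2) s)) \<partial>lborel)
     \<longlonglongrightarrow> (\<integral>s. indicator {x<..} s * (exp (- s) * Q s) \<partial>lborel)"
  proof (rule integral_dominated_convergence[where w="\<lambda>s. indicator {x<..} s * exp (- s)"])
    show "integrable lborel (\<lambda>s. indicator {x<..} s * exp (- s))"
      using has_bochner_integral_exp_tail by (rule integrable.intros)
    show "AE s in lborel. (\<lambda>n. indicator {x<..} s * (tail_density (n + 2) s * q (n + 2) (norm_u (n + 2) s))) \<longlonglongrightarrow> indicator {x<..} s * (exp (- s) * Q s)"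
      using lim
    proof eventually_elim
      case (elim s)
      show ?case
        by (intro tendsto_mult tendsto_const LIMSEQ_ignore_initial_segment[OF tail_density_tendsto] LIMSEQ_ignore_initial_segment[OF elim])
    qed
    show "AE s in lborel. norm (indicator {x<..} s * (tail_density (n + 2) s * q (n + 2) (norm_u (n + 2) s))) \<le> indicator {x<..} s * exp (- s)" for n
    proof (intro AE_I2)
      fix s
      have "tail_density (n + 2) s * q (n + 2) (norm_u (n + 2) s) \<le> exp (- s) * 1"
        using q tail_density_le[of "n + 2" s] tail_density_nonneg by (intro mult_mono) auto
      then show "norm (indicator {x<..} s * (tail_density (n + 2) s * q (n + 2) (norm_u (n + 2) s))) \<le> indicator {x<..} s * exp (- s)"
        using q tail_density_nonneg by (simp add: abs_mult indicator_def)
    qed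
  qed measurable
  then show "(\<lambda>n. real (n + 2) * (\<integral>t. std_normal_density t * (indicator {norm_u (n + 2) x<..} t * q (n + 2) t) \<partial>lborel))
     \<longlonglongrightarrow> (\<integral>s. indicator {x<..} s * (exp (- s) * Q s) \<partial>lborel)"
    by (subst tail_integral_rescale) auto
qed

lemma std_normal_tail_tendsto:
  "(\<lambda>n. real n * measure std_normal_distribution {norm_u n x<..}) \<longlonglongrightarrow> exp (- x)"
proof -
  have "measure std_normal_distribution {a<..} = (\<integral>t. std_normal_density t * (indicator {a<..} t * 1) \<partial>lborel)" for a
  proof -
    have "measure std_normal_distribution {a<..} = (\<integral>t. indicator {a<..} t \<partial>std_normal_distribution)" by simp
    also have "\<dots> = (\<integral>t. std_normal_density t *\<^sub>R indicator {a<..} t \<partial>lborel)"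
      by (rule integral_density) auto
    finally show ?thesis by simp
  qed
  then show ?thesis
    using tail_integral_tendsto[of "\<lambda>_ _. 1" "\<lambda>_. 1" x] has_bochner_integral_integral_eq[OF has_bochner_integral_exp_tail[of x]]
    by simp
qed

section \<open>Bivariate tails and the Huesler-Reiss law\<close>

lemma std_normal_cdf_eq: "std_normal_cdf x = (\<integral>t. std_normal_density t * indicator {..x} t \<partial>lborel)"
proof -
  have "std_normal_cdf x = (\<integral>t. indicator {..x} t \<partial>std_normal_distribution)"
    by (simp add: std_normal_cdf_def cdf_def)
  also have "\<dots> = (\<integral>t. std_normal_density t *\<^sub>R indicator {..x} t \<partial>lborel)"
    by (rule integral_density) auto
  finally show ?thesis by simp
qed

lemma integrable_std_normal_indicator:
  "A \<in> sets borel \<Longrightarrow> integrable lborel (\<lambda>t. std_normal_density t * indicator A t)"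
  by (rule Bochner_Integration.integrable_bound[of lborel std_normal_density]) (auto simp: indicator_def)

lemma std_normal_cdf_lessThan: "(\<integral>t. std_normal_density t * indicator {..<x} t \<partial>lborel) = std_normal_cdf x"
  unfolding std_normal_cdf_eq
  using AE_lborel_singleton[of x] by (intro integral_cong_AE) (auto simp: indicator_def elim!: eventually_mono)

lemma std_normal_cdf_atLeast: "(\<integral>t. std_normal_density t * indicator {x..} t \<partial>lborel) = 1 - std_normal_cdf x"
proof -
  have "(\<integral>t. std_normal_density t * indicator {x..} t \<partial>lborel) + (\<integral>t. std_normal_density t * indicator {..<x} t \<partial>lborel)
     = (\<integral>t. std_normal_density t * indicator {x..} t + std_normal_density t * indicator {..<x} t \<partial>lborel)"
    by (intro Bochner_Integration.integral_add[symmetric] integrable_std_normal_indicator) auto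
  also have "\<dots> = (\<integral>t. std_normal_density t \<partial>lborel)"
    by (intro Bochner_Integration.integral_cong refl) (auto simp: indicator_def)
  finally show ?thesis by (simp add: std_normal_cdf_lessThan)
qed

lemma std_normal_cdf_minus: "std_normal_cdf (- x) = 1 - std_normal_cdf x"
proof -
  have "std_normal_cdf (- x) = \<bar>- 1\<bar> *\<^sub>R (\<integral>t. std_normal_density (0 + - 1 * t) * indicator {..- x} (0 + - 1 * t) \<partial>lborel)"
    unfolding std_normal_cdf_eq by (rule lborel_integral_real_affine) simp
  also have "\<dots> = (\<integral>t. std_normal_density t * indicator {x..} t \<partial>lborel)"
    by (simp, intro Bochner_Integration.integral_cong refl) (auto simp: indicator_def std_normal_density_def)
  finally show ?thesis by (simp add: std_normal_cdf_atLeast)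
qed

lemma std_normal_cdf_translate:
  "(\<integral>t. std_normal_density (t - m) * indicator {..<x} t \<partial>lborel) = std_normal_cdf (x - m)"
proof -
  have "(\<integral>t. std_normal_density (t - m) * indicator {..<x} t \<partial>lborel)
     = \<bar>1\<bar> *\<^sub>R (\<integral>t. std_normal_density ((m + 1 * t) - m) * indicator {..<x} (m + 1 * t) \<partial>lborel)"
    by (rule lborel_integral_real_affine) simp
  also have "\<dots> = (\<integral>t. std_normal_density t * indicator {..<x - m} t \<partial>lborel)"
    by (simp, intro Bochner_Integration.integral_cong refl) (auto simp: indicator_def)
  finally show ?thesis by (simp only: std_normal_cdf_lessThan)
qed

text \<open>The limiting probability that the second component exceeds its level when the first one
  equals \<open>u\<^sub>n(s)\<close>.\<close>

definition limit_exceedance :: "ereal \<Rightarrow> real \<Rightarrow> real \<Rightarrow> real" where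
  "limit_exceedance lam y s = (if lam = \<infinity> then 0
     else measure std_normal_distribution {w. 2 * (real_of_ereal lam)\<^sup>2 + y - s < 2 * real_of_ereal lam * w})"

lemma measurable_std_normal_section:
  assumes [measurable]: "(\<lambda>z. f (fst z) (snd z)) \<in> borel_measurable (borel \<Otimes>\<^sub>M borel)"
  shows "(\<lambda>s. measure std_normal_distribution {w. f s w > (0::real)}) \<in> borel_measurable borel"
proof -
  interpret N: prob_space std_normal_distribution by (rule prob_space_std_normal)
  have "(\<lambda>s. measure std_normal_distribution {w. f s w > 0}) = (\<lambda>s. \<integral>w. indicator {0<..} (f s w) \<partial>std_normal_distribution :: real)"
  proof
    fix s
    have "(\<lambda>w. f (fst (s, w)) (snd (s, w))) \<in> borel_measurable borel" by measurable
    then have [measurable]: "f s \<in> borel_measurable borel" by simp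
    have "(\<integral>w. indicator {0<..} (f s w) \<partial>std_normal_distribution) = (\<integral>w. indicator {w. f s w > 0} w \<partial>std_normal_distribution :: real)"
      by (intro Bochner_Integration.integral_cong refl) (auto simp: indicator_def)
    then show "measure std_normal_distribution {w. f s w > 0} = (\<integral>w. indicator {0<..} (f s w) \<partial>std_normal_distribution)"
      by simp
  qed
  moreover have "(\<lambda>s. \<integral>w. indicator {0<..} (f s w) \<partial>std_normal_distribution :: real) \<in> borel_measurable borel"
  proof (rule N.borel_measurable_lebesgue_integral)
    have "measurable (borel \<Otimes>\<^sub>M std_normal_distribution) borel = (measurable (borel \<Otimes>\<^sub>M borel) borel :: (real \<times> real \<Rightarrow> real) set)"
      by (intro measurable_cong_sets sets_pair_measure_cong) auto
    moreover have "(\<lambda>z. indicator {0<..} (f (fst z) (snd z)) :: real) \<in> borel_measurable (borel \<Otimes>\<^sub>M borel)"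
      by (rule measurable_compose[OF assms]) simp
    ultimately have "(\<lambda>z. indicator {0<..} (f (fst z) (snd z)) :: real) \<in> borel_measurable (borel \<Otimes>\<^sub>M std_normal_distribution)"
      by simp
    then show "case_prod (\<lambda>s w. indicator {0<..} (f s w) :: real) \<in> borel_measurable (borel \<Otimes>\<^sub>M std_normal_distribution)"
      by (simp add: split_beta')
  qed
  ultimately show ?thesis by simp
qed

lemma measurable_limit_exceedance [measurable]: "limit_exceedance lam y \<in> borel_measurable borel"
proof (cases "lam = \<infinity>")
  case False
  have "(\<lambda>s. measure std_normal_distribution {w. 2 * real_of_ereal lam * w - (2 * (real_of_ereal lam)\<^sup>2 + y - s) > 0}) \<in> borel_measurable borel"
    by (rule measurable_std_normal_section) measurable
  then show ?thesis using False by (simp add: limit_exceedance_def[abs_def])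
qed (simp add: limit_exceedance_def[abs_def])

text \<open>After the integrals are exchanged, the two conditions on \<open>s\<close> for fixed
  \<open>w\<close> merge into \<open>s\<close> exceeding a maximum, and the tail integral of
  \<open>exp (- s)\<close> is explicit. This covers \<open>l = 0\<close> as well.\<close>

lemma limit_exceedance_integral:
  assumes l: "0 \<le> l"
  shows "(\<integral>s. indicator {x<..} s * (exp (- s) * limit_exceedance (ereal l) y s) \<partial>lborel)
     = (\<integral>w. exp (- max x (2 * l\<^sup>2 + y - 2 * l * w)) \<partial>std_normal_distribution)"
proof -
  interpret N: prob_space std_normal_distribution by (rule prob_space_std_normal)
  interpret LN: pair_sigma_finite lborel std_normal_distribution ..
  have [measurable_cong]: "sets std_normal_distribution = sets borel" by simp
  let ?f = "\<lambda>s w. indicator {x<..} s * exp (- s) * (indicator {0<..} (2 * l * w - (2 * l\<^sup>2 + y - s)) :: real)"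
  have i0: "integrable lborel (\<lambda>s. indicator {x<..} s * exp (- s))"
    using has_bochner_integral_exp_tail by (rule integrable.intros)
  have i: "integrable (lborel \<Otimes>\<^sub>M std_normal_distribution) (\<lambda>(s, w). ?f s w)"
  proof (rule Bochner_Integration.integrable_bound)
    show "integrable (lborel \<Otimes>\<^sub>M std_normal_distribution) (\<lambda>(s, w). indicator {x<..} s * exp (- s) :: real)"
      by (rule LN.Fubini_integrable) (use integrable_norm[OF i0] N.prob_space in auto)
  qed (auto simp: indicator_def)
  have "(\<integral>s. indicator {x<..} s * (exp (- s) * limit_exceedance (ereal l) y s) \<partial>lborel) = (\<integral>s. (\<integral>w. ?f s w \<partial>std_normal_distribution) \<partial>lborel)"
  proof (intro Bochner_Integration.integral_cong refl)
    fix s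
    have "limit_exceedance (ereal l) y s = (\<integral>w. indicator {w. 2 * l\<^sup>2 + y - s < 2 * l * w} w \<partial>std_normal_distribution)"
      by (simp add: limit_exceedance_def)
    also have "\<dots> = (\<integral>w. indicator {0<..} (2 * l * w - (2 * l\<^sup>2 + y - s)) \<partial>std_normal_distribution)"
      by (intro Bochner_Integration.integral_cong refl) (auto simp: indicator_def)
    finally show "indicator {x<..} s * (exp (- s) * limit_exceedance (ereal l) y s) = (\<integral>w. ?f s w \<partial>std_normal_distribution)"
      by (simp only: integral_mult_right_zero mult.assoc)
  qed
  also have "\<dots> = (\<integral>w. (\<integral>s. ?f s w \<partial>lborel) \<partial>std_normal_distribution)"
    by (rule LN.Fubini_integral[OF i, symmetric])
  also have "\<dots> = (\<integral>w. exp (- max x (2 * l\<^sup>2 + y - 2 * l * w)) \<partial>std_normal_distribution)"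
  proof (intro Bochner_Integration.integral_cong refl)
    fix w
    have "(\<integral>s. ?f s w \<partial>lborel) = (\<integral>s. indicator {max x (2 * l\<^sup>2 + y - 2 * l * w)<..} s * exp (- s) \<partial>lborel)"
      by (intro Bochner_Integration.integral_cong refl) (auto simp: indicator_def)
    then show "(\<integral>s. ?f s w \<partial>lborel) = exp (- max x (2 * l\<^sup>2 + y - 2 * l * w))"
      using has_bochner_integral_integral_eq[OF has_bochner_integral_exp_tail] by simp
  qed
  finally show ?thesis .
qed

text \<open>The maximum switches at \<open>w0\<close>. Below it the factor
  \<open>exp (2 * l * w - 2 * l\<^sup>2)\<close> tilts the normal density into its translate by
  \<open>2 * l\<close>; above it a plain normal tail is left.\<close>

lemma std_normal_expectation_exp_max:
  assumes l: "0 < l"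
  shows "(\<integral>w. exp (- max x (2 * l\<^sup>2 + y - 2 * l * w)) \<partial>std_normal_distribution)
     = exp (- y) * (1 - std_normal_cdf (l + (x - y) / (2 * l))) + exp (- x) * (1 - std_normal_cdf (l + (y - x) / (2 * l)))"
proof -
  define w0 where "w0 = l + (y - x) / (2 * l)"
  have "(\<integral>w. exp (- max x (2 * l\<^sup>2 + y - 2 * l * w)) \<partial>std_normal_distribution)
      = (\<integral>w. std_normal_density w *\<^sub>R exp (- max x (2 * l\<^sup>2 + y - 2 * l * w)) \<partial>lborel)"
    by (rule integral_density) auto
  also have "\<dots> = (\<integral>w. exp (- y) * (std_normal_density (w - 2 * l) * indicator {..<w0} w) + exp (- x) * (std_normal_density w * indicator {w0..} w) \<partial>lborel)"
  proof (intro Bochner_Integration.integral_cong refl)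
    fix w
    have w0: "w < w0 \<longleftrightarrow> x < 2 * l\<^sup>2 + y - 2 * l * w"
      using l by (simp add: w0_def field_simps power2_eq_square)
    have "std_normal_density w * exp (- (2 * l\<^sup>2 + y - 2 * l * w)) = exp (- y) * std_normal_density (w - 2 * l)"
    proof -
      have "- w\<^sup>2 / 2 + - (2 * l\<^sup>2 + y - 2 * l * w) = - y + - (w - 2 * l)\<^sup>2 / 2"
        by (simp add: power2_eq_square algebra_simps)
      then have "exp (- w\<^sup>2 / 2) * exp (- (2 * l\<^sup>2 + y - 2 * l * w)) = exp (- y) * exp (- (w - 2 * l)\<^sup>2 / 2)"
        by (simp only: mult_exp_exp)
      then show ?thesis unfolding std_normal_density_def by (simp only: mult.assoc mult.left_commute)
    qed
    then show "std_normal_density w *\<^sub>R exp (- max x (2 * l\<^sup>2 + y - 2 * l * w))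
       = exp (- y) * (std_normal_density (w - 2 * l) * indicator {..<w0} w) + exp (- x) * (std_normal_density w * indicator {w0..} w)"
      using w0 by (cases "w < w0") (simp_all add: max_def)
  qed
  also have "\<dots> = (\<integral>w. exp (- y) * (std_normal_density (w - 2 * l) * indicator {..<w0} w) \<partial>lborel) + (\<integral>w. exp (- x) * (std_normal_density w * indicator {w0..} w) \<partial>lborel)"
  proof (rule Bochner_Integration.integral_add)
    have "integrable lborel (\<lambda>w. std_normal_density (w - 2 * l))"
      using lborel_integrable_real_affine[of std_normal_density 1 "- 2 * l"] by (simp add: add.commute)
    then have "integrable lborel (\<lambda>w. std_normal_density (w - 2 * l) * indicator {..<w0} w)"
      by (rule Bochner_Integration.integrable_bound) (auto simp: indicator_def)
    then show "integrable lborel (\<lambda>w. exp (- y) * (std_normal_density (w - 2 * l) * indicator {..<w0} w))"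
      by (rule integrable_mult_right)
    show "integrable lborel (\<lambda>w. exp (- x) * (std_normal_density w * indicator {w0..} w))"
      by (intro integrable_mult_right integrable_std_normal_indicator) auto
  qed
  also have "\<dots> = exp (- y) * std_normal_cdf (w0 - 2 * l) + exp (- x) * (1 - std_normal_cdf w0)"
    by (simp only: integral_mult_right_zero std_normal_cdf_translate std_normal_cdf_atLeast)
  also have "w0 - 2 * l = - (l + (x - y) / (2 * l))"
    by (simp add: w0_def diff_divide_distrib)
  finally show ?thesis by (simp only: std_normal_cdf_minus w0_def)
qed

text \<open>Inclusion-exclusion in the limit: two marginal exceedance rates minus the joint one. For
  finite positive \<open>lam\<close> subtracting the \<open>1 - std_normal_cdf\<close> terms leaves
  the terms of the definition; the joint rate is \<open>exp (- max x y)\<close> for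
  \<open>lam = 0\<close> and 0 for \<open>lam = \<infinity>\<close>.\<close>

lemma huesler_reiss_exponent:
  assumes "0 \<le> lam"
  shows "exp (- (exp (- x) + exp (- y) - (\<integral>s. indicator {x<..} s * (exp (- s) * limit_exceedance lam y s) \<partial>lborel)))
     = huesler_reiss lam x y"
proof (cases lam)
  case (real l)
  with assms have l: "0 \<le> l" by simp
  show ?thesis
  proof (cases "l = 0")
    case True
    interpret N: prob_space std_normal_distribution by (rule prob_space_std_normal)
    have "N.prob UNIV = 1" using N.prob_space by simp
    moreover have "exp (- (exp (- x) + exp (- y) - exp (- max x y))) = min (gumbel_cdf x) (gumbel_cdf y)"
      by (auto simp: gumbel_cdf_def max_def min_def)
    ultimately show ?thesis using real True limit_exceedance_integral[OF l, of x y]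
      by (simp add: huesler_reiss_def)
  next
    case False
    with l have "0 < l" by simp
    from limit_exceedance_integral[OF l, of x y] std_normal_expectation_exp_max[OF this, of x y] False real show ?thesis
      by (simp add: huesler_reiss_def Let_def algebra_simps)
  qed
next
  case PInf
  then show ?thesis
    by (simp add: limit_exceedance_def huesler_reiss_def gumbel_cdf_def exp_add[symmetric])
qed (use assms in simp)

text \<open>The excess of the second component over its level, multiplied by \<open>sqrt (2 ln n)\<close>; in terms of
  \<open>v = (1 - r) ln n\<close> its limit can be read off. Being free of quotients by \<open>sqrt (1 - r\<^sup>2)\<close>, it also covers
  \<open>r = 1\<close> and \<open>r = - 1\<close>.\<close>

definition scaled_excess :: "nat \<Rightarrow> real \<Rightarrow> real \<Rightarrow> real \<Rightarrow> real \<Rightarrow> real" where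
  "scaled_excess n r y s w = (let L = ln (real n); v = (1 - r) * L in
     sqrt (2 * v * (1 + r)) * w + r * s - y - 2 * v + v * (ln (4 * pi * L) / (2 * L)))"

text \<open>Multiplication by \<open>m = sqrt (2 * L)\<close> makes the levels affine,
  \<open>m * norm_u n t = 2 * L + t - h\<close>. The large terms then combine to
  \<open>- (1 - r) * (2 * L - h)\<close>, which is \<open>- 2 * v\<close> plus the logarithmic
  correction.\<close>

lemma exceedance_iff_scaled_excess:
  assumes n: "n \<ge> 2" and r: "\<bar>r\<bar> \<le> 1"
  shows "norm_u n y < r * norm_u n s + sqrt (1 - r\<^sup>2) * w \<longleftrightarrow> 0 < scaled_excess n r y s w"
proof -
  define L where "L = ln (real n)"
  define h where "h = ln (4 * pi * L) / 2"
  define m where "m = sqrt (2 * L)"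
  have L: "L > 0" using n by (simp add: L_def)
  have m: "m > 0" "m * m = 2 * L" using L by (simp_all add: m_def)
  have u: "m * norm_u n t = 2 * L + t - h" for t
  proof -
    have "m * norm_u n t = m * m + m * ((t - h) / m)"
      unfolding norm_u_eq m_def L_def h_def by (simp only: distrib_left)
    then show ?thesis using m by simp
  qed
  have "m * sqrt (1 - r\<^sup>2) = sqrt (2 * ((1 - r) * L) * (1 + r))"
    unfolding m_def by (subst real_sqrt_mult[symmetric]) (simp add: power2_eq_square algebra_simps)
  then have "m * (r * norm_u n s + sqrt (1 - r\<^sup>2) * w) - m * norm_u n y
     = sqrt (2 * ((1 - r) * L) * (1 + r)) * w + r * (2 * L + s - h) - (2 * L + y - h)"
    unfolding u[symmetric] by (simp add: algebra_simps)
  also have "\<dots> = scaled_excess n r y s w"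
  proof -
    have "(1 - r) * L * (ln (4 * pi * L) / (2 * L)) = (1 - r) * h" using L by (simp add: h_def)
    then show ?thesis unfolding scaled_excess_def Let_def L_def[symmetric] by (simp add: algebra_simps)
  qed
  finally have "scaled_excess n r y s w = m * (r * norm_u n s + sqrt (1 - r\<^sup>2) * w - norm_u n y)"
    by (simp add: right_diff_distrib)
  then show ?thesis using m by (simp add: zero_less_mult_iff)
qed

text \<open>A finite limit of \<open>(1 - r n) * ln n\<close> forces \<open>r n\<close> to 1, so the
  coefficient of \<open>w\<close> tends to \<open>2 * l\<close>; the logarithmic correction is a
  convergent factor times a null sequence.\<close>

lemma scaled_excess_tendsto:
  assumes v: "(\<lambda>n. (1 - r n) * ln (real n)) \<longlonglongrightarrow> l\<^sup>2" and l: "0 \<le> l"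
  shows "(\<lambda>n. scaled_excess n (r n) y s w) \<longlonglongrightarrow> 2 * l * w - (2 * l\<^sup>2 + y - s)"
proof -
  have "(\<lambda>n. (1 - r n) * ln (real n) * (1 / ln (real n))) \<longlonglongrightarrow> l\<^sup>2 * 0"
    by (intro tendsto_mult v) real_asymp
  moreover have "eventually (\<lambda>n. (1 - r n) * ln (real n) * (1 / ln (real n)) = 1 - r n) sequentially"
    using eventually_ge_at_top[of 2] by eventually_elim auto
  ultimately have "(\<lambda>n. 1 - r n) \<longlonglongrightarrow> 0"
    by (subst (asm) tendsto_cong) auto
  then have "(\<lambda>n. 1 - (1 - r n)) \<longlonglongrightarrow> 1 - 0" by (intro tendsto_intros)
  then have r: "r \<longlonglongrightarrow> 1" by simp
  have "(\<lambda>n::nat. ln (4 * pi * ln (real n)) / (2 * ln (real n))) \<longlonglongrightarrow> 0"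
    by real_asymp
  with r v have "(\<lambda>n. sqrt (2 * ((1 - r n) * ln (real n)) * (1 + r n)) * w + r n * s - y - 2 * ((1 - r n) * ln (real n)) + ((1 - r n) * ln (real n)) * (ln (4 * pi * ln (real n)) / (2 * ln (real n))))
     \<longlonglongrightarrow> sqrt (2 * l\<^sup>2 * (1 + 1)) * w + 1 * s - y - 2 * l\<^sup>2 + l\<^sup>2 * 0"
    by (intro tendsto_intros)
  also have "sqrt (2 * l\<^sup>2 * (1 + 1)) = 2 * l"
    using l by (simp add: real_sqrt_mult)
  finally show ?thesis by (simp add: scaled_excess_def Let_def algebra_simps)
qed

text \<open>The term \<open>- 2 * v\<close> wins: the logarithmic correction returns at most
  \<open>v\<close>, the noise is of order \<open>sqrt v\<close>, and the rest is at most
  \<open>C\<close>.\<close>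

lemma scaled_excess_eventually_neg:
  assumes v: "filterlim (\<lambda>n. (1 - r n) * ln (real n)) at_top sequentially" and r: "eventually (\<lambda>n. \<bar>r n\<bar> \<le> 1) sequentially"
  shows "eventually (\<lambda>n. scaled_excess n (r n) y s w < 0) sequentially"
proof -
  define C where "C = \<bar>y\<bar> + \<bar>s\<bar>"
  \<comment> \<open>Chosen so that \<open>v \<ge> B\<close> gives both \<open>sqrt v \<ge> 1\<close>
    and \<open>sqrt v \<ge> 2 * \<bar>w\<bar> + C + 1\<close>.\<close>
  define B where "B = max 1 ((2 * \<bar>w\<bar> + C + 1)\<^sup>2)"
  have "(\<lambda>n::nat. ln (4 * pi * ln (real n)) / (2 * ln (real n))) \<longlonglongrightarrow> 0"
    by real_asymp
  then have h: "eventually (\<lambda>n::nat. ln (4 * pi * ln (real n)) / (2 * ln (real n)) < 1) sequentially"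
    by (rule order_tendstoD) simp
  have "eventually (\<lambda>n. B \<le> (1 - r n) * ln (real n)) sequentially"
    using v by (simp add: filterlim_at_top)
  with r h show ?thesis
  proof eventually_elim
    case (elim n)
    define v where "v = (1 - r n) * ln (real n)"
    have v: "B \<le> v" using elim by (simp add: v_def)
    then have v1: "1 \<le> v" "(2 * \<bar>w\<bar> + C + 1)\<^sup>2 \<le> v" by (simp_all add: B_def)
    have s1: "1 \<le> sqrt v" using v1 by simp
    have s2: "2 * \<bar>w\<bar> + C + 1 \<le> sqrt v" using v1 by (simp add: real_le_rsqrt)
    have C: "0 \<le> C" by (simp add: C_def)
    have "sqrt (2 * v * (1 + r n)) \<le> sqrt (2\<^sup>2 * v)" using elim v1 by (simp add: mult_right_mono)
    also have "\<dots> = 2 * sqrt v" by (simp add: real_sqrt_mult)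
    finally have c: "sqrt (2 * v * (1 + r n)) \<le> 2 * sqrt v" .
    have "sqrt (2 * v * (1 + r n)) * w \<le> sqrt (2 * v * (1 + r n)) * \<bar>w\<bar>" using elim v1 by (intro mult_left_mono) auto
    also have "\<dots> \<le> 2 * sqrt v * \<bar>w\<bar>" using c by (intro mult_right_mono) auto
    finally have 1: "sqrt (2 * v * (1 + r n)) * w \<le> 2 * sqrt v * \<bar>w\<bar>" .
    have "\<bar>r n * s\<bar> \<le> 1 * \<bar>s\<bar>" unfolding abs_mult using elim by (intro mult_right_mono) auto
    then have 2: "r n * s - y \<le> C" by (simp add: C_def)
    have 3: "v * (ln (4 * pi * ln (real n)) / (2 * ln (real n))) \<le> v * 1"
      using elim v1 by (intro mult_left_mono) auto
    have "C + 1 \<le> sqrt v * (C + 1)" using mult_right_mono[OF s1, of "C + 1"] C by simp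
    moreover have "sqrt v * (2 * \<bar>w\<bar> + C + 1) \<le> sqrt v * sqrt v" using s2 s1 by (intro mult_left_mono) auto
    moreover have "sqrt v * sqrt v = v" using v1 by simp
    ultimately have "2 * sqrt v * \<bar>w\<bar> + C + 1 \<le> v" by (simp add: algebra_simps)
    with 1 2 3 show ?case unfolding scaled_excess_def Let_def v_def[symmetric] by linarith
  qed
qed

text \<open>The conditional probability that the second component exceeds its level when the first
  equals \<open>t\<close>, in the Cholesky representation.\<close>

definition exceedance :: "nat \<Rightarrow> real \<Rightarrow> real \<Rightarrow> real \<Rightarrow> real" where
  "exceedance n r y t = measure std_normal_distribution {w. norm_u n y < r * t + sqrt (1 - r\<^sup>2) * w}"

lemma measurable_exceedance [measurable]: "exceedance n r y \<in> borel_measurable borel"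
proof -
  have "(\<lambda>t. measure std_normal_distribution {w. r * t + sqrt (1 - r\<^sup>2) * w - norm_u n y > 0}) \<in> borel_measurable borel"
    by (rule measurable_std_normal_section) measurable
  then show ?thesis by (simp add: exceedance_def[abs_def])
qed

lemma AE_std_normal_neq: "AE w in std_normal_distribution. w \<noteq> c"
proof -
  interpret N: prob_space std_normal_distribution by (rule prob_space_std_normal)
  show ?thesis using std_normal_distribution_singleton[of c] N.prob_eq_0[of "{c}"] by simp
qed

text \<open>The sign of the excess converges for almost every \<open>w\<close>, and dominated
  convergence follows. It can fail only where the limiting excess is 0: at one value of
  \<open>w\<close> if \<open>l > 0\<close>, and at \<open>s = y\<close> if \<open>l = 0\<close>.
  Both sets are null.\<close>

lemma exceedance_tendsto:
  assumes lam: "0 \<le> lam" "(\<lambda>n. ereal ((1 - r n) * ln (real n))) \<longlonglongrightarrow> lam\<^sup>2"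
    and r: "eventually (\<lambda>n. \<bar>r n\<bar> \<le> 1) sequentially"
  shows "AE s in lborel. (\<lambda>n. exceedance n (r n) y (norm_u n s)) \<longlonglongrightarrow> limit_exceedance lam y s"
proof -
  interpret N: prob_space std_normal_distribution by (rule prob_space_std_normal)
  have ev: "eventually (\<lambda>n. n \<ge> 2 \<and> \<bar>r n\<bar> \<le> 1) sequentially"
    using r eventually_ge_at_top[of 2] by eventually_elim simp
  have ex: "exceedance n (r n) y (norm_u n s) = (\<integral>w. indicator {w. norm_u n y < r n * norm_u n s + sqrt (1 - (r n)\<^sup>2) * w} w \<partial>std_normal_distribution)" for n s
    by (simp add: exceedance_def)
  have lim: "(\<lambda>n. exceedance n (r n) y (norm_u n s)) \<longlonglongrightarrow> measure std_normal_distribution A"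
    if [measurable]: "A \<in> sets borel" and A: "AE w in std_normal_distribution. eventually (\<lambda>n. 0 < scaled_excess n (r n) y s w \<longleftrightarrow> w \<in> A) sequentially" for A s
  proof -
    have "(\<lambda>n. exceedance n (r n) y (norm_u n s)) \<longlonglongrightarrow> (\<integral>w. indicator A w \<partial>std_normal_distribution)"
      unfolding ex
    proof (rule integral_dominated_convergence[where w="\<lambda>_. 1"])
      show "AE w in std_normal_distribution. (\<lambda>n. indicator {w. norm_u n y < r n * norm_u n s + sqrt (1 - (r n)\<^sup>2) * w} w) \<longlonglongrightarrow> (indicator A w :: real)"
        using A
      proof eventually_elim
        case (elim w)
        then have "eventually (\<lambda>n. indicator {w. norm_u n y < r n * norm_u n s + sqrt (1 - (r n)\<^sup>2) * w} w = (indicator A w :: real)) sequentially"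
          using ev by eventually_elim (simp add: indicator_def exceedance_iff_scaled_excess)
        then show ?case by (rule tendsto_eventually)
      qed
    qed (auto simp: indicator_def)
    then show ?thesis by simp
  qed
  show ?thesis
  proof (cases lam)
    case (real l)
    with lam have l: "0 \<le> l" and v: "(\<lambda>n. (1 - r n) * ln (real n)) \<longlonglongrightarrow> l\<^sup>2"
      by (auto simp: power2_eq_square)
    have sgn: "eventually (\<lambda>n. 0 < scaled_excess n (r n) y s w \<longleftrightarrow> w \<in> {w. 2 * l\<^sup>2 + y - s < 2 * l * w}) sequentially"
      if "2 * l * w - (2 * l\<^sup>2 + y - s) \<noteq> 0" for s w
    proof (cases "2 * l * w - (2 * l\<^sup>2 + y - s) > 0")
      case True
      from order_tendstoD(1)[OF scaled_excess_tendsto[OF v l] this] show ?thesis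
        by eventually_elim (use True in auto)
    next
      case False
      with that have "2 * l * w - (2 * l\<^sup>2 + y - s) < 0" by simp
      from order_tendstoD(2)[OF scaled_excess_tendsto[OF v l] this] show ?thesis
        by eventually_elim (use False in auto)
    qed
    have "(\<lambda>n. exceedance n (r n) y (norm_u n s)) \<longlonglongrightarrow> limit_exceedance lam y s" if s: "s \<noteq> y" for s
    proof -
      have "AE w in std_normal_distribution. 2 * l * w - (2 * l\<^sup>2 + y - s) \<noteq> 0"
      proof (cases "l = 0")
        case False
        show ?thesis using AE_std_normal_neq[of "(2 * l\<^sup>2 + y - s) / (2 * l)"]
          by eventually_elim (use False in \<open>auto simp: field_simps\<close>)
      qed (use s in auto)
      then have "AE w in std_normal_distribution. eventually (\<lambda>n. 0 < scaled_excess n (r n) y s w \<longleftrightarrow> w \<in> {w. 2 * l\<^sup>2 + y - s < 2 * l * w}) sequentially"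
        by eventually_elim (rule sgn)
      from lim[OF _ this] show ?thesis using real by (simp add: limit_exceedance_def)
    qed
    then show ?thesis using AE_lborel_singleton[of y] by (auto elim!: eventually_mono)
  next
    case PInf
    then have "lam\<^sup>2 = \<infinity>" by (simp add: power2_eq_square)
    with lam have v: "filterlim (\<lambda>n. (1 - r n) * ln (real n)) at_top sequentially"
      by (simp add: tendsto_PInfty_eq_at_top)
    have "eventually (\<lambda>n. 0 < scaled_excess n (r n) y s w \<longleftrightarrow> w \<in> {}) sequentially" for s w
      by (rule eventually_mono[OF scaled_excess_eventually_neg[OF v r, of y s w]]) auto
    then have "(\<lambda>n. exceedance n (r n) y (norm_u n s)) \<longlonglongrightarrow> measure std_normal_distribution {}" for s
      by (intro lim) auto
    then show ?thesis using PInf by (simp add: limit_exceedance_def)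
  qed (use lam in simp)
qed

section \<open>Independent pairs\<close>

definition pair_prob :: "nat \<Rightarrow> real \<Rightarrow> real \<Rightarrow> real \<Rightarrow> real" where
  "pair_prob n r x y = measure std_normal_plane {z \<in> space std_normal_plane.
      fst z \<le> norm_u n x \<and> r * fst z + sqrt (1 - r\<^sup>2) * snd z \<le> norm_u n y}"

lemma pair_prob_bounds: "0 \<le> pair_prob n r x y" "pair_prob n r x y \<le> 1"
proof -
  interpret N: prob_space std_normal_distribution by (rule prob_space_std_normal)
  interpret P: pair_prob_space std_normal_distribution std_normal_distribution ..
  show "0 \<le> pair_prob n r x y" "pair_prob n r x y \<le> 1" by (simp_all add: pair_prob_def)
qed

text \<open>Inclusion-exclusion for the two exceedance events: both margins are standard normal, and
  the joint event is integrated over its first coordinate.\<close>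

lemma one_minus_pair_prob:
  assumes r: "\<bar>r\<bar> \<le> 1"
  shows "1 - pair_prob n r x y = measure std_normal_distribution {norm_u n x<..} + measure std_normal_distribution {norm_u n y<..}
     - (\<integral>t. std_normal_density t * (indicator {norm_u n x<..} t * exceedance n r y t) \<partial>lborel)"
proof -
  interpret N: prob_space std_normal_distribution by (rule prob_space_std_normal)
  interpret P: pair_prob_space std_normal_distribution std_normal_distribution ..
  have [measurable_cong]: "sets std_normal_distribution = sets borel" by simp
  let ?Y = "\<lambda>z. r * fst z + sqrt (1 - r\<^sup>2) * snd z"
  let ?A = "{z \<in> space std_normal_plane. norm_u n x < fst z}"
  let ?B = "{z \<in> space std_normal_plane. norm_u n y < ?Y z}"
  note G = gaussian_cf_std_normal_plane[OF r]
  have dist: "distr std_normal_plane borel fst = std_normal_distribution" "distr std_normal_plane borel ?Y = std_normal_distribution"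
    using gaussian_cf_std_normal[OF G, of 1] gaussian_cf_std_normal[OF G, of 2] by simp_all
  have A: "measure std_normal_plane ?A = measure std_normal_distribution {norm_u n x<..}"
    by (subst dist(1)[symmetric], subst measure_distr) (auto intro!: arg_cong[where f="measure std_normal_plane"])
  have B: "measure std_normal_plane ?B = measure std_normal_distribution {norm_u n y<..}"
    by (subst dist(2)[symmetric], subst measure_distr) (auto intro!: arg_cong[where f="measure std_normal_plane"])
  have "measure std_normal_plane (?A \<inter> ?B) = measure std_normal_plane ((?A \<inter> ?B) \<inter> space std_normal_plane)"
    by (rule arg_cong[where f="measure std_normal_plane"]) blast
  also have "\<dots> = (\<integral>z. indicator (?A \<inter> ?B) z \<partial>std_normal_plane)"
    by simp
  also have "\<dots> = (\<integral>t. (\<integral>w. indicator (?A \<inter> ?B) (t, w) \<partial>std_normal_distribution) \<partial>std_normal_distribution)"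
    by (rule P.integral_fst'[symmetric]) (auto intro!: P.integrable_const_bound[where B=1] simp: indicator_def)
  also have "\<dots> = (\<integral>t. indicator {norm_u n x<..} t * exceedance n r y t \<partial>std_normal_distribution)"
  proof (intro Bochner_Integration.integral_cong refl)
    fix t
    have "(\<integral>w. indicator (?A \<inter> ?B) (t, w) \<partial>std_normal_distribution)
       = (\<integral>w. indicator {norm_u n x<..} t * indicator {w. norm_u n y < r * t + sqrt (1 - r\<^sup>2) * w} w \<partial>std_normal_distribution :: real)"
      by (intro Bochner_Integration.integral_cong refl) (auto simp: indicator_def space_pair_measure)
    then show "(\<integral>w. indicator (?A \<inter> ?B) (t, w) \<partial>std_normal_distribution) = indicator {norm_u n x<..} t * exceedance n r y t"
      by (simp add: exceedance_def)
  qed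
  also have "\<dots> = (\<integral>t. std_normal_density t *\<^sub>R (indicator {norm_u n x<..} t * exceedance n r y t) \<partial>lborel)"
    by (rule integral_density) auto
  finally have AB: "measure std_normal_plane (?A \<inter> ?B) = (\<integral>t. std_normal_density t * (indicator {norm_u n x<..} t * exceedance n r y t) \<partial>lborel)"
    by simp
  have "{z \<in> space std_normal_plane. fst z \<le> norm_u n x \<and> ?Y z \<le> norm_u n y} = space std_normal_plane - (?A \<union> ?B)"
    by auto
  then have "pair_prob n r x y = 1 - measure std_normal_plane (?A \<union> ?B)"
    unfolding pair_prob_def by (simp only:, intro P.prob_compl) measurable
  also have "measure std_normal_plane (?A \<union> ?B) = measure std_normal_plane ?A + measure std_normal_plane ?B - measure std_normal_plane (?A \<inter> ?B)"
  proof -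
    have "?A \<in> sets std_normal_plane" "?B \<in> sets std_normal_plane" by measurable
    then show ?thesis by (intro measure_Un3) (simp_all only: P.fmeasurable_eq_sets)
  qed
  finally show ?thesis unfolding A B AB by simp
qed

text \<open>Comparison with \<open>(1 - v / n) ^ n\<close>: the difference of two
  \<open>n\<close>-th powers of numbers of modulus at most 1 is at most \<open>n\<close> times the
  difference of the numbers.\<close>

lemma power_tendsto_exp_minus:
  fixes p :: "nat \<Rightarrow> real"
  assumes p: "\<And>n. 0 \<le> p n" "\<And>n. p n \<le> 1" and lim: "(\<lambda>n. real n * (1 - p n)) \<longlonglongrightarrow> v"
  shows "(\<lambda>n. p n ^ n) \<longlonglongrightarrow> exp (- v)"
proof -
  have "0 \<le> v" using p by (intro LIMSEQ_le_const[OF lim]) auto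
  have "(\<lambda>n. p n ^ n - (1 + (- v) / real n) ^ n) \<longlonglongrightarrow> 0"
  proof (rule tendsto_0_le)
    show "(\<lambda>n. real n * (1 - p n) - v) \<longlonglongrightarrow> 0" using tendsto_diff[OF lim tendsto_const, of v] by simp
    \<comment> \<open>From \<open>m\<close> on, \<open>1 - v / n\<close> lies in the unit
      interval.\<close>
    obtain m :: nat where m: "v \<le> real m" using real_arch_simple by blast
    show "\<forall>\<^sub>F n in sequentially. norm (p n ^ n - (1 + (- v) / real n) ^ n) \<le> norm (real n * (1 - p n) - v) * 1"
      using eventually_ge_at_top[of "max m 1"]
    proof eventually_elim
      case (elim n)
      then have n: "v \<le> real n" "0 < real n" using m by linarith+
      then have b: "norm (1 + (- v) / real n) \<le> 1" using \<open>0 \<le> v\<close> by (auto simp: abs_le_iff field_simps)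
      have "norm (p n ^ n - (1 + (- v) / real n) ^ n) \<le> real n * norm (p n - (1 + (- v) / real n))"
        by (rule norm_power_diff) (use p b in auto)
      also have "\<dots> = norm (real n * (p n - (1 + (- v) / real n)))" by (simp add: abs_mult)
      also have "real n * (p n - (1 + (- v) / real n)) = - (real n * (1 - p n) - v)"
        using n by (simp add: field_simps)
      finally show ?case by simp
    qed
  qed
  from tendsto_add[OF this tendsto_exp_limit_sequentially[of "- v"]] show ?thesis by simp
qed

text \<open>The classical Huesler-Reiss theorem for independent pairs; it supplies the limit once
  the dependent row has been compared with such pairs.\<close>

theorem pair_prob_power_tendsto:
  assumes lam: "0 \<le> lam" "(\<lambda>n. ereal ((1 - r n) * ln (real n))) \<longlonglongrightarrow> lam\<^sup>2"
    and r: "eventually (\<lambda>n. \<bar>r n\<bar> \<le> 1) sequentially"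
  shows "(\<lambda>n. pair_prob n (r n) x y ^ n) \<longlonglongrightarrow> huesler_reiss lam x y"
proof -
  interpret N: prob_space std_normal_distribution by (rule prob_space_std_normal)
  let ?J = "\<lambda>n. \<integral>t. std_normal_density t * (indicator {norm_u n x<..} t * exceedance n (r n) y t) \<partial>lborel"
  have J: "(\<lambda>n. real n * ?J n) \<longlonglongrightarrow> (\<integral>s. indicator {x<..} s * (exp (- s) * limit_exceedance lam y s) \<partial>lborel)"
    by (rule tail_integral_tendsto[OF _ _ _ _ exceedance_tendsto[OF lam r]]) (auto simp: exceedance_def[of _ _ _ "_ :: real"])
  have "(\<lambda>n. real n * measure std_normal_distribution {norm_u n x<..} + real n * measure std_normal_distribution {norm_u n y<..} - real n * ?J n)
    \<longlonglongrightarrow> exp (- x) + exp (- y) - (\<integral>s. indicator {x<..} s * (exp (- s) * limit_exceedance lam y s) \<partial>lborel)"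
    by (intro tendsto_intros std_normal_tail_tendsto J)
  moreover have "eventually (\<lambda>n. real n * measure std_normal_distribution {norm_u n x<..} + real n * measure std_normal_distribution {norm_u n y<..} - real n * ?J n
     = real n * (1 - pair_prob n (r n) x y)) sequentially"
    using r by eventually_elim (simp add: one_minus_pair_prob algebra_simps)
  ultimately have "(\<lambda>n. real n * (1 - pair_prob n (r n) x y))
    \<longlonglongrightarrow> exp (- x) + exp (- y) - (\<integral>s. indicator {x<..} s * (exp (- s) * limit_exceedance lam y s) \<partial>lborel)"
    by (rule Lim_transform_eventually)
  from power_tendsto_exp_minus[OF pair_prob_bounds this] show ?thesis
    by (simp only: huesler_reiss_exponent[OF lam(1)])
qed

section \<open>Uniform convergence\<close>

lemma gumbel_cdf_bounds: "0 < gumbel_cdf x" "gumbel_cdf x < 1"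
  by (simp_all add: gumbel_cdf_def)

lemma gumbel_cdf_le_iff: "gumbel_cdf x \<le> gumbel_cdf y \<longleftrightarrow> x \<le> y"
  by (simp add: gumbel_cdf_def)

lemma gumbel_cdf_quantile:
  assumes "0 < p" "p < 1"
  shows "gumbel_cdf (- ln (- ln p)) = p"
  using assms by (simp add: gumbel_cdf_def)

text \<open>Bivariate analogue of Polya's theorem, on a grid of Gumbel quantiles; the clipping inequality
  \<open>P(A) \<le> P(A \<inter> B) + 1 - P(B)\<close> handles the corner at infinity.\<close>

lemma bivariate_uniform_convergence:
  fixes F :: "nat \<Rightarrow> real \<Rightarrow> real \<Rightarrow> real" and H :: "real \<Rightarrow> real \<Rightarrow> real"
  assumes lim: "\<And>x y. (\<lambda>n. F n x y) \<longlonglongrightarrow> H x y"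
    and F0: "\<And>n x y. n \<ge> 1 \<Longrightarrow> 0 \<le> F n x y"
    and F_mono: "\<And>n x y x' y'. n \<ge> 1 \<Longrightarrow> x \<le> x' \<Longrightarrow> y \<le> y' \<Longrightarrow> F n x y \<le> F n x' y'"
    and F_clip: "\<And>n x y x' y'. n \<ge> 1 \<Longrightarrow> F n x y \<le> F n (min x x') (min y y') + (1 - F n x' y')"
    and H_le: "\<And>x y. H x y \<le> gumbel_cdf x" "\<And>x y. H x y \<le> gumbel_cdf y"
    and H_ge: "\<And>x y. gumbel_cdf x * gumbel_cdf y \<le> H x y"
    and H_mono: "\<And>x y x' y'. x \<le> x' \<Longrightarrow> y \<le> y' \<Longrightarrow> H x y \<le> H x' y'"
    and H_lip: "\<And>x y x' y'. x \<le> x' \<Longrightarrow> y \<le> y' \<Longrightarrow>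
       H x' y' - H x y \<le> (gumbel_cdf x' - gumbel_cdf x) + (gumbel_cdf y' - gumbel_cdf y)"
  shows "(\<lambda>n. SUP (x, y)\<in>UNIV. \<bar>F n x y - H x y\<bar>) \<longlonglongrightarrow> 0"
proof (rule LIMSEQ_I)
  fix e :: real assume e: "0 < e"
  \<comment> \<open>Yields \<open>4 / K \<le> e / 2\<close>; with \<open>h = e / 8\<close> the final
    bound \<open>2 * h + 4 / K\<close> is at most \<open>3 / 4 * e\<close>. The added 2 keeps the
    grid \<open>{1..K - 1}\<close> nonempty.\<close>
  define K where "K = nat \<lceil>8 / e\<rceil> + 2"
  have K: "K \<ge> 2" "4 / real K \<le> e / 2"
  proof -
    have "8 / e \<le> real K" unfolding K_def by linarith
    then have "8 \<le> real K * e" using e by (simp add: field_simps)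
    then show "4 / real K \<le> e / 2" unfolding K_def by (simp add: field_simps)
  qed (simp add: K_def)
  define g where "g = (\<lambda>j::nat. - ln (- ln (real j / real K)))"
  have g: "gumbel_cdf (g j) = real j / real K" if "1 \<le> j" "j \<le> K - 1" for j
    unfolding g_def using that K by (intro gumbel_cdf_quantile) (auto simp: field_simps)
  define G where "G = g ` {1..K - 1}"
  define T where "T = g (K - 1)"
  have T: "T \<in> G" "gumbel_cdf T = 1 - 1 / real K"
    using g[of "K - 1"] K by (auto simp: G_def T_def of_nat_diff field_simps)
  \<comment> \<open>Rounding \<open>K * gumbel_cdf x\<close> down or up gives grid neighbours within
    Gumbel distance \<open>1 / K\<close>. Below the first quantile there is no lower neighbour, but
    \<open>H\<close> is small there; beyond \<open>T\<close> there is no upper one, so the argument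
    is clipped to \<open>min x T\<close>.\<close>
  have lower: "gumbel_cdf x \<le> 1 / real K \<or> (\<exists>a\<in>G. a \<le> x \<and> gumbel_cdf x - gumbel_cdf a \<le> 1 / real K)"
    and upper: "\<exists>b\<in>G. min x T \<le> b \<and> gumbel_cdf (max x b) - gumbel_cdf x \<le> 1 / real K" for x
  proof -
    define j where "j = nat \<lfloor>real K * gumbel_cdf x\<rfloor>"
    have j1: "real j \<le> real K * gumbel_cdf x" "real K * gumbel_cdf x < real j + 1"
      using gumbel_cdf_bounds[of x] unfolding j_def by (auto simp: of_nat_nat)
    have "real K * gumbel_cdf x < real K" using gumbel_cdf_bounds[of x] K by simp
    then have j2: "j \<le> K - 1" using j1 by linarith
    have j3: "real j / real K \<le> gumbel_cdf x" "gumbel_cdf x \<le> real j / real K + 1 / real K"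
      using j1 K by (simp_all add: field_simps)
    show "gumbel_cdf x \<le> 1 / real K \<or> (\<exists>a\<in>G. a \<le> x \<and> gumbel_cdf x - gumbel_cdf a \<le> 1 / real K)"
    proof (cases "j = 0")
      case False
      then have "g j \<in> G" using j2 by (auto simp: G_def)
      moreover have "g j \<le> x" using g[of j] j3 j2 False gumbel_cdf_le_iff[of "g j" x] by simp
      moreover have "gumbel_cdf x - gumbel_cdf (g j) \<le> 1 / real K" using g[of j] j3 j2 False by simp
      ultimately show ?thesis by blast
    qed (use j3 in simp)
    show "\<exists>b\<in>G. min x T \<le> b \<and> gumbel_cdf (max x b) - gumbel_cdf x \<le> 1 / real K"
    proof (cases "j = K - 1")
      case True
      then have "T \<le> x" using g[of j] j3 K gumbel_cdf_le_iff[of T x] by (simp add: T_def)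
      then show ?thesis using T by (intro bexI[of _ T]) auto
    next
      case False
      then have j4: "1 \<le> Suc j" "Suc j \<le> K - 1" using j2 by auto
      have "x \<le> g (Suc j)" using g[OF j4] j3 gumbel_cdf_le_iff[of x "g (Suc j)"] by (simp add: add_divide_distrib)
      moreover have "gumbel_cdf (g (Suc j)) - gumbel_cdf x \<le> 1 / real K" using g[OF j4] j3 by (simp add: add_divide_distrib)
      moreover have "g (Suc j) \<in> G" using j4 by (auto simp: G_def)
      ultimately show ?thesis by (intro bexI[of _ "g (Suc j)"]) (auto simp: max_def)
    qed
  qed
  define h where "h = e / 8"
  have "eventually (\<lambda>n. \<forall>a\<in>G. \<forall>b\<in>G. \<bar>F n a b - H a b\<bar> < h) sequentially"
  proof (intro eventually_ball_finite ballI)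
    fix a b
    have "(\<lambda>n. \<bar>F n a b - H a b\<bar>) \<longlonglongrightarrow> \<bar>H a b - H a b\<bar>" by (intro tendsto_intros lim)
    then show "eventually (\<lambda>n. \<bar>F n a b - H a b\<bar> < h) sequentially"
      by (rule order_tendstoD) (use e in \<open>simp add: h_def\<close>)
  qed (simp_all add: G_def)
  then obtain n0 where n0: "\<And>n a b. n \<ge> n0 \<Longrightarrow> a \<in> G \<Longrightarrow> b \<in> G \<Longrightarrow> \<bar>F n a b - H a b\<bar> < h"
    unfolding eventually_sequentially by blast
  show "\<exists>N. \<forall>n\<ge>N. norm ((SUP (x, y)\<in>UNIV. \<bar>F n x y - H x y\<bar>) - 0) < e"
  proof (intro exI[of _ "max n0 1"] allI impI)
    fix n assume "max n0 1 \<le> n"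
    then have n: "n \<ge> n0" "n \<ge> 1" by auto
    have bound: "\<bar>F n x y - H x y\<bar> \<le> 2 * h + 4 / real K" for x y
    proof -
      obtain b where b: "b \<in> G" "min x T \<le> b" "gumbel_cdf (max x b) - gumbel_cdf x \<le> 1 / real K" using upper by blast
      obtain c where c: "c \<in> G" "min y T \<le> c" "gumbel_cdf (max y c) - gumbel_cdf y \<le> 1 / real K" using upper by blast
      have "F n x y \<le> F n (min x T) (min y T) + (1 - F n T T)" by (rule F_clip[OF n(2)])
      also have "F n (min x T) (min y T) \<le> F n b c" by (rule F_mono[OF n(2) b(2) c(2)])
      finally have 1: "F n x y \<le> F n b c + (1 - F n T T)" by simp
      have 2: "\<bar>F n b c - H b c\<bar> < h" "\<bar>F n T T - H T T\<bar> < h" using n0[OF n(1)] b c T by auto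
      have "1 - 2 / real K \<le> gumbel_cdf T * gumbel_cdf T"
        unfolding T(2) using K(1) by (simp add: field_simps)
      then have 3: "1 - 2 / real K \<le> H T T" using H_ge[of T T] by linarith
      have "H b c \<le> H (max x b) (max y c)" by (rule H_mono) auto
      moreover have "H (max x b) (max y c) - H x y \<le> (gumbel_cdf (max x b) - gumbel_cdf x) + (gumbel_cdf (max y c) - gumbel_cdf y)"
        by (rule H_lip) auto
      ultimately have ub: "H b c - H x y \<le> (gumbel_cdf (max x b) - gumbel_cdf x) + (gumbel_cdf (max y c) - gumbel_cdf y)" by simp
      \<comment> \<open>The budget: \<open>h\<close> for \<open>F n b c\<close>,
        \<open>2 / K\<close> for returning from \<open>(b, c)\<close> to \<open>(x, y)\<close>, and
        \<open>h + 2 / K\<close> for \<open>1 - F n T T\<close>.\<close>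
      have up: "F n x y - H x y \<le> 2 * h + 4 / real K"
      proof -
        have "2 / real K = 2 * (1 / real K)" "4 / real K = 4 * (1 / real K)" by simp_all
        then show ?thesis using ub 1 2 3 b(3) c(3) by linarith
      qed
      have h: "0 \<le> h" and K0: "0 \<le> 1 / real K" using e by (simp_all add: h_def)
      have "- (2 * h + 4 / real K) \<le> F n x y - H x y"
      proof (cases "gumbel_cdf x \<le> 1 / real K \<or> gumbel_cdf y \<le> 1 / real K")
        case True
        then have "H x y \<le> 1 / real K" using H_le(1)[of x y] H_le(2)[of x y] by auto
        moreover have "4 / real K = 4 * (1 / real K)" by simp
        ultimately show ?thesis using F0[OF n(2), of x y] h K0 by linarith
      next
        case False
        then obtain a d where a: "a \<in> G" "a \<le> x" "gumbel_cdf x - gumbel_cdf a \<le> 1 / real K"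
          and d: "d \<in> G" "d \<le> y" "gumbel_cdf y - gumbel_cdf d \<le> 1 / real K" using lower by blast
        have "F n a d \<le> F n x y" by (rule F_mono[OF n(2) a(2) d(2)])
        moreover have "\<bar>F n a d - H a d\<bar> < h" using n0[OF n(1)] a d by auto
        moreover note H_lip[OF a(2) d(2)]
        moreover have "4 / real K = 4 * (1 / real K)" by simp
        ultimately show ?thesis using a(3) d(3) h K0 by linarith
      qed
      with up show ?thesis by (simp add: abs_le_iff)
    qed
    have b: "(SUP (x, y)\<in>UNIV. \<bar>F n x y - H x y\<bar>) \<le> 2 * h + 4 / real K"
      using bound by (intro cSUP_least) auto
    have "\<bar>F n 0 0 - H 0 0\<bar> \<le> (SUP (x, y)\<in>UNIV. \<bar>F n x y - H x y\<bar>)"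
      using bound by (intro cSUP_upper2[of _ _ "(0, 0)"] bdd_aboveI2[of _ _ "2 * h + 4 / real K"]) auto
    then have "0 \<le> (SUP (x, y)\<in>UNIV. \<bar>F n x y - H x y\<bar>)" using abs_ge_zero order_trans by blast
    moreover have "2 * h + 4 / real K < e" using K(2) e unfolding h_def by linarith
    ultimately show "norm ((SUP (x, y)\<in>UNIV. \<bar>F n x y - H x y\<bar>) - 0) < e" using b by simp
  qed
qed

text \<open>Carries the comparison of joint increments (\<open>a\<close>) with marginal ones
  (\<open>q\<close>) from a single pair to \<open>n\<close> pairs: splitting off one factor leaves
  products whose factors are dominated one by one.\<close>

lemma power_increment_mono:
  fixes a a' q q' :: real
  assumes "0 \<le> a" "a \<le> a'" "a \<le> q" "a' \<le> q'" "a' - a \<le> q' - q"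
  shows "a' ^ n - a ^ n \<le> q' ^ n - q ^ n"
proof (induction n)
  case (Suc n)
  have "a' ^ Suc n - a ^ Suc n = a' * (a' ^ n - a ^ n) + (a' - a) * a ^ n"
    by (simp add: algebra_simps)
  also have "\<dots> \<le> q' * (q' ^ n - q ^ n) + (q' - q) * q ^ n"
    using assms Suc by (intro add_mono mult_mono power_mono) (auto intro: power_mono)
  also have "\<dots> = q' ^ Suc n - q ^ Suc n" by (simp add: algebra_simps)
  finally show ?case .
qed simp

lemma norm_u_mono: "x \<le> y \<Longrightarrow> norm_u n x \<le> norm_u n y"
proof -
  assume "x \<le> y"
  moreover have "0 \<le> norm_a n" by (cases "n = 0") (simp_all add: norm_a_def)
  ultimately show ?thesis unfolding norm_u_def by (intro add_right_mono mult_left_mono)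
qed

definition marginal_prob :: "nat \<Rightarrow> real \<Rightarrow> real" where
  "marginal_prob n x = measure std_normal_distribution {..norm_u n x}"

lemma marginal_prob_power_tendsto: "(\<lambda>n. marginal_prob n x ^ n) \<longlonglongrightarrow> gumbel_cdf x"
proof -
  interpret N: prob_space std_normal_distribution by (rule prob_space_std_normal)
  have "1 - marginal_prob n x = measure std_normal_distribution {norm_u n x<..}" for n
  proof -
    have "measure std_normal_distribution (space std_normal_distribution - {..norm_u n x}) = 1 - marginal_prob n x"
      unfolding marginal_prob_def by (rule N.prob_compl) simp
    moreover have "space std_normal_distribution - {..norm_u n x} = {norm_u n x<..}" by auto
    ultimately show ?thesis by simp
  qed
  then have "(\<lambda>n. real n * (1 - marginal_prob n x)) \<longlonglongrightarrow> exp (- x)"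
    using std_normal_tail_tendsto by simp
  then show ?thesis unfolding gumbel_cdf_def
    by (rule power_tendsto_exp_minus[rotated 2]) (simp_all add: marginal_prob_def)
qed

text \<open>Raising one level adds a strip cut by the other event; without the cut it is the
  marginal increment, since both coordinates of the model are standard normal.\<close>

lemma pair_prob_increments:
  assumes r: "\<bar>r\<bar> \<le> 1" and x: "x \<le> x'" and y: "y \<le> y'"
  shows "pair_prob n r x y \<le> pair_prob n r x' y"
    and "pair_prob n r x y \<le> pair_prob n r x y'"
    and "pair_prob n r x y \<le> marginal_prob n x"
    and "pair_prob n r x y \<le> marginal_prob n y"
    and "pair_prob n r x' y - pair_prob n r x y \<le> marginal_prob n x' - marginal_prob n x"
    and "pair_prob n r x y' - pair_prob n r x y \<le> marginal_prob n y' - marginal_prob n y"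
proof -
  interpret N: prob_space std_normal_distribution by (rule prob_space_std_normal)
  interpret P: pair_prob_space std_normal_distribution std_normal_distribution ..
  have [measurable_cong]: "sets std_normal_distribution = sets borel" by simp
  let ?P = std_normal_plane
  let ?Y = "\<lambda>z. r * fst z + sqrt (1 - r\<^sup>2) * snd z"
  define A where "A = (\<lambda>x. {z \<in> space ?P. fst z \<le> norm_u n x})"
  define B where "B = (\<lambda>y. {z \<in> space ?P. ?Y z \<le> norm_u n y})"
  note G = gaussian_cf_std_normal_plane[OF r]
  have dist: "distr ?P borel fst = std_normal_distribution" "distr ?P borel ?Y = std_normal_distribution"
    using gaussian_cf_std_normal[OF G, of 1] gaussian_cf_std_normal[OF G, of 2] by simp_all
  have s[measurable]: "A x \<in> sets ?P" "B y \<in> sets ?P" for x y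
    unfolding A_def B_def by measurable
  have mA: "measure ?P (A x) = marginal_prob n x" for x
    unfolding marginal_prob_def A_def
    by (subst dist(1)[symmetric], subst measure_distr) (auto intro!: arg_cong[where f="measure ?P"])
  have mB: "measure ?P (B y) = marginal_prob n y" for y
    unfolding marginal_prob_def B_def
    by (subst dist(2)[symmetric], subst measure_distr) (auto intro!: arg_cong[where f="measure ?P"])
  have p: "pair_prob n r x y = measure ?P (A x \<inter> B y)" for x y
    unfolding pair_prob_def A_def B_def by (intro arg_cong[where f="measure ?P"]) auto
  have sub: "A x \<subseteq> A x'" "B y \<subseteq> B y'"
    using norm_u_mono[OF x, of n] norm_u_mono[OF y, of n] unfolding A_def B_def by auto
  show "pair_prob n r x y \<le> pair_prob n r x' y" "pair_prob n r x y \<le> pair_prob n r x y'"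
    unfolding p using sub by (intro P.finite_measure_mono[OF _ sets.Int[OF s]]; blast)+
  show "pair_prob n r x y \<le> marginal_prob n x"
    unfolding p mA[symmetric] by (rule P.finite_measure_mono[OF _ s(1)]) blast
  show "pair_prob n r x y \<le> marginal_prob n y"
    unfolding p mB[symmetric] by (rule P.finite_measure_mono[OF _ s(2)]) blast
  have d: "measure ?P (C' \<inter> D) - measure ?P (C \<inter> D) \<le> measure ?P C' - measure ?P C"
    if [measurable]: "C \<in> sets ?P" "C' \<in> sets ?P" "D \<in> sets ?P" and "C \<subseteq> C'" for C C' D
  proof -
    have "measure ?P (C' \<inter> D) - measure ?P (C \<inter> D) = measure ?P (C' \<inter> D - C \<inter> D)"
      using that by (intro P.finite_measure_Diff[symmetric]) auto
    also have "\<dots> \<le> measure ?P (C' - C)" by (rule P.finite_measure_mono[OF _ sets.Diff[OF that(2) that(1)]]) auto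
    also have "\<dots> = measure ?P C' - measure ?P C" using that by (intro P.finite_measure_Diff) auto
    finally show ?thesis .
  qed
  show "pair_prob n r x' y - pair_prob n r x y \<le> marginal_prob n x' - marginal_prob n x"
    unfolding p mA[symmetric] by (rule d[OF s(1) s(1) s(2) sub(1)])
  show "pair_prob n r x y' - pair_prob n r x y \<le> marginal_prob n y' - marginal_prob n y"
    unfolding p mB[symmetric] Int_commute[of "A x"] by (rule d[OF s(2) s(2) s(1) sub(2)])
qed

text \<open>Apart from the product bound, everything is the limit of the same statement for powers
  of \<open>pair_prob\<close> and \<open>marginal_prob\<close>, so \<open>huesler_reiss\<close> is
  never differentiated.\<close>

lemma huesler_reiss_properties:
  assumes lam: "0 \<le> lam" "(\<lambda>n. ereal ((1 - r n) * ln (real n))) \<longlonglongrightarrow> lam\<^sup>2"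
    and r: "eventually (\<lambda>n. \<bar>r n\<bar> \<le> 1) sequentially"
  shows "huesler_reiss lam x y \<le> gumbel_cdf x" "huesler_reiss lam x y \<le> gumbel_cdf y"
    and "gumbel_cdf x * gumbel_cdf y \<le> huesler_reiss lam x y"
    and "x \<le> x' \<Longrightarrow> y \<le> y' \<Longrightarrow> huesler_reiss lam x y \<le> huesler_reiss lam x' y'"
    and "x \<le> x' \<Longrightarrow> y \<le> y' \<Longrightarrow>
       huesler_reiss lam x' y' - huesler_reiss lam x y \<le> (gumbel_cdf x' - gumbel_cdf x) + (gumbel_cdf y' - gumbel_cdf y)"
proof -
  note lim = pair_prob_power_tendsto[OF lam r]
  note mlim = marginal_prob_power_tendsto
  have ev: "eventually Q sequentially" if "\<And>n. \<bar>r n\<bar> \<le> 1 \<Longrightarrow> Q n" for Q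
    using r by eventually_elim (rule that)
  show "huesler_reiss lam x y \<le> gumbel_cdf x"
    by (rule tendsto_le[OF _ mlim lim]) (auto intro!: ev power_mono pair_prob_increments pair_prob_bounds)
  show "huesler_reiss lam x y \<le> gumbel_cdf y"
    by (rule tendsto_le[OF _ mlim lim]) (auto intro!: ev power_mono pair_prob_increments pair_prob_bounds)
  \<comment> \<open>The joint exceedance rate is nonnegative and can only raise the value above that
    of independent margins.\<close>
  have "0 \<le> (\<integral>s. indicator {x<..} s * (exp (- s) * limit_exceedance lam y s) \<partial>lborel)"
    by (intro Bochner_Integration.integral_nonneg) (auto simp: limit_exceedance_def)
  then have "exp (- (exp (- x) + exp (- y))) \<le> huesler_reiss lam x y"
    unfolding huesler_reiss_exponent[OF lam(1), symmetric] by simp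
  then show "gumbel_cdf x * gumbel_cdf y \<le> huesler_reiss lam x y"
    by (simp add: gumbel_cdf_def exp_add[symmetric])
  assume x: "x \<le> x'" and y: "y \<le> y'"
  have 1: "huesler_reiss lam x y \<le> huesler_reiss lam x' y"
    by (rule tendsto_le[OF _ lim lim]) (auto intro!: ev power_mono pair_prob_increments pair_prob_bounds x)
  have 2: "huesler_reiss lam x' y \<le> huesler_reiss lam x' y'"
    by (rule tendsto_le[OF _ lim lim]) (auto intro!: ev power_mono pair_prob_increments pair_prob_bounds y)
  show "huesler_reiss lam x y \<le> huesler_reiss lam x' y'" using 1 2 by simp
  have 3: "huesler_reiss lam x' y - huesler_reiss lam x y \<le> gumbel_cdf x' - gumbel_cdf x"
    by (rule tendsto_le[OF _ tendsto_diff[OF mlim mlim] tendsto_diff[OF lim lim]])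
       (auto intro!: ev power_increment_mono pair_prob_increments pair_prob_bounds x)
  have 4: "huesler_reiss lam x' y' - huesler_reiss lam x' y \<le> gumbel_cdf y' - gumbel_cdf y"
    by (rule tendsto_le[OF _ tendsto_diff[OF mlim mlim] tendsto_diff[OF lim lim]])
       (auto intro!: ev power_increment_mono pair_prob_increments pair_prob_bounds y)
  show "huesler_reiss lam x' y' - huesler_reiss lam x y \<le> (gumbel_cdf x' - gumbel_cdf x) + (gumbel_cdf y' - gumbel_cdf y)"
    using 3 4 by simp
qed

section \<open>The comparison error\<close>

text \<open>The quadratic form is nonnegative at the vectors with entries \<open>1, 1\<close> and
  \<open>1, - 1\<close> at \<open>k\<close> and \<open>l\<close>.\<close>

lemma abs_covariance_le_1:
  assumes Z: "gaussian_cf N K Z S" and kl: "k \<in> K" "l \<in> K" "k \<noteq> l"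
    and S: "S k k = 1" "S l l = 1" "S k l = S l k"
  shows "\<bar>S k l\<bar> \<le> 1"
proof -
  have K: "finite K" using gaussian_cfD(2)[OF Z] .
  have "0 \<le> 2 + 2 * c * S k l" if c: "c = 1 \<or> c = - 1" for c
  proof -
    let ?t = "\<lambda>m. if m = k then 1 else if m = l then c else 0"
    have "quad_form K S ?t = quad_form {k, l} S ?t"
      using K kl by (intro quad_form_support) auto
    also have "\<dots> = 2 + 2 * c * S k l"
      using kl S c by (auto simp: quad_form_def)
    finally show ?thesis using quad_form_nonneg[OF Z, of ?t] by simp
  qed
  from this[of 1] this[of "- 1"] show ?thesis by simp
qed

text \<open>The last term of \<open>norm_u_square\<close> is nonnegative and dropped; the logarithm
  in \<open>norm_b\<close> costs the factor \<open>ln n\<close>.\<close>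

lemma exp_norm_u_square_le:
  assumes n: "n \<ge> 2"
  shows "exp (- (norm_u n m)\<^sup>2) \<le> 4 * pi * exp (- 2 * m) * ln (real n) / (real n)\<^sup>2"
proof -
  define L where "L = ln (real n)"
  have L: "L > 0" using n by (simp add: L_def)
  have "2 * L + 2 * m - ln (4 * pi * L) \<le> (norm_u n m)\<^sup>2"
    unfolding norm_u_square[OF n] L_def[symmetric] using L by simp
  then have "exp (- (norm_u n m)\<^sup>2) \<le> exp (- 2 * m + (ln (4 * pi * L) - 2 * L))" by simp
  also have "\<dots> = exp (- 2 * m) * (exp (ln (4 * pi * L)) / exp (of_nat 2 * L))"
    by (simp only: exp_add exp_diff) simp
  also have "\<dots> = exp (- 2 * m) * (4 * pi * L / (real n)\<^sup>2)"
    using L n unfolding exp_of_nat_mult by (simp add: L_def)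
  finally show ?thesis by (simp add: L_def mult_ac)
qed

lemma short_range_error_tendsto:
  fixes \<sigma> \<alpha> m :: real and I :: "nat \<Rightarrow> real"
  assumes \<sigma>: "0 \<le> \<sigma>" and \<alpha>: "0 < \<alpha>" "\<alpha> < (1 - \<sigma>) / (1 + \<sigma>)"
    and I: "\<And>n. n \<ge> 1 \<Longrightarrow> 0 \<le> I n \<and> I n \<le> real n powr \<alpha>"
  shows "(\<lambda>n. real n * (2 * I n + 1) * exp (- (norm_u n m)\<^sup>2 / (1 + \<sigma>))) \<longlonglongrightarrow> 0"
proof -
  define \<gamma> where "\<gamma> = 1 / (1 + \<sigma>)"
  \<comment> \<open>Since \<open>(1 - \<sigma>) / (1 + \<sigma>) = 2 * \<gamma> - 1\<close>, the
    upper bound on \<open>\<alpha>\<close> says exactly \<open>\<beta> > 0\<close>, and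
    \<open>n powr (- \<beta>)\<close> beats the power of \<open>ln n\<close>.\<close>
  define \<beta> where "\<beta> = 2 * \<gamma> - 1 - \<alpha>"
  define C where "C = (4 * pi * exp (- 2 * m)) powr \<gamma>"
  have \<gamma>: "\<gamma> > 0" using \<sigma> by (simp add: \<gamma>_def)
  have "(1 - \<sigma>) / (1 + \<sigma>) = 2 * \<gamma> - 1" using \<sigma> by (simp add: \<gamma>_def field_simps)
  then have \<beta>: "\<beta> > 0" using \<alpha> by (simp add: \<beta>_def)
  have lim: "(\<lambda>n. 3 * C * (ln (real n) powr \<gamma> * real n powr (- \<beta>))) \<longlonglongrightarrow> 3 * C * 0"
    using \<gamma> \<beta> by (intro tendsto_mult tendsto_const) real_asymp
  have "eventually (\<lambda>n. norm (real n * (2 * I n + 1) * exp (- (norm_u n m)\<^sup>2 / (1 + \<sigma>)))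
     \<le> 3 * C * (ln (real n) powr \<gamma> * real n powr (- \<beta>))) sequentially"
    using eventually_ge_at_top[of 2]
  proof eventually_elim
    case (elim n)
    have L: "ln (real n) > 0" using elim by simp
    have In: "0 \<le> I n" "I n \<le> real n powr \<alpha>" using I[of n] elim by auto
    have "1 \<le> real n powr \<alpha>" using elim \<alpha> by (intro ge_one_powr_ge_zero) auto
    then have 1: "2 * I n + 1 \<le> 3 * real n powr \<alpha>" using In by simp
    have "exp (- (norm_u n m)\<^sup>2 / (1 + \<sigma>)) = exp (- (norm_u n m)\<^sup>2) powr \<gamma>"
      by (simp add: powr_def \<gamma>_def)
    also have "\<dots> \<le> (4 * pi * exp (- 2 * m) * ln (real n) / (real n)\<^sup>2) powr \<gamma>"
      using \<gamma> exp_norm_u_square_le[OF elim, of m] by (intro powr_mono2) auto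
    also have "\<dots> = C * (ln (real n) powr \<gamma> * real n powr (- (2 * \<gamma>)))"
    proof -
      have "(real n)\<^sup>2 powr \<gamma> = real n powr (2 * \<gamma>)"
        using elim by (simp add: powr_powr flip: powr_numeral)
      then show ?thesis
        using L elim unfolding C_def by (simp add: powr_mult powr_divide powr_minus_divide)
    qed
    finally have 2: "exp (- (norm_u n m)\<^sup>2 / (1 + \<sigma>)) \<le> C * (ln (real n) powr \<gamma> * real n powr (- (2 * \<gamma>)))" .
    have "real n * (2 * I n + 1) * exp (- (norm_u n m)\<^sup>2 / (1 + \<sigma>))
       \<le> real n * (3 * real n powr \<alpha>) * (C * (ln (real n) powr \<gamma> * real n powr (- (2 * \<gamma>))))"
      using 1 2 In by (intro mult_mono) auto
    also have "\<dots> = 3 * C * (ln (real n) powr \<gamma> * (real n powr 1 * real n powr \<alpha> * real n powr (- (2 * \<gamma>))))"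
      using elim by simp
    also have "real n powr 1 * real n powr \<alpha> * real n powr (- (2 * \<gamma>)) = real n powr (- \<beta>)"
      unfolding powr_add[symmetric] \<beta>_def by (simp add: algebra_simps)
    finally show ?case using In by simp
  qed
  from Lim_null_comparison[OF this] lim show ?thesis by simp
qed

text \<open>By \<open>1 / (1 + \<mu>) \<ge> 1 - \<mu>\<close> the denominator costs a factor
  \<open>exp (\<mu> * u\<^sup>2)\<close>, bounded because eventually
  \<open>u\<^sup>2 \<le> 3 * ln n\<close> (any constant above 2 would do). The rest,
  \<open>n\<^sup>2 * \<mu> * exp (- u\<^sup>2)\<close>, is of order
  \<open>\<mu> * ln n\<close>.\<close>

lemma long_range_error_tendsto:
  fixes \<mu> :: "nat \<Rightarrow> real"
  assumes \<mu>: "(\<lambda>n. \<mu> n * ln (real n)) \<longlonglongrightarrow> 0" and \<mu>0: "eventually (\<lambda>n. 0 \<le> \<mu> n) sequentially"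
  shows "(\<lambda>n. (real n)\<^sup>2 * (\<mu> n * exp (- (norm_u n m)\<^sup>2 / (1 + \<mu> n)))) \<longlonglongrightarrow> 0"
proof -
  define C where "C = 4 * pi * exp (- 2 * m)"
  have lim: "(\<lambda>n. C * (\<mu> n * ln (real n)) * exp (3 * (\<mu> n * ln (real n)))) \<longlonglongrightarrow> C * 0 * exp (3 * 0)"
    by (intro tendsto_intros \<mu>)
  have "eventually (\<lambda>n. 2 * ln (real n) + 2 * (m - ln (4 * pi * ln (real n)) / 2) + (m - ln (4 * pi * ln (real n)) / 2)\<^sup>2 / (2 * ln (real n)) \<le> 3 * ln (real n)) sequentially"
    by real_asymp
  then have "eventually (\<lambda>n. norm ((real n)\<^sup>2 * (\<mu> n * exp (- (norm_u n m)\<^sup>2 / (1 + \<mu> n)))) \<le> C * (\<mu> n * ln (real n)) * exp (3 * (\<mu> n * ln (real n)))) sequentially"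
    using \<mu>0 eventually_ge_at_top[of 2]
  proof eventually_elim
    case (elim n)
    define v where "v = (norm_u n m)\<^sup>2"
    have v: "0 \<le> v" by (simp add: v_def)
    have v3: "v \<le> 3 * ln (real n)" using elim(1) unfolding v_def norm_u_square[OF elim(3)] .
    have "- v / (1 + \<mu> n) \<le> - v + \<mu> n * v"
    proof -
      have "(- v + \<mu> n * v) * (1 + \<mu> n) = - v + \<mu> n * (\<mu> n * v)" by (simp add: algebra_simps)
      moreover have "0 \<le> \<mu> n * (\<mu> n * v)" using v elim by simp
      ultimately have "- v \<le> (- v + \<mu> n * v) * (1 + \<mu> n)" by linarith
      moreover have "0 < 1 + \<mu> n" using elim by linarith
      ultimately show ?thesis by (subst pos_divide_le_eq)
    qed
    also have "\<dots> \<le> - v + 3 * (\<mu> n * ln (real n))" using mult_left_mono[OF v3, of "\<mu> n"] elim by simp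
    finally have "exp (- v / (1 + \<mu> n)) \<le> exp (- v + 3 * (\<mu> n * ln (real n)))" by simp
    also have "\<dots> = exp (- v) * exp (3 * (\<mu> n * ln (real n)))" by (rule exp_add)
    also have "\<dots> \<le> C * ln (real n) / (real n)\<^sup>2 * exp (3 * (\<mu> n * ln (real n)))"
      unfolding v_def C_def by (intro mult_right_mono exp_norm_u_square_le elim) auto
    finally have "(real n)\<^sup>2 * (\<mu> n * exp (- v / (1 + \<mu> n))) \<le> (real n)\<^sup>2 * (\<mu> n * (C * ln (real n) / (real n)\<^sup>2 * exp (3 * (\<mu> n * ln (real n)))))"
      using elim by (intro mult_left_mono) auto
    also have "\<dots> = C * (\<mu> n * ln (real n)) * exp (3 * (\<mu> n * ln (real n)))" using elim by simp
    finally show ?case using elim by (simp add: v_def)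
  qed
  from Lim_null_comparison[OF this] lim show ?thesis by simp
qed

text \<open>Around each of the \<open>2 * n\<close> indices at most \<open>2 * (2 * d + 1)\<close>
  lie within lag \<open>d\<close> and are charged \<open>A\<close>; all \<open>2 * n\<close> are
  charged \<open>B\<close>.\<close>

lemma double_sum_lag_bound:
  fixes f :: "nat \<times> nat \<Rightarrow> nat \<times> nat \<Rightarrow> real"
  assumes K_def: "K = {1, 2::nat} \<times> {1..n}"
    and AB: "0 \<le> A" "0 \<le> B"
    and f: "\<And>p q. p \<in> K \<Longrightarrow> q \<in> K \<Longrightarrow> f p q \<le> (if nat \<bar>int (snd p) - int (snd q)\<bar> < d then A else B)"
    and f0: "\<And>p q. p \<in> K \<Longrightarrow> q \<in> K - {p} \<Longrightarrow> 0 \<le> f p q"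
  shows "(\<Sum>p\<in>K. \<Sum>q\<in>K - {p}. f p q) \<le> 4 * (real n * (2 * real d + 1) * A) + 4 * ((real n)\<^sup>2 * B)"
proof -
  have fin: "finite (K)" by (simp add: K_def)
  have "(\<Sum>q\<in>K - {p}. f p q) \<le> 2 * (2 * real d + 1) * A + 2 * real n * B" if p: "p \<in> K" for p
  proof -
    let ?N = "{1, 2::nat} \<times> {snd p - d..snd p + d}"
    have "(\<Sum>q\<in>K - {p}. f p q) \<le> (\<Sum>q\<in>K - {p}. (if q \<in> ?N then A else 0) + B)"
    proof (rule sum_mono)
      fix q assume q: "q \<in> K - {p}"
      show "f p q \<le> (if q \<in> ?N then A else 0) + B"
      proof (cases "nat \<bar>int (snd p) - int (snd q)\<bar> < d")
        case True
        then have "snd q \<in> {snd p - d..snd p + d}" by auto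
        moreover have "fst q \<in> {1, 2}" using q by (auto simp: K_def)
        ultimately have "q \<in> ?N" by (cases q) auto
        with f[OF p, of q] True AB q show ?thesis by auto
      next
        case False
        with f[OF p, of q] AB q show ?thesis by auto
      qed
    qed
    also have "\<dots> \<le> (\<Sum>q\<in>K. (if q \<in> ?N then A else 0) + B)"
      using AB fin by (intro sum_mono2) auto
    also have "\<dots> = (\<Sum>q\<in>K \<inter> ?N. A) + real (card (K)) * B"
      unfolding sum.distrib sum.inter_restrict[OF fin, symmetric] by simp
    also have "(\<Sum>q\<in>K \<inter> ?N. A) \<le> (\<Sum>q\<in>?N. A)"
      using AB by (intro sum_mono2) auto
    also have "(\<Sum>q\<in>?N. A) \<le> 2 * (2 * real d + 1) * A"
    proof -
      have "card ?N \<le> 2 * (2 * d + 1)" by (simp add: card_cartesian_product)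
      then have "real (card ?N) \<le> real (2 * (2 * d + 1))" by (rule of_nat_mono)
      then have "real (card ?N) \<le> 2 * (2 * real d + 1)" by (simp del: card_cartesian_product)
      then show ?thesis using AB by (simp add: mult_right_mono del: card_cartesian_product)
    qed
    finally show ?thesis by (simp add: K_def card_cartesian_product)
  qed
  then have "(\<Sum>p\<in>K. \<Sum>q\<in>K - {p}. f p q) \<le> (\<Sum>p\<in>K. 2 * (2 * real d + 1) * A + 2 * real n * B)"
    by (rule sum_mono)
  also have "\<dots> = 4 * (real n * (2 * real d + 1) * A) + 4 * ((real n)\<^sup>2 * B)"
    by (simp add: K_def card_cartesian_product power2_eq_square algebra_simps)
  finally show ?thesis .
qed

theorem theorem1p1:
  fixes M :: "'a measure"
    and X :: "nat \<Rightarrow> nat \<Rightarrow> nat \<Rightarrow> 'a \<Rightarrow> real"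
    and \<rho>0 :: "nat \<Rightarrow> real"
    and \<rho> :: "nat \<Rightarrow> nat \<Rightarrow> nat \<Rightarrow> nat \<Rightarrow> real"
    and \<sigma> \<alpha> :: real
    and I :: "nat \<Rightarrow> nat"
    and lam :: ereal
  assumes "prob_space M"
    and gaussian: "\<And>n. n \<ge> 1 \<Longrightarrow>
          jointly_gaussian M ({1, 2} \<times> {1..n}) (\<lambda>(i, k). X i n k)"
    and mean: "\<And>i n k. i \<in> {1, 2} \<Longrightarrow> 1 \<le> k \<Longrightarrow> k \<le> n \<Longrightarrow>
          prob_space.expectation M (X i n k) = 0"
    and var: "\<And>i n k. i \<in> {1, 2} \<Longrightarrow> 1 \<le> k \<Longrightarrow> k \<le> n \<Longrightarrow>
          prob_space.variance M (X i n k) = 1"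
    and corr0: "\<And>n k. 1 \<le> k \<Longrightarrow> k \<le> n \<Longrightarrow>
          correlation M (X 1 n k) (X 2 n k) = \<rho>0 n"
    and corr: "\<And>i j n k l. i \<in> {1, 2} \<Longrightarrow> j \<in> {1, 2} \<Longrightarrow>
          1 \<le> k \<Longrightarrow> k \<le> n \<Longrightarrow> 1 \<le> l \<Longrightarrow> l \<le> n \<Longrightarrow> k \<noteq> l \<Longrightarrow>
          correlation M (X i n k) (X j n l) = \<rho> i j (nat \<bar>int k - int l\<bar>) n"
    and sigma: "\<sigma> = Sup {\<bar>\<rho> i j k n\<bar> | i j k n.
          n \<ge> 2 \<and> 1 \<le> k \<and> k < n \<and> i \<in> {1, 2} \<and> j \<in> {1, 2}}"
    and sigma_less: "\<sigma> < 1"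
    and alpha: "0 < \<alpha>" "\<alpha> < (1 - \<sigma>) / (1 + \<sigma>)"
    and I: "\<And>n. n \<ge> 1 \<Longrightarrow> I n = nat \<lfloor>real n powr \<alpha>\<rfloor>"
    and long_range: "(\<lambda>n. Max {\<bar>\<rho> i j k n\<bar> | i j k.
          I n \<le> k \<and> k < n \<and> i \<in> {1, 2} \<and> j \<in> {1, 2}} * ln (real n)) \<longlonglongrightarrow> 0"
    and lam_nonneg: "0 \<le> lam"
    and lam: "(\<lambda>n. ereal ((1 - \<rho>0 n) * ln (real n))) \<longlonglongrightarrow> lam\<^sup>2"
  shows "(\<lambda>n. SUP (x, y) \<in> (UNIV :: (real \<times> real) set).
          \<bar>measure M {\<omega> \<in> space M.
              row_max (X 1) n \<omega> \<le> norm_u n x \<and> row_max (X 2) n \<omega> \<le> norm_u n y}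
            - huesler_reiss lam x y\<bar>) \<longlonglongrightarrow> 0"
proof -
  interpret prob_space M by fact
  define Z where "Z = (\<lambda>n p. X (fst p) n (snd p))"
  define K where "K = (\<lambda>n::nat. {1, 2::nat} \<times> {1..n})"
  define S where "S = (\<lambda>n p q. expectation (\<lambda>\<omega>. Z n p \<omega> * Z n q \<omega>))"
  have G: "gaussian_cf M (K n) (Z n) (S n)" if "n \<ge> 1" for n
    unfolding S_def
  proof (rule jointly_gaussian_cf)
    show "jointly_gaussian M (K n) (Z n)"
      using gaussian[OF that] by (simp add: K_def Z_def split_beta')
    show "expectation (Z n p) = 0" if "p \<in> K n" for p
      using that mean by (auto simp: K_def Z_def)
  qed
  have S_corr: "S n p q = correlation M (Z n p) (Z n q)" if "p \<in> K n" "q \<in> K n" for n p q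
    using that mean var by (auto simp: S_def correlation_def K_def Z_def)
  have S_diag: "S n p p = 1" if "p \<in> K n" for n p
    using that mean[of "fst p" "snd p" n] var[of "fst p" "snd p" n] by (auto simp: S_def K_def Z_def power2_eq_square)
  have S_sym: "S n p q = S n q p" for n p q
    by (simp add: S_def mult.commute)
  have S_rho: "S n p q = \<rho> (fst p) (fst q) (nat \<bar>int (snd p) - int (snd q)\<bar>) n" if "p \<in> K n" "q \<in> K n" "snd p \<noteq> snd q" for n p q
    using that corr[of "fst p" "fst q" "snd p" n "snd q"] by (auto simp: S_corr Z_def) (auto simp: K_def)
  have S_12: "S n (1, k) (2, k) = \<rho>0 n" if "1 \<le> k" "k \<le> n" for n k
    using that corr0[of k n] by (subst S_corr) (auto simp: K_def Z_def)
  have S_le1: "\<bar>S n p q\<bar> \<le> 1" if "n \<ge> 1" "p \<in> K n" "q \<in> K n" "p \<noteq> q" for n p q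
    using that by (intro abs_covariance_le_1[OF G] S_diag S_sym)
  have \<rho>0_le: "\<bar>\<rho>0 n\<bar> \<le> 1" if "n \<ge> 1" for n
    using S_le1[of n "(1, 1)" "(2, 1)"] S_12[of 1 n] that by (simp add: K_def)
  \<comment> \<open>Lag \<open>k\<close> is realised by the positions 1 and \<open>k + 1\<close>.
    The bound makes the set under \<open>Sup\<close> bounded above, without which
    \<open>\<sigma>\<close> would say nothing about its elements.\<close>
  have \<rho>_le1: "\<bar>\<rho> i j k n\<bar> \<le> 1" if "1 \<le> k" "k < n" "i \<in> {1, 2}" "j \<in> {1, 2}" for i j k n
    using S_le1[of n "(i, 1)" "(j, Suc k)"] S_rho[of "(i, 1)" n "(j, Suc k)"] that by (simp add: K_def)
  have \<rho>_le: "\<bar>\<rho> i j k n\<bar> \<le> \<sigma>" if "n \<ge> 2" "1 \<le> k" "k < n" "i \<in> {1, 2}" "j \<in> {1, 2}" for i j k n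
    unfolding sigma using that \<rho>_le1
    by (intro cSup_upper bdd_aboveI[of _ 1]) blast+
  have \<sigma>: "0 \<le> \<sigma>" using \<rho>_le[of 2 1 1 1] by simp
  \<comment> \<open>Gives \<open>I n < n\<close> for \<open>n \<ge> 2\<close>, so that the maximum
    \<open>\<mu> n\<close> runs over a nonempty set and is nonnegative.\<close>
  have "\<alpha> < 1"
  proof -
    have "(1 - \<sigma>) / (1 + \<sigma>) \<le> 1" using \<sigma> by (simp add: divide_le_eq)
    then show ?thesis using alpha by simp
  qed
  define \<mu> where "\<mu> = (\<lambda>n. Max {\<bar>\<rho> i j k n\<bar> | i j k. I n \<le> k \<and> k < n \<and> i \<in> {1, 2} \<and> j \<in> {1, 2}})"
  have \<mu>_ge: "\<bar>\<rho> i j k n\<bar> \<le> \<mu> n" if "I n \<le> k" "k < n" "i \<in> {1, 2}" "j \<in> {1, 2}" for i j k n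
    unfolding \<mu>_def
  proof (rule Max_ge)
    show "finite {\<bar>\<rho> i j k n\<bar> | i j k. I n \<le> k \<and> k < n \<and> i \<in> {1, 2} \<and> j \<in> {1, 2}}"
    proof (rule finite_subset)
      show "{\<bar>\<rho> i j k n\<bar> | i j k. I n \<le> k \<and> k < n \<and> i \<in> {1, 2} \<and> j \<in> {1, 2}}
          \<subseteq> (\<lambda>(i, j, k). \<bar>\<rho> i j k n\<bar>) ` ({1, 2} \<times> {1, 2} \<times> {..<n})"
      proof clarify
        fix i j k :: nat assume "k < n" "i \<in> {1, 2}" "j \<in> {1, 2}"
        then show "\<bar>\<rho> i j k n\<bar> \<in> (\<lambda>(i, j, k). \<bar>\<rho> i j k n\<bar>) ` ({1, 2} \<times> {1, 2} \<times> {..<n})"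
          by (intro image_eqI[of _ _ "(i, j, k)"]) auto
      qed
    qed auto
  qed (use that in blast)
  have I_le: "real (I n) \<le> real n powr \<alpha>" if "n \<ge> 1" for n
    unfolding I[OF that] by (simp add: of_nat_nat)
  have \<mu>0: "0 \<le> \<mu> n" if "n \<ge> 2" for n
  proof -
    have "real n powr \<alpha> < real n powr 1" using that \<open>\<alpha> < 1\<close> by (intro powr_less_mono) auto
    then have "I n < n" using I_le[of n] that by simp
    then have "\<bar>\<rho> 1 1 (I n) n\<bar> \<le> \<mu> n" by (intro \<mu>_ge) auto
    then show ?thesis using abs_ge_zero order_trans by blast
  qed
  define F where "F = (\<lambda>n x y. measure M {\<omega> \<in> space M. row_max (X 1) n \<omega> \<le> norm_u n x \<and> row_max (X 2) n \<omega> \<le> norm_u n y})"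
  define u where "u = (\<lambda>n x y (p :: nat \<times> nat). if fst p = 1 then norm_u n x else norm_u n y)"
  have event: "{\<omega> \<in> space M. row_max (X 1) n \<omega> \<le> norm_u n x \<and> row_max (X 2) n \<omega> \<le> norm_u n y}
      = {\<omega> \<in> space M. \<forall>p\<in>K n. Z n p \<omega> \<le> u n x y p}" if "n \<ge> 1" for n x y
    using that by (auto simp: row_max_def K_def Z_def u_def)
  define c where "c = 1 / (pi * sqrt (1 - \<sigma>\<^sup>2))"
  have \<sigma>2: "1 - \<sigma>\<^sup>2 > 0" using \<sigma> sigma_less by (simp add: abs_square_less_1)
  then have c: "c \<ge> 0" by (simp add: c_def)
  \<comment> \<open>Bounds for one summand: a short lag has weight at most 1 and
    \<open>\<sigma>\<close> in the exponent, a long one has \<open>\<mu> n\<close> in both places;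
    the square root is bounded through \<open>\<sigma>\<close> in either case.\<close>
  define A where "A = (\<lambda>n m. c * exp (- (norm_u n m)\<^sup>2 / (1 + \<sigma>)))"
  define B where "B = (\<lambda>n m. c * (\<mu> n * exp (- (norm_u n m)\<^sup>2 / (1 + \<mu> n))))"
  define err where "err = (\<lambda>n m. 4 * (real n * (2 * real (I n) + 1) * A n m) + 4 * ((real n)\<^sup>2 * B n m))"
  have compare: "\<bar>F n x y - pair_prob n (\<rho>0 n) x y ^ n\<bar> \<le> err n (min x y)"
    if n: "n \<ge> 2" and w: "0 \<le> norm_u n (min x y)" for n x y
  proof -
    have n1: "n \<ge> 1" using n by simp
    let ?w = "norm_u n (min x y)"
    \<comment> \<open>The covariance of \<open>n\<close> independent copies of the pair at position
      1.\<close>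
    define T where "T = (\<lambda>p q :: nat \<times> nat. if snd p = snd q then S n (fst p, 1) (fst q, 1) else 0)"
    \<comment> \<open>Across positions \<open>T\<close> is 0, so the larger of the two moduli is
      that of \<open>S\<close>.\<close>
    define R where "R = (\<lambda>p q :: nat \<times> nat. \<bar>\<rho> (fst p) (fst q) (nat \<bar>int (snd p) - int (snd q)\<bar>) n\<bar>)"
    have one: "gaussian_cf M ({1, 2} \<times> {1}) (Z n) (S n)"
      by (rule gaussian_cf_mono[OF G[OF n1]]) (use n in \<open>auto simp: K_def\<close>)
    have pair: "gaussian_cf M {1, 2} (\<lambda>i. Z n (i, 1)) (\<lambda>i j. S n (i, 1) (j, 1))"
      by (rule gaussian_cf_reindex[OF one]) (auto simp: bij_betw_def inj_on_def)
    have Y: "gaussian_cf (PiM {1..n} (\<lambda>_. M)) (K n) (\<lambda>p \<omega>. Z n (fst p, 1) (\<omega> (snd p))) T"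
      unfolding K_def T_def by (rule gaussian_cf_iid_copies[OF pair]) simp
    have in_K: "(i, 1) \<in> K n" if "i \<in> {1, 2}" for i using that n by (auto simp: K_def)
    \<comment> \<open>Inside a pair the correlation does not depend on the position, so the matrices
      agree; here \<open>\<rho>0 n\<close> drops out of the error, however close to 1 it is.\<close>
    have S_T: "S n p q = T p q" if "p \<in> K n" "q \<in> K n" "snd p = snd q" for p q
    proof -
      define i j k where "i = fst p" "j = fst q" "k = snd p"
      then have pq: "p = (i, k)" "q = (j, k)" using that by (simp_all add: prod_eq_iff)
      then have k: "1 \<le> k" "k \<le> n" and ij: "i \<in> {1, 2}" "j \<in> {1, 2}" using that by (auto simp: K_def)
      show ?thesis
        using ij S_12[OF k] S_12[of 1 n] S_sym[of n "(2, k)" "(1, k)"] S_sym[of n "(2, 1)" "(1, 1)"] n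
          S_diag[of "(i, k)" n] S_diag[of "(i, 1)" n] that in_K[OF ij(1)]
        unfolding pq T_def by auto
    qed
    have R_le: "R p q \<le> \<sigma>" if "p \<in> K n" "q \<in> K n" "snd p \<noteq> snd q" for p q
      unfolding R_def using that n by (intro \<rho>_le) (auto simp: K_def)
    have R_le_\<mu>: "R p q \<le> \<mu> n" if "p \<in> K n" "q \<in> K n" "snd p \<noteq> snd q" "I n \<le> nat \<bar>int (snd p) - int (snd q)\<bar>" for p q
      unfolding R_def using that n by (intro \<mu>_ge) (auto simp: K_def)
    have S_R: "\<bar>S n p q - T p q\<bar> = R p q" if "p \<in> K n" "q \<in> K n" "snd p \<noteq> snd q" for p q
      using that S_rho[OF that] by (simp add: R_def T_def)
    have "\<bar>measure M {\<omega> \<in> space M. \<forall>p\<in>K n. Z n p \<omega> \<le> u n x y p}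
        - measure (PiM {1..n} (\<lambda>_. M)) {\<omega> \<in> space (PiM {1..n} (\<lambda>_. M)). \<forall>p\<in>K n. Z n (fst p, 1) (\<omega> (snd p)) \<le> u n x y p}\<bar>
       \<le> (\<Sum>p\<in>K n. \<Sum>q\<in>K n - {p}. \<bar>S n p q - T p q\<bar> * (exp (- ?w\<^sup>2 / (1 + R p q)) / (pi * sqrt (1 - (R p q)\<^sup>2))))"
    proof (rule normal_comparison[OF G[OF n1] Y])
      show "T p p = 1" if "p \<in> K n" for p
        using S_T[OF that that] S_diag[OF that] by simp
      show "T p q = T q p" for p q using S_sym[of n "(fst p, 1)" "(fst q, 1)"] by (simp add: T_def)
      show "\<bar>S n p q\<bar> \<le> R p q \<and> \<bar>T p q\<bar> \<le> R p q \<and> R p q < 1"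
        if "p \<in> K n" "q \<in> K n" "p \<noteq> q" "S n p q \<noteq> T p q" for p q
      proof -
        have ne: "snd p \<noteq> snd q" using S_T that by blast
        then have "T p q = 0" by (simp add: T_def)
        with S_R[OF that(1,2) ne] R_le[OF that(1,2) ne] sigma_less show ?thesis by simp
      qed
      show "?w \<le> \<bar>u n x y p\<bar>" for p
        using norm_u_mono[of "min x y" x n] norm_u_mono[of "min x y" y n] by (auto simp: u_def)
    qed (use S_diag S_sym w in auto)
    also have "measure (PiM {1..n} (\<lambda>_. M)) {\<omega> \<in> space (PiM {1..n} (\<lambda>_. M)). \<forall>p\<in>K n. Z n (fst p, 1) (\<omega> (snd p)) \<le> u n x y p}
       = measure M {\<omega> \<in> space M. \<forall>i\<in>{1, 2}. Z n (i, 1) \<omega> \<le> (if i = 1 then norm_u n x else norm_u n y)} ^ n"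
      using measure_iid_copies_orthant[OF pair, of "{1..n}" "\<lambda>i. if i = 1 then norm_u n x else norm_u n y"]
      unfolding K_def u_def by simp
    also have "measure M {\<omega> \<in> space M. \<forall>i\<in>{1, 2}. Z n (i, 1) \<omega> \<le> (if i = 1 then norm_u n x else norm_u n y)} = pair_prob n (\<rho>0 n) x y"
      using gaussian_pair_orthant[OF pair, of "\<rho>0 n" "\<lambda>i. if i = 1 then norm_u n x else norm_u n y"] S_12[of 1 n] S_sym[of n "(2, 1)" "(1, 1)"]
        S_diag[OF in_K] \<rho>0_le[OF n1] n unfolding pair_prob_def by simp
    also have "measure M {\<omega> \<in> space M. \<forall>p\<in>K n. Z n p \<omega> \<le> u n x y p} = F n x y"
      unfolding F_def event[OF n1] ..
    also have "(\<Sum>p\<in>K n. \<Sum>q\<in>K n - {p}. \<bar>S n p q - T p q\<bar> * (exp (- ?w\<^sup>2 / (1 + R p q)) / (pi * sqrt (1 - (R p q)\<^sup>2)))) \<le> err n (min x y)"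
      unfolding err_def
    proof (rule double_sum_lag_bound)
      show "K n = {1, 2} \<times> {1..n}" by (simp add: K_def)
      show A0: "0 \<le> A n (min x y)" and B0: "0 \<le> B n (min x y)"
        using c \<mu>0[OF n] by (simp_all add: A_def B_def)
      have R0: "0 \<le> R p q" for p q by (simp add: R_def)
      \<comment> \<open>\<open>b\<close> bounds the weight and \<open>b'\<close> the correlation in
        the exponent; they are chosen differently for short lags.\<close>
      have gen: "\<bar>S n p q - T p q\<bar> * (exp (- ?w\<^sup>2 / (1 + R p q)) / (pi * sqrt (1 - (R p q)\<^sup>2))) \<le> c * (b * exp (- ?w\<^sup>2 / (1 + b')))"
        if pq: "p \<in> K n" "q \<in> K n" "snd p \<noteq> snd q" and b: "R p q \<le> b" "R p q \<le> b'" for p q b b'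
      proof -
        have R2: "(R p q)\<^sup>2 \<le> \<sigma>\<^sup>2" using R_le[OF pq] R0 by (intro power_mono) auto
        have "?w\<^sup>2 / (1 + b') \<le> ?w\<^sup>2 / (1 + R p q)" using b R0[of p q] by (intro divide_left_mono) auto
        then have "exp (- ?w\<^sup>2 / (1 + R p q)) / (pi * sqrt (1 - (R p q)\<^sup>2)) \<le> exp (- ?w\<^sup>2 / (1 + b')) / (pi * sqrt (1 - \<sigma>\<^sup>2))"
          using R2 \<sigma>2 by (intro frac_le mult_left_mono) auto
        then have "\<bar>S n p q - T p q\<bar> * (exp (- ?w\<^sup>2 / (1 + R p q)) / (pi * sqrt (1 - (R p q)\<^sup>2))) \<le> b * (exp (- ?w\<^sup>2 / (1 + b')) / (pi * sqrt (1 - \<sigma>\<^sup>2)))"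
          unfolding S_R[OF pq] using b R0[of p q] R2 \<sigma>2 by (intro mult_mono) auto
        then show ?thesis by (simp add: c_def)
      qed
      fix p q assume pq: "p \<in> K n" "q \<in> K n"
      show "\<bar>S n p q - T p q\<bar> * (exp (- ?w\<^sup>2 / (1 + R p q)) / (pi * sqrt (1 - (R p q)\<^sup>2)))
         \<le> (if nat \<bar>int (snd p) - int (snd q)\<bar> < I n then A n (min x y) else B n (min x y))"
      proof (cases "snd p = snd q")
        case True
        then show ?thesis using S_T[OF pq] A0 B0 by simp
      next
        case ne: False
        show ?thesis
        proof (cases "nat \<bar>int (snd p) - int (snd q)\<bar> < I n")
          case True
          then show ?thesis using gen[OF pq ne, of 1 \<sigma>] R_le[OF pq ne] sigma_less by (simp add: A_def)
        next
          case False
          then show ?thesis using gen[OF pq ne, of "\<mu> n" "\<mu> n"] R_le_\<mu>[OF pq ne] by (simp add: B_def)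
        qed
      qed
    next
      fix p q assume pq: "p \<in> K n" "q \<in> K n - {p}"
      show "0 \<le> \<bar>S n p q - T p q\<bar> * (exp (- ?w\<^sup>2 / (1 + R p q)) / (pi * sqrt (1 - (R p q)\<^sup>2)))"
      proof (cases "snd p = snd q")
        case False
        then have "0 \<le> R p q" "R p q < 1" using R_le[of p q] pq sigma_less by (auto simp: R_def)
        then have "(R p q)\<^sup>2 < 1" by (simp add: abs_square_less_1)
        then show ?thesis by simp
      qed (use S_T pq in simp)
    qed
    finally show ?thesis by simp
  qed
  have err_lim: "(\<lambda>n. err n m) \<longlonglongrightarrow> 0" for m
  proof -
    have "(\<lambda>n. 4 * (c * (real n * (2 * real (I n) + 1) * exp (- (norm_u n m)\<^sup>2 / (1 + \<sigma>)))) + 4 * (c * ((real n)\<^sup>2 * (\<mu> n * exp (- (norm_u n m)\<^sup>2 / (1 + \<mu> n))))))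
       \<longlonglongrightarrow> 4 * (c * 0) + 4 * (c * 0)"
    proof (intro tendsto_add tendsto_mult tendsto_const)
      show "(\<lambda>n. real n * (2 * real (I n) + 1) * exp (- (norm_u n m)\<^sup>2 / (1 + \<sigma>))) \<longlonglongrightarrow> 0"
        by (rule short_range_error_tendsto[OF \<sigma> alpha]) (use I_le in auto)
      show "(\<lambda>n. (real n)\<^sup>2 * (\<mu> n * exp (- (norm_u n m)\<^sup>2 / (1 + \<mu> n)))) \<longlonglongrightarrow> 0"
      proof (rule long_range_error_tendsto)
        show "(\<lambda>n. \<mu> n * ln (real n)) \<longlonglongrightarrow> 0" unfolding \<mu>_def by (rule long_range)
        show "eventually (\<lambda>n. 0 \<le> \<mu> n) sequentially" by (rule eventually_sequentiallyI[of 2]) (rule \<mu>0)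
      qed
    qed
    then show ?thesis by (simp add: err_def A_def B_def mult_ac)
  qed
  have r: "eventually (\<lambda>n. \<bar>\<rho>0 n\<bar> \<le> 1) sequentially"
    using \<rho>0_le by (auto intro!: eventually_sequentiallyI[of 1])
  note HR = huesler_reiss_properties[OF lam_nonneg lam r]
  have "(\<lambda>n. SUP (x, y)\<in>UNIV. \<bar>F n x y - huesler_reiss lam x y\<bar>) \<longlonglongrightarrow> 0"
  proof (rule bivariate_uniform_convergence)
    fix x y :: real
    \<comment> \<open>The comparison requires a nonnegative lower level, which holds for large
      \<open>n\<close> because the levels tend to infinity.\<close>
    have "eventually (\<lambda>n. 0 \<le> sqrt (2 * ln (real n)) + (min x y - ln (4 * pi * ln (real n)) / 2) / sqrt (2 * ln (real n))) sequentially"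
      by real_asymp
    then have "eventually (\<lambda>n. norm (F n x y - pair_prob n (\<rho>0 n) x y ^ n) \<le> err n (min x y)) sequentially"
      using eventually_ge_at_top[of 2] by eventually_elim (simp add: compare norm_u_eq)
    from tendsto_add[OF Lim_null_comparison[OF this err_lim] pair_prob_power_tendsto[OF lam_nonneg lam r, of x y]]
    show "(\<lambda>n. F n x y) \<longlonglongrightarrow> huesler_reiss lam x y" by simp
  next
    fix n :: nat and x y x' y' :: real
    assume n: "n \<ge> 1"
    note [measurable] = gaussian_cfD(3)[OF G[OF n]]
    have fin: "finite (K n)" by (simp add: K_def)
    define E where "E = (\<lambda>x y. {\<omega> \<in> space M. \<forall>p\<in>K n. Z n p \<omega> \<le> u n x y p})"
    have F: "F n x y = prob (E x y)" for x y unfolding F_def event[OF n] E_def ..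
    have E[measurable]: "E x y \<in> events" for x y
      unfolding E_def using fin by measurable
    have E_eq: "E x y = {\<omega> \<in> space M. (\<forall>k\<in>{1..n}. X 1 n k \<omega> \<le> norm_u n x) \<and> (\<forall>k\<in>{1..n}. X 2 n k \<omega> \<le> norm_u n y)}" for x y
      unfolding E_def by (auto simp: K_def Z_def u_def)
    show "0 \<le> F n x y" by (simp add: F)
    show "F n x y \<le> F n x' y'" if "x \<le> x'" "y \<le> y'"
    proof -
      have "E x y \<subseteq> E x' y'"
        unfolding E_eq using norm_u_mono[OF that(1), of n] norm_u_mono[OF that(2), of n] by (auto intro: order_trans)
      then show ?thesis unfolding F by (rule finite_measure_mono) (rule E)
    qed
    \<comment> \<open>With this, the intersection of two orthants is the orthant at the minima, as
      the clipping inequality demands.\<close>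
    have m: "norm_u n (min a b) = min (norm_u n a) (norm_u n b)" for a b
      using norm_u_mono[of a b n] norm_u_mono[of b a n] by (auto simp: min_def)
    have "E x y \<inter> E x' y' = E (min x x') (min y y')" unfolding E_eq m by auto
    moreover have "prob (E x y) \<le> prob (E x y \<inter> E x' y') + (1 - prob (E x' y'))"
    proof -
      have "prob (E x y) \<le> prob ((E x y \<inter> E x' y') \<union> (space M - E x' y'))"
        by (intro finite_measure_mono) (auto simp: E_def)
      also have "\<dots> \<le> prob (E x y \<inter> E x' y') + prob (space M - E x' y')"
        by (rule measure_Un_le) auto
      finally show ?thesis by (simp add: prob_compl)
    qed
    ultimately show "F n x y \<le> F n (min x x') (min y y') + (1 - F n x' y')" by (simp add: F)
  qed (use HR in auto)
  then show ?thesis by (simp only: F_def)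
qed

end
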